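(* Consider the pricing model described in the context. Suppose that $H^{-1}$ admits an $(s_n,r_{1n})$-sparse approximation, that the design is regular, that the optimal prices satisfy $0<p_O^\star<\bar p\cdot e_O$ (entrywise), and that $s_n\sqrt{\log(|V_O|)/n}+r_{1n}=o(1)$. Let $\check W^\mu$ and $\check v$ be the thresholded estimator of $H^{-1}$ and the debiased estimator of $v_O$ (defined in the context), with thresholds such that, for some constant $C_0>0$, with probability $1-o(1)$, $2|\check W_{kj}-(H^{-1})_{kj}|\le\mu_{kj}\le C_0\sqrt{\log|V_O|/n}$ for all $k,j\in V_O$. Define $$\hat p_O=\Big(\big[(\check W^\mu+(\check W^\mu)^T)^{-1}\check v\big]\wedge\bar p\cdot e_O\Big)_+ .$$ Then, for some constant $C_1>0$, with probability $1-o(1)$, $$R(\hat p_O)\le C_1\Big(s_n^2\,\frac{\log|V_O|}{n}+r_{1n}^2\Big),\qquad R(p_O):=\frac{\Pi(p_O^\star)-\Pi(p_O)}{\Pi(p_O^\star)} .$$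
   Context: **Asymptotics.** $n$ is the number of periods, $[n]=\{1,\dots,n\}$; limits are as $n\to\infty$. The network, its sizes, the agents' parameters, the data distribution, $s_n,r_{1n},M_\varepsilon,M_\Psi$ may depend on $n$. A "constant" is a number not depending on $n$ or on the network sizes; $\bar p>0,\bar a,\bar b,\zeta$ are constants. **Pricing model.** $V=V_O\sqcup V_L$ is a finite set of agents (observable and latent), $G\in\mathbb R_{\ge0}^{V\times V}$ the weights. In period $t$, agent $i$ consuming $y_i\ge0$ at unit price $p_i$ gets payoff $u_i^{(t)}(y_i,y_{-i},p_i)=(a_i+\xi_i^{(t)})y_i-b_iy_i^2+\sum_jG_{ij}y_iy_j-p_iy_i$, where $0<a_i\le\bar a$, $0<b_i\le\bar b$, and the taste shocks $\xi^{(t)}$ have zero mean and are independent over $t$ (possibly correlated across agents). For prices $p$, consumption is at a consumption equilibrium: $y\ge0$ with $y_i\in\arg\max_{z\ge0}u_i^{(t)}(z,y_{-i},p_i)$ for all $i\in V$. Put $\lambda_i=2b_i$, $\bar\lambda=2\bar b$, $\Lambda=\mathrm{diag}(\lambda_i)$, $M=\Lambda-G$. There is $\zeta>0$ with $\lambda_i\ge\sum_jG_{ij}+\zeta$ and $\lambda_i\ge\sum_jG_{ji}+\zeta$ for all $i$. Latent agents always face the outside price $\bar p$; prices for observable agents lie in $[0,\bar p]$; and $\mathbb P(a_i+\xi_i^{(t)}>\bar p)=1$ for all $i,t$. Subscripts $O,L$ denote sub-vectors/blocks for $V_O,V_L$; $e_O$ is the all-ones vector in $\mathbb R^{V_O}$.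 Put $S_{OL}=M_{OL}M_{LL}^{-1}$, $H=M_{OO}-M_{OL}M_{LL}^{-1}M_{LO}$, $v_O=H^{-1}a_O-H^{-1}S_{OL}(a_L-p_L)$ with $p_L=\bar p\cdot e_L$, $\varepsilon_O^{(t)}=H^{-1}\xi_O^{(t)}-H^{-1}S_{OL}\xi_L^{(t)}$; then equilibrium consumption of the observable agents is $$y_O^{(t)}=v_O-H^{-1}p_O^{(t)}+\varepsilon_O^{(t)}.\qquad( * )$$ The seller observes only $\{(p_O^{(t)},y_O^{(t)})\}_{t\in[n]}$. For a price vector $p_O$, $\Pi(p_O)=E[\langle p_O,y_O(p_O)\rangle]$ is the expected revenue, where $y_O(p_O)$ is the equilibrium consumption of observable agents under $p_O$ and the expectation is over taste shocks; $p_O^\star$ maximizes $\Pi$ over $0\le p_O\le\bar p\cdot e_O$. For a vector $x$, $[(x\wedge\bar p\cdot e_O)_+]_i=\min\{\bar p,\max\{x_i,0\}\}$. **Norms and indices.** $\|A\|_1,\|A\|_\infty$ are the maximum absolute column and row sums; $A_{k,\cdot}$ and $A_{\cdot,k}$ the $k$th row and column. $\bar V_O=\{0\}\cup V_O$; $(1;p_O^{(t)})\in\mathbb R^{\bar V_O}$ has $0$th entry $1$ and $j$th entry $p_j^{(t)}$. $\mathbf 1_{kj}=1$ if $k=j$, else $0$. $\Phi$ is the standard normal CDF. **Sparse approximation.** A matrix is $s$-sparse if each row and each column has at most $s$ nonzero entries. $H^{-1}$ admits an $(s,r_1)$-sparse approximation if there is an $s$-sparse $\bar W$ with $\max\{\|H^{-1}-\bar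 W\|_1,\|H^{-1}-\bar W\|_\infty\}\le r_1$. **Regular design.** The design is regular if, for constants $0<c<C$, $C'>0$ and parameters $M_\varepsilon,M_\Psi\ge1$: 1. the data $(p_O^{(t)},y_O^{(t)})$, $t\in[n]$, are i.i.d. and satisfy $( * )$, and $E[\varepsilon_O^{(t)}\mid p_O^{(t)}]=0$; 2. for all $t$: $\min_{j\in V_O}E[(\varepsilon_j^{(t)})^2\mid p_O^{(t)}]\ge c$, $\max_{j\in V_O}E[|\varepsilon_j^{(t)}|^4\mid p_O^{(t)}]\le C$, and $E[\max_{t\in[n],j\in V_O}|\varepsilon_j^{(t)}|^4\mid\{p_O^{(t)}\}]\le M_\varepsilon$; 3. $\bar\Psi:=E[(1;p_O^{(t)})(1;p_O^{(t)})^T]^{-1}$ satisfies $\min_{k,j\in\bar V_O}E[\{\bar\Psi_{k,\cdot}(1;p_O^{(t)})(1;p_O^{(t)})_j-\mathbf 1_{kj}\}^2]\ge c$, $\max_{k,j\in\bar V_O}E[|\bar\Psi_{k,\cdot}(1;p_O^{(t)})(1;p_O^{(t)})_j|^4]\le C$, $E[\max_{t\in[n];j,k\in\bar V_O}|\bar\Psi_{k,\cdot}(1;p_O^{(t)})(1;p_O^{(t)})_j|^4]\le M_\Psi$, and the eigenvalues of $\bar\Psi$ are bounded above by a constant; 4. $s_n^2(\log|V_O|)(\log n)^3=o(n)$, $M_\varepsilon M_\Psi\log|V_O|=o(n)$, $C'\log|V_O|\ge\log n$. **Estimators.** Put $M_n^2=1\vee\max_{k\in V_O}\frac1n\sum_t(p_k^{(t)})^4$,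 $\tau=\frac1{4M_n}$, $\lambda=\frac1{\sqrt n}\Phi^{-1}\big(1-\frac1{3n|V_O|^2}\big)$, $\hat\Sigma=\frac1n\sum_t(1;p_O^{(t)})(1;p_O^{(t)})^T$. Step 1: $(\hat W,\hat v,\hat z)$ minimizes $\sum_{k\in V_O}\big(\|(\tilde v_k,\tilde W_{k,\cdot})\|_1+\tau z_k\big)$ over $(\tilde W,\tilde v,z)$ subject to, for all $k\in V_O$, $j\in\bar V_O$: $\big|\frac1n\sum_t\{y_k^{(t)}-(\tilde v_k-\tilde W_{k,\cdot}p_O^{(t)})\}(1;p_O^{(t)})_j\big|\le\lambda z_k$ and $\big\{\frac1n\sum_t\{y_k^{(t)}-(\tilde v_k-\tilde W_{k,\cdot}p_O^{(t)})\}^2(1;p_O^{(t)})_j^2\big\}^{1/2}\le z_k$. Step 2: $\hat\Psi\in\mathbb R^{\bar V_O\times\bar V_O}$ is the $\Psi$-part of a minimizer of $\sum_{k\in\bar V_O}\big\{\big(\frac1n\sum_t|\Psi_{k,\cdot}(1;p_O^{(t)})|^4\big)^{1/4}+z_k\big\}$ over $(z,\Psi)$ subject to, for all $k,j\in\bar V_O$: $|\Psi_{k,\cdot}\hat\Sigma_{\cdot,j}-\mathbf 1_{kj}|\le\lambda z_k$ and $\big\{\frac1n\sum_t\{\Psi_{k,\cdot}(1;p_O^{(t)})(1;p_O^{(t)})_j-\mathbf 1_{kj}\}^2\big\}^{1/2}\le z_k$. Step 3 (debiased estimator): $(-\check v^T;\check W^T)=(-\hat v^T;\hat W^T)-\hat\Psi\big\{\frac1n\sum_t(1;p_O^{(t)})\{y_O^{(t)}-(\hat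 v-\hat Wp_O^{(t)})\}^T\big\}$. Step 4 (thresholded estimator, for thresholds $\mu_{kj}$): $\check W^\mu_{kj}=\check W_{kj}\,1\{|\check W_{kj}|>\mu_{kj}\}$, $k,j\in V_O$. *)

theory Defs
  imports "HOL-Probability.Probability" "HOL-Library.Landau_Symbols"
begin

section \<open>Matrices over finite index sets\<close>

text \<open>Vectors and matrices are functions of which only the values on a finite index set matter.\<close>

definition mv_on :: "'j set \<Rightarrow> ('i \<Rightarrow> 'j \<Rightarrow> real) \<Rightarrow> ('j \<Rightarrow> real) \<Rightarrow> 'i \<Rightarrow> real" where
  "mv_on J A x = (\<lambda>i. \<Sum>j\<in>J. A i j * x j)"

definition mm_on :: "'j set \<Rightarrow> ('i \<Rightarrow> 'j \<Rightarrow> real) \<Rightarrow> ('j \<Rightarrow> 'k \<Rightarrow> real) \<Rightarrow> 'i \<Rightarrow> 'k \<Rightarrow> real" where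
  "mm_on J A B = (\<lambda>i k. \<Sum>j\<in>J. A i j * B j k)"

definition inverse_pair_on :: "'i set \<Rightarrow> ('i \<Rightarrow> 'i \<Rightarrow> real) \<Rightarrow> ('i \<Rightarrow> 'i \<Rightarrow> real) \<Rightarrow> bool" where
  "inverse_pair_on I A B \<longleftrightarrow>
     (\<forall>i\<in>I. \<forall>j\<in>I. mm_on I A B i j = of_bool (i = j) \<and> mm_on I B A i j = of_bool (i = j))"

definition invertible_on :: "'i set \<Rightarrow> ('i \<Rightarrow> 'i \<Rightarrow> real) \<Rightarrow> bool" where
  "invertible_on I A \<longleftrightarrow> (\<exists>B. inverse_pair_on I A B)"

text \<open>Determined on \<open>I \<times> I\<close> when \<open>A\<close> is invertible there, and an unspecified matrix otherwise.\<close>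

definition inv_on :: "'i set \<Rightarrow> ('i \<Rightarrow> 'i \<Rightarrow> real) \<Rightarrow> 'i \<Rightarrow> 'i \<Rightarrow> real" where
  "inv_on I A = (SOME B. inverse_pair_on I A B)"

definition eigenvalue_on :: "'i set \<Rightarrow> ('i \<Rightarrow> 'i \<Rightarrow> real) \<Rightarrow> real \<Rightarrow> bool" where
  "eigenvalue_on I A \<mu> \<longleftrightarrow> (\<exists>x. (\<exists>i\<in>I. x i \<noteq> 0) \<and> (\<forall>i\<in>I. mv_on I A x i = \<mu> * x i))"

definition norm_1_on :: "'i set \<Rightarrow> ('i \<Rightarrow> 'i \<Rightarrow> real) \<Rightarrow> real" where
  "norm_1_on I A = (MAX j\<in>I. \<Sum>i\<in>I. \<bar>A i j\<bar>)"

definition norm_inf_on :: "'i set \<Rightarrow> ('i \<Rightarrow> 'i \<Rightarrow> real) \<Rightarrow> real" where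
  "norm_inf_on I A = (MAX i\<in>I. \<Sum>j\<in>I. \<bar>A i j\<bar>)"

definition sparse_on :: "'i set \<Rightarrow> nat \<Rightarrow> ('i \<Rightarrow> 'i \<Rightarrow> real) \<Rightarrow> bool" where
  "sparse_on I s A \<longleftrightarrow>
     (\<forall>i\<in>I. card {j\<in>I. A i j \<noteq> 0} \<le> s) \<and> (\<forall>j\<in>I. card {i\<in>I. A i j \<noteq> 0} \<le> s)"

definition sparse_approximable_on ::
    "'i set \<Rightarrow> ('i \<Rightarrow> 'i \<Rightarrow> real) \<Rightarrow> nat \<Rightarrow> real \<Rightarrow> bool" where
  "sparse_approximable_on I A s r \<longleftrightarrow>
     (\<exists>W. sparse_on I s W \<and>
        max (norm_1_on I (\<lambda>i j. A i j - W i j)) (norm_inf_on I (\<lambda>i j. A i j - W i j)) \<le> r)"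


section \<open>The pricing model\<close>

text \<open>
  One instance of the model: observable agents, latent agents, network weights \<open>G\<close>, the payoff
  coefficients \<open>a\<close> and \<open>b\<close>, the probability space, and, per period, the random vectors of taste
  shocks (all agents), of prices (observable agents) and of consumptions (all agents).
\<close>

record ('v, 'w) pricing =
  VO :: "'v set"
  VL :: "'v set"
  weight :: "'v \<Rightarrow> 'v \<Rightarrow> real"
  acoef :: "'v \<Rightarrow> real"
  bcoef :: "'v \<Rightarrow> real"
  pspace :: "'w measure"
  shock :: "nat \<Rightarrow> 'w \<Rightarrow> 'v \<Rightarrow> real"
  price :: "nat \<Rightarrow> 'w \<Rightarrow> 'v \<Rightarrow> real"
  cons :: "nat \<Rightarrow> 'w \<Rightarrow> 'v \<Rightarrow> real"

definition agents :: "('v, 'w) pricing \<Rightarrow> 'v set" where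
  "agents D = VO D \<union> VL D"

text \<open>
  Payoff of agent \<open>i\<close> consuming \<open>z\<close> at unit price \<open>q\<close> under shocks \<open>\<xi>\<close>, when the others consume
  according to \<open>y\<close>; the value \<open>y i\<close> is irrelevant.
\<close>

definition payoff :: "('v, 'w) pricing \<Rightarrow> ('v \<Rightarrow> real) \<Rightarrow> 'v \<Rightarrow> real \<Rightarrow> ('v \<Rightarrow> real) \<Rightarrow> real \<Rightarrow> real" where
  "payoff D \<xi> i z y q =
     (acoef D i + \<xi> i) * z - bcoef D i * z\<^sup>2
       + (\<Sum>j\<in>agents D. weight D i j * z * (y(i := z)) j) - q * z"

definition consumption_equilibrium ::
    "('v, 'w) pricing \<Rightarrow> ('v \<Rightarrow> real) \<Rightarrow> ('v \<Rightarrow> real) \<Rightarrow> ('v \<Rightarrow> real) \<Rightarrow> bool" where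
  "consumption_equilibrium D \<xi> p y \<longleftrightarrow>
     (\<forall>i\<in>agents D. is_arg_max (\<lambda>z. payoff D \<xi> i z y (p i)) (\<lambda>z. 0 \<le> z) (y i))"

definition all_prices :: "('v, 'w) pricing \<Rightarrow> real \<Rightarrow> ('v \<Rightarrow> real) \<Rightarrow> 'v \<Rightarrow> real" where
  "all_prices D pbar p = (\<lambda>i. if i \<in> VO D then p i else pbar)"

definition pricing_model ::
    "real \<Rightarrow> real \<Rightarrow> real \<Rightarrow> real \<Rightarrow> nat \<Rightarrow> ('v, 'w) pricing \<Rightarrow> bool" where
  "pricing_model pbar abar bbar \<zeta> n D \<longleftrightarrow>
     finite (VO D) \<and> finite (VL D) \<and> VO D \<inter> VL D = {} \<and>
     (\<forall>i\<in>agents D. \<forall>j\<in>agents D. 0 \<le> weight D i j) \<and>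
     (\<forall>i\<in>agents D. 0 < acoef D i \<and> acoef D i \<le> abar) \<and>
     (\<forall>i\<in>agents D. 0 < bcoef D i \<and> bcoef D i \<le> bbar) \<and>
     (\<forall>i\<in>agents D. (\<Sum>j\<in>agents D. weight D i j) + \<zeta> \<le> 2 * bcoef D i) \<and>
     (\<forall>i\<in>agents D. (\<Sum>j\<in>agents D. weight D j i) + \<zeta> \<le> 2 * bcoef D i) \<and>
     prob_space (pspace D) \<and>
     prob_space.indep_vars (pspace D) (\<lambda>_. PiM (agents D) (\<lambda>_. borel))
       (\<lambda>t \<omega>. restrict (shock D t \<omega>) (agents D)) {1..n} \<and>
     (\<forall>t\<in>{1..n}. \<forall>i\<in>agents D.
        integrable (pspace D) (\<lambda>\<omega>. shock D t \<omega> i) \<and>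
        (\<integral>\<omega>. shock D t \<omega> i \<partial>pspace D) = 0 \<and>
        (AE \<omega> in pspace D. acoef D i + shock D t \<omega> i > pbar)) \<and>
     (\<forall>t\<in>{1..n}. \<forall>k\<in>VO D.
        (\<lambda>\<omega>. price D t \<omega> k) \<in> borel_measurable (pspace D) \<and>
        (AE \<omega> in pspace D. 0 \<le> price D t \<omega> k \<and> price D t \<omega> k \<le> pbar)) \<and>
     (\<forall>t\<in>{1..n}. AE \<omega> in pspace D.
        consumption_equilibrium D (shock D t \<omega>) (all_prices D pbar (price D t \<omega>)) (cons D t \<omega>))"

definition M_mat :: "('v, 'w) pricing \<Rightarrow> 'v \<Rightarrow> 'v \<Rightarrow> real" where
  "M_mat D i j = (if i = j then 2 * bcoef D i else 0) - weight D i j"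

text \<open>Only the \<open>VO \<times> VL\<close> entries are meaningful.\<close>

definition S_mat :: "('v, 'w) pricing \<Rightarrow> 'v \<Rightarrow> 'v \<Rightarrow> real" where
  "S_mat D = mm_on (VL D) (M_mat D) (inv_on (VL D) (M_mat D))"

definition H_mat :: "('v, 'w) pricing \<Rightarrow> 'v \<Rightarrow> 'v \<Rightarrow> real" where
  "H_mat D = (\<lambda>i j. M_mat D i j - mm_on (VL D) (S_mat D) (M_mat D) i j)"

definition H_inv :: "('v, 'w) pricing \<Rightarrow> 'v \<Rightarrow> 'v \<Rightarrow> real" where
  "H_inv D = inv_on (VO D) (H_mat D)"

definition v_vec :: "('v, 'w) pricing \<Rightarrow> real \<Rightarrow> 'v \<Rightarrow> real" where
  "v_vec D pbar = (\<lambda>k. mv_on (VO D) (H_inv D) (acoef D) k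
     - mv_on (VO D) (H_inv D) (mv_on (VL D) (S_mat D) (\<lambda>l. acoef D l - pbar)) k)"

definition eps :: "('v, 'w) pricing \<Rightarrow> nat \<Rightarrow> 'w \<Rightarrow> 'v \<Rightarrow> real" where
  "eps D t \<omega> = (\<lambda>k. mv_on (VO D) (H_inv D) (shock D t \<omega>) k
     - mv_on (VO D) (H_inv D) (mv_on (VL D) (S_mat D) (shock D t \<omega>)) k)"

definition equilibrium_consumption ::
    "('v, 'w) pricing \<Rightarrow> real \<Rightarrow> nat \<Rightarrow> ('v \<Rightarrow> real) \<Rightarrow> 'w \<Rightarrow> 'v \<Rightarrow> real" where
  "equilibrium_consumption D pbar t p \<omega> =
     (SOME y. consumption_equilibrium D (shock D t \<omega>) (all_prices D pbar p) y)"

text \<open>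
  Almost surely the equilibrium is unique on the agents and affine in the shocks, so the value does
  not depend on the period \<open>t\<close>. Integrating over the completion makes the choice of a consumption
  vector on the exceptional null set immaterial.
\<close>

definition expected_revenue :: "('v, 'w) pricing \<Rightarrow> real \<Rightarrow> nat \<Rightarrow> ('v \<Rightarrow> real) \<Rightarrow> real" where
  "expected_revenue D pbar t p =
     (\<integral>\<omega>. (\<Sum>k\<in>VO D. p k * equilibrium_consumption D pbar t p \<omega> k) \<partial>completion (pspace D))"

definition optimal_prices :: "('v, 'w) pricing \<Rightarrow> real \<Rightarrow> nat \<Rightarrow> ('v \<Rightarrow> real) \<Rightarrow> bool" where
  "optimal_prices D pbar t p \<longleftrightarrow>
     is_arg_max (expected_revenue D pbar t) (\<lambda>q. \<forall>k\<in>VO D. 0 \<le> q k \<and> q k \<le> pbar) p"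

text \<open>Relative revenue loss of \<open>p\<close> with respect to the prices \<open>pstar\<close>.\<close>

definition regret :: "('v, 'w) pricing \<Rightarrow> real \<Rightarrow> nat \<Rightarrow> ('v \<Rightarrow> real) \<Rightarrow> ('v \<Rightarrow> real) \<Rightarrow> real" where
  "regret D pbar t pstar p =
     (expected_revenue D pbar t pstar - expected_revenue D pbar t p) / expected_revenue D pbar t pstar"


section \<open>Regular designs\<close>

text \<open>The index set \<open>{0} \<union> X\<close> is encoded in the option type, with \<open>None\<close> in the role of \<open>0\<close>.\<close>

definition bar_ix :: "'v set \<Rightarrow> 'v option set" where
  "bar_ix X = insert None (Some ` X)"

definition aug :: "('v \<Rightarrow> real) \<Rightarrow> 'v option \<Rightarrow> real" where
  "aug p = case_option 1 p"

text \<open>The sigma-algebra generated by the price vectors of the periods in \<open>T\<close>.\<close>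

definition price_sigma :: "('v, 'w) pricing \<Rightarrow> nat set \<Rightarrow> 'w measure" where
  "price_sigma D T = vimage_algebra (space (pspace D))
     (\<lambda>\<omega>. restrict (\<lambda>(t, k). price D t \<omega> k) (T \<times> VO D)) (PiM (T \<times> VO D) (\<lambda>_. borel))"

definition observation_space :: "('v, 'w) pricing \<Rightarrow> (('v \<Rightarrow> real) \<times> ('v \<Rightarrow> real)) measure" where
  "observation_space D = PiM (VO D) (\<lambda>_. borel) \<Otimes>\<^sub>M PiM (VO D) (\<lambda>_. borel)"

definition observation :: "('v, 'w) pricing \<Rightarrow> nat \<Rightarrow> 'w \<Rightarrow> ('v \<Rightarrow> real) \<times> ('v \<Rightarrow> real)" where
  "observation D t \<omega> = (restrict (price D t \<omega>) (VO D), restrict (cons D t \<omega>) (VO D))"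

definition regular_sampling :: "real \<Rightarrow> nat \<Rightarrow> ('v, 'w) pricing \<Rightarrow> bool" where
  "regular_sampling pbar n D \<longleftrightarrow>
     prob_space.indep_vars (pspace D) (\<lambda>_. observation_space D) (observation D) {1..n} \<and>
     (\<forall>t\<in>{1..n}. \<forall>t'\<in>{1..n}.
        distr (pspace D) (observation_space D) (observation D t)
          = distr (pspace D) (observation_space D) (observation D t')) \<and>
     (\<forall>t\<in>{1..n}. AE \<omega> in pspace D. \<forall>k\<in>VO D.
        cons D t \<omega> k = v_vec D pbar k - mv_on (VO D) (H_inv D) (price D t \<omega>) k + eps D t \<omega> k) \<and>
     (\<forall>t\<in>{1..n}. \<forall>k\<in>VO D. AE \<omega> in pspace D.
        real_cond_exp (pspace D) (price_sigma D {t}) (\<lambda>\<omega>. eps D t \<omega> k) \<omega> = 0)"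

text \<open>
  The conditional moments are taken in \<open>ennreal\<close>: \<^const>\<open>real_cond_exp\<close> would turn an infinite
  conditional expectation into \<open>0\<close>.
\<close>

definition regular_noise :: "real \<Rightarrow> real \<Rightarrow> real \<Rightarrow> nat \<Rightarrow> ('v, 'w) pricing \<Rightarrow> bool" where
  "regular_noise c C M\<epsilon> n D \<longleftrightarrow>
     (\<forall>t\<in>{1..n}. \<forall>j\<in>VO D. AE \<omega> in pspace D.
        ennreal c \<le> nn_cond_exp (pspace D) (price_sigma D {t}) (\<lambda>\<omega>. ennreal ((eps D t \<omega> j)\<^sup>2)) \<omega>) \<and>
     (\<forall>t\<in>{1..n}. \<forall>j\<in>VO D. AE \<omega> in pspace D.
        nn_cond_exp (pspace D) (price_sigma D {t}) (\<lambda>\<omega>. ennreal (\<bar>eps D t \<omega> j\<bar> ^ 4)) \<omega> \<le> ennreal C) \<and>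
     (AE \<omega> in pspace D.
        nn_cond_exp (pspace D) (price_sigma D {1..n})
          (\<lambda>\<omega>. ennreal (MAX (t, j)\<in>{1..n} \<times> VO D. \<bar>eps D t \<omega> j\<bar> ^ 4)) \<omega> \<le> ennreal M\<epsilon>)"

definition second_moment :: "('v, 'w) pricing \<Rightarrow> nat \<Rightarrow> 'v option \<Rightarrow> 'v option \<Rightarrow> real" where
  "second_moment D t i j = (\<integral>\<omega>. aug (price D t \<omega>) i * aug (price D t \<omega>) j \<partial>pspace D)"

definition Psi_bar :: "('v, 'w) pricing \<Rightarrow> nat \<Rightarrow> 'v option \<Rightarrow> 'v option \<Rightarrow> real" where
  "Psi_bar D t = inv_on (bar_ix (VO D)) (second_moment D t)"

definition Psi_prod :: "('v, 'w) pricing \<Rightarrow> nat \<Rightarrow> 'w \<Rightarrow> 'v option \<Rightarrow> 'v option \<Rightarrow> real" where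
  "Psi_prod D t \<omega> k j =
     mv_on (bar_ix (VO D)) (Psi_bar D t) (aug (price D t \<omega>)) k * aug (price D t \<omega>) j"

definition regular_prices :: "real \<Rightarrow> real \<Rightarrow> real \<Rightarrow> real \<Rightarrow> nat \<Rightarrow> ('v, 'w) pricing \<Rightarrow> bool" where
  "regular_prices c C K M\<Psi> n D \<longleftrightarrow>
     (\<forall>t\<in>{1..n}. invertible_on (bar_ix (VO D)) (second_moment D t)) \<and>
     (\<forall>t\<in>{1..n}. \<forall>k\<in>bar_ix (VO D). \<forall>j\<in>bar_ix (VO D).
        c \<le> (\<integral>\<omega>. (Psi_prod D t \<omega> k j - of_bool (k = j))\<^sup>2 \<partial>pspace D) \<and>
        (\<integral>\<omega>. \<bar>Psi_prod D t \<omega> k j\<bar> ^ 4 \<partial>pspace D) \<le> C) \<and>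
     (\<integral>\<omega>. (MAX (t, k, j)\<in>{1..n} \<times> bar_ix (VO D) \<times> bar_ix (VO D). \<bar>Psi_prod D t \<omega> k j\<bar> ^ 4)
        \<partial>pspace D) \<le> M\<Psi> \<and>
     (\<forall>t\<in>{1..n}. \<forall>\<mu>. eigenvalue_on (bar_ix (VO D)) (Psi_bar D t) \<mu> \<longrightarrow> \<mu> \<le> K)"

definition regular_design ::
    "real \<Rightarrow> (nat \<Rightarrow> nat) \<Rightarrow> (nat \<Rightarrow> real) \<Rightarrow> (nat \<Rightarrow> real) \<Rightarrow> (nat \<Rightarrow> ('v, 'w) pricing) \<Rightarrow> bool" where
  "regular_design pbar s M\<epsilon> M\<Psi> D \<longleftrightarrow>
     (\<exists>c C C' K. 0 < c \<and> c < C \<and> 0 < C' \<and>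
        (\<forall>n\<ge>1. 1 \<le> M\<epsilon> n \<and> 1 \<le> M\<Psi> n \<and>
           regular_sampling pbar n (D n) \<and>
           regular_noise c C (M\<epsilon> n) n (D n) \<and>
           regular_prices c C K (M\<Psi> n) n (D n) \<and>
           ln (real n) \<le> C' * ln (real (card (VO (D n)))))) \<and>
     (\<lambda>n. (real (s n))\<^sup>2 * ln (real (card (VO (D n)))) * ln (real n) ^ 3) \<in> o(\<lambda>n. real n) \<and>
     (\<lambda>n. M\<epsilon> n * M\<Psi> n * ln (real (card (VO (D n))))) \<in> o(\<lambda>n. real n)"


section \<open>The estimators\<close>

text \<open>
  In this section \<open>p\<close> and \<open>y\<close> are realized data: \<open>p t k\<close> and \<open>y t k\<close> are the price and the
  consumption of agent \<open>k\<close> in period \<open>t\<close>.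
\<close>

definition avg :: "nat \<Rightarrow> (nat \<Rightarrow> real) \<Rightarrow> real" where
  "avg n f = (\<Sum>t=1..n. f t) / real n"

definition M_n :: "nat \<Rightarrow> 'v set \<Rightarrow> (nat \<Rightarrow> 'v \<Rightarrow> real) \<Rightarrow> real" where
  "M_n n X p = sqrt (max 1 (MAX k\<in>X. avg n (\<lambda>t. p t k ^ 4)))"

definition tau :: "nat \<Rightarrow> 'v set \<Rightarrow> (nat \<Rightarrow> 'v \<Rightarrow> real) \<Rightarrow> real" where
  "tau n X p = 1 / (4 * M_n n X p)"

definition lam :: "nat \<Rightarrow> 'v set \<Rightarrow> real" where
  "lam n X = 1 / sqrt (real n) *
     inv (cdf std_normal_distribution) (1 - 1 / (3 * real n * (real (card X))\<^sup>2))"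

definition Sigma_hat :: "nat \<Rightarrow> (nat \<Rightarrow> 'v \<Rightarrow> real) \<Rightarrow> 'v option \<Rightarrow> 'v option \<Rightarrow> real" where
  "Sigma_hat n p i j = avg n (\<lambda>t. aug (p t) i * aug (p t) j)"

definition resid :: "'v set \<Rightarrow> (nat \<Rightarrow> 'v \<Rightarrow> real) \<Rightarrow> (nat \<Rightarrow> 'v \<Rightarrow> real) \<Rightarrow>
    ('v \<Rightarrow> 'v \<Rightarrow> real) \<Rightarrow> ('v \<Rightarrow> real) \<Rightarrow> nat \<Rightarrow> 'v \<Rightarrow> real" where
  "resid X p y W v t k = y t k - (v k - mv_on X W (p t) k)"

definition step1_feasible :: "nat \<Rightarrow> 'v set \<Rightarrow> (nat \<Rightarrow> 'v \<Rightarrow> real) \<Rightarrow> (nat \<Rightarrow> 'v \<Rightarrow> real) \<Rightarrow>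
    ('v \<Rightarrow> 'v \<Rightarrow> real) \<times> ('v \<Rightarrow> real) \<times> ('v \<Rightarrow> real) \<Rightarrow> bool" where
  "step1_feasible n X p y = (\<lambda>(W, v, z). \<forall>k\<in>X. \<forall>j\<in>bar_ix X.
     \<bar>avg n (\<lambda>t. resid X p y W v t k * aug (p t) j)\<bar> \<le> lam n X * z k \<and>
     sqrt (avg n (\<lambda>t. (resid X p y W v t k)\<^sup>2 * (aug (p t) j)\<^sup>2)) \<le> z k)"

definition step1_objective :: "nat \<Rightarrow> 'v set \<Rightarrow> (nat \<Rightarrow> 'v \<Rightarrow> real) \<Rightarrow>
    ('v \<Rightarrow> 'v \<Rightarrow> real) \<times> ('v \<Rightarrow> real) \<times> ('v \<Rightarrow> real) \<Rightarrow> real" where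
  "step1_objective n X p = (\<lambda>(W, v, z).
     \<Sum>k\<in>X. (\<bar>v k\<bar> + (\<Sum>j\<in>X. \<bar>W k j\<bar>)) + tau n X p * z k)"

definition step1_solution :: "nat \<Rightarrow> 'v set \<Rightarrow> (nat \<Rightarrow> 'v \<Rightarrow> real) \<Rightarrow> (nat \<Rightarrow> 'v \<Rightarrow> real) \<Rightarrow>
    ('v \<Rightarrow> 'v \<Rightarrow> real) \<Rightarrow> ('v \<Rightarrow> real) \<Rightarrow> bool" where
  "step1_solution n X p y W v \<longleftrightarrow>
     (\<exists>z. is_arg_min (step1_objective n X p) (step1_feasible n X p y) (W, v, z))"

definition step2_feasible :: "nat \<Rightarrow> 'v set \<Rightarrow> (nat \<Rightarrow> 'v \<Rightarrow> real) \<Rightarrow>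
    ('v option \<Rightarrow> real) \<times> ('v option \<Rightarrow> 'v option \<Rightarrow> real) \<Rightarrow> bool" where
  "step2_feasible n X p = (\<lambda>(z, \<Psi>). \<forall>k\<in>bar_ix X. \<forall>j\<in>bar_ix X.
     \<bar>mm_on (bar_ix X) \<Psi> (Sigma_hat n p) k j - of_bool (k = j)\<bar> \<le> lam n X * z k \<and>
     sqrt (avg n (\<lambda>t. (mv_on (bar_ix X) \<Psi> (aug (p t)) k * aug (p t) j - of_bool (k = j))\<^sup>2)) \<le> z k)"

definition step2_objective :: "nat \<Rightarrow> 'v set \<Rightarrow> (nat \<Rightarrow> 'v \<Rightarrow> real) \<Rightarrow>
    ('v option \<Rightarrow> real) \<times> ('v option \<Rightarrow> 'v option \<Rightarrow> real) \<Rightarrow> real" where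
  "step2_objective n X p = (\<lambda>(z, \<Psi>).
     \<Sum>k\<in>bar_ix X. root 4 (avg n (\<lambda>t. \<bar>mv_on (bar_ix X) \<Psi> (aug (p t)) k\<bar> ^ 4)) + z k)"

definition step2_solution :: "nat \<Rightarrow> 'v set \<Rightarrow> (nat \<Rightarrow> 'v \<Rightarrow> real) \<Rightarrow>
    ('v option \<Rightarrow> 'v option \<Rightarrow> real) \<Rightarrow> bool" where
  "step2_solution n X p \<Psi> \<longleftrightarrow>
     (\<exists>z. is_arg_min (step2_objective n X p) (step2_feasible n X p) (z, \<Psi>))"

text \<open>The matrix \<open>(-v\<^sup>T; W\<^sup>T)\<close>, with rows indexed by \<open>{0} \<union> X\<close> and columns by \<open>X\<close>.\<close>

definition stack :: "('v \<Rightarrow> 'v \<Rightarrow> real) \<Rightarrow> ('v \<Rightarrow> real) \<Rightarrow> 'v option \<Rightarrow> 'v \<Rightarrow> real" where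
  "stack W v i k = (case i of None \<Rightarrow> - v k | Some j \<Rightarrow> W k j)"

definition debiased :: "nat \<Rightarrow> 'v set \<Rightarrow> (nat \<Rightarrow> 'v \<Rightarrow> real) \<Rightarrow> (nat \<Rightarrow> 'v \<Rightarrow> real) \<Rightarrow>
    ('v \<Rightarrow> 'v \<Rightarrow> real) \<Rightarrow> ('v \<Rightarrow> real) \<Rightarrow> ('v option \<Rightarrow> 'v option \<Rightarrow> real) \<Rightarrow> 'v option \<Rightarrow> 'v \<Rightarrow> real" where
  "debiased n X p y W v \<Psi> i k = stack W v i k
     - mm_on (bar_ix X) \<Psi> (\<lambda>j k. avg n (\<lambda>t. aug (p t) j * resid X p y W v t k)) i k"

definition W_check :: "nat \<Rightarrow> 'v set \<Rightarrow> (nat \<Rightarrow> 'v \<Rightarrow> real) \<Rightarrow> (nat \<Rightarrow> 'v \<Rightarrow> real) \<Rightarrow>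
    ('v \<Rightarrow> 'v \<Rightarrow> real) \<Rightarrow> ('v \<Rightarrow> real) \<Rightarrow> ('v option \<Rightarrow> 'v option \<Rightarrow> real) \<Rightarrow> 'v \<Rightarrow> 'v \<Rightarrow> real" where
  "W_check n X p y W v \<Psi> k j = debiased n X p y W v \<Psi> (Some j) k"

definition v_check :: "nat \<Rightarrow> 'v set \<Rightarrow> (nat \<Rightarrow> 'v \<Rightarrow> real) \<Rightarrow> (nat \<Rightarrow> 'v \<Rightarrow> real) \<Rightarrow>
    ('v \<Rightarrow> 'v \<Rightarrow> real) \<Rightarrow> ('v \<Rightarrow> real) \<Rightarrow> ('v option \<Rightarrow> 'v option \<Rightarrow> real) \<Rightarrow> 'v \<Rightarrow> real" where
  "v_check n X p y W v \<Psi> k = - debiased n X p y W v \<Psi> None k"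

definition threshold :: "('v \<Rightarrow> 'v \<Rightarrow> real) \<Rightarrow> ('v \<Rightarrow> 'v \<Rightarrow> real) \<Rightarrow> 'v \<Rightarrow> 'v \<Rightarrow> real" where
  "threshold \<mu> W k j = (if \<bar>W k j\<bar> > \<mu> k j then W k j else 0)"

definition price_estimate ::
    "'v set \<Rightarrow> real \<Rightarrow> ('v \<Rightarrow> 'v \<Rightarrow> real) \<Rightarrow> ('v \<Rightarrow> real) \<Rightarrow> 'v \<Rightarrow> real" where
  "price_estimate X pbar W v =
     (\<lambda>i. min pbar (max (mv_on X (inv_on X (\<lambda>k j. W k j + W j k)) v i) 0))"


section \<open>Probability \<open>1 - o(1)\<close>\<close>

text \<open>
  Inner probability, so that no measurable selection of the minimizers has to be assumed; if the
  sets \<open>{\<omega>. P n \<omega>}\<close> are events, this says that their probabilities tend to \<open>1\<close>.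
\<close>

definition whp :: "(nat \<Rightarrow> 'w measure) \<Rightarrow> (nat \<Rightarrow> 'w \<Rightarrow> bool) \<Rightarrow> bool" where
  "whp M P \<longleftrightarrow> (\<exists>A. (\<forall>n. A n \<in> sets (M n) \<and> (\<forall>\<omega>\<in>A n. P n \<omega>)) \<and>
     (\<lambda>n. measure (M n) (A n)) \<longlonglongrightarrow> 1)"

end

theory Submission
  imports Defs
begin

text \<open>
  The revenue is a quadratic form in the prices, and its Hessian is minus the sum of the inverse of \<open>H\<close> and its
  transpose. Both this form and the optimal revenue are controlled by diagonal dominance, so the
  regret is of the order of the averaged squared error of the estimated prices. Thresholding an
  entrywise accurate estimate of an approximately sparse matrix gives row and column sums
  of the error of order \<open>s \<rho> + r\<close>, where \<open>\<rho>\<^sup>2\<close> is the logarithm of the number of observable agents over \<open>n\<close>.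
  What remains is the averaged squared error of the debiased intercept. Since the relaxed inverse
  reproduces the first row of the identity up to order \<open>\<rho>\<close>, it suffices that the first-stage estimate
  is bounded in the \<open>l\<^sub>1\<close>-norm, without any rate, and that the noise averaged with the weights given by
  the intercept row of the relaxed inverse is small in mean square. These weights may be chosen
  in dependence on the noise when the minimizer is not unique, but by strict convexity of the
  \<open>l\<^sub>4\<close>-norm their direction depends only on the prices.
\<close>

section \<open>Coercive matrices\<close>

text \<open>Entrywise control of \<open>W_check\<close> comes with the hypothesis on the thresholds,
  so of the debiasing step only the row \<open>None\<close> is analysed, and only in average over
  the agents. That average is why a second moment suffices: the averaged squared noise has
  expectation of order 1/n, and Markov's inequality at level ln|V_O| / n fails with probability 1 /
  ln|V_O|, which vanishes since |V_O| grows at least like a power of n. The obstacle is that a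
  minimizer of the second step is an arbitrary function on the sample space, neither measurable nor
  a function of the prices, so the orthogonality of noise and prices says nothing about it. It is
  compared with a near-minimizer selected measurably among countably many rational candidates. Those
  weights involve the prices of all periods, but the cross terms of the second moment vanish once
  the other periods are frozen.\<close>

lemma mv_on_cong:
  assumes "\<And>j. j \<in> J \<Longrightarrow> A i j = A' i' j" "\<And>j. j \<in> J \<Longrightarrow> x j = x' j"
  shows "mv_on J A x i = mv_on J A' x' i'"
  using assms by (simp add: mv_on_def)

lemma mv_on_add: "mv_on J A (\<lambda>j. x j + y j) i = mv_on J A x i + mv_on J A y i"
  by (simp add: mv_on_def algebra_simps sum.distrib)

lemma mv_on_diff: "mv_on J A (\<lambda>j. x j - y j) i = mv_on J A x i - mv_on J A y i"
  by (simp add: mv_on_def algebra_simps sum_subtractf)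

lemma mv_on_unit: "finite J \<Longrightarrow> l \<in> J \<Longrightarrow> mv_on J A (\<lambda>j. if j = l then c else 0) i = c * A i l"
  by (simp add: mv_on_def if_distrib[of "\<lambda>x. _ * x"] sum.delta cong: if_cong)

lemma mv_on_mm: "mv_on K (mm_on J A B) x i = mv_on J A (mv_on K B x) i"
  unfolding mv_on_def mm_on_def sum_distrib_left sum_distrib_right
  by (subst sum.swap) (simp add: mult_ac)

lemma mv_on_inverse:
  assumes "inverse_pair_on I A B" "finite I" "i \<in> I"
  shows "mv_on I A (mv_on I B x) i = x i" "mv_on I B (mv_on I A x) i = x i"
proof -
  have "mv_on I (mm_on I A B) x i = x i" "mv_on I (mm_on I B A) x i = x i"
    using assms by (simp_all add: mv_on_def inverse_pair_on_def sum.delta if_distrib[of "\<lambda>c. c * _"]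
        of_bool_def cong: if_cong)
  then show "mv_on I A (mv_on I B x) i = x i" "mv_on I B (mv_on I A x) i = x i"
    by (simp_all add: mv_on_mm)
qed

lemma inv_on_inverse: "invertible_on I A \<Longrightarrow> inverse_pair_on I A (inv_on I A)"
  unfolding invertible_on_def inv_on_def by (erule someI_ex)

text \<open>No symmetry is asked for: the condition concerns the symmetric part only. Neither the
  network matrix nor the inverse of \<open>H_mat\<close> need be symmetric.\<close>

definition coercive_on :: "'i set \<Rightarrow> real \<Rightarrow> ('i \<Rightarrow> 'i \<Rightarrow> real) \<Rightarrow> bool" where
  "coercive_on I c A \<longleftrightarrow> (\<forall>x. c * (\<Sum>i\<in>I. (x i)\<^sup>2) \<le> (\<Sum>i\<in>I. x i * mv_on I A x i))"

text \<open>Gaussian elimination without pivoting: positivity of the quadratic form is inherited by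
  Schur complements.\<close>

lemma positive_form_solvable:
  assumes "finite I" "\<And>x. \<exists>i\<in>I. x i \<noteq> 0 \<Longrightarrow> 0 < (\<Sum>i\<in>I. x i * mv_on I A x i)"
  shows "\<exists>x. \<forall>i\<in>I. mv_on I A x i = b i"
  using assms
proof (induction I arbitrary: A b rule: finite_induct)
  case (insert k I)
  let ?\<alpha> = "A k k"
  have unit: "(\<Sum>i\<in>insert k I. (if i = k then 1 else 0) * mv_on (insert k I) A (\<lambda>j. if j = k then 1 else 0) i) = ?\<alpha>"
    using insert.hyps by (subst mv_on_unit) (auto simp: if_distrib[of "\<lambda>c. c * _"] cong: if_cong)
  have \<alpha>: "?\<alpha> > 0"
    using insert.prems[of "\<lambda>j. if j = k then 1 else 0"] unfolding unit by auto
  define A' where "A' = (\<lambda>i j. A i j - A i k * A k j / ?\<alpha>)"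
  \<comment> \<open>\<open>ext c x\<close> completes \<open>x\<close> by the coordinate
    \<open>k\<close> for which row \<open>k\<close> evaluates to \<open>c\<close>. With
    \<open>c = 0\<close> the form of \<open>A\<close> at the completed vector is the form of the
    Schur complement \<open>A'\<close> at \<open>x\<close>, so positivity passes to
    \<open>A'\<close>.\<close>
  define ext where "ext = (\<lambda>(c::real) x j. if j = k then (c - (\<Sum>j\<in>I. A k j * x j)) / ?\<alpha> else x j)"
  have ext_in: "ext c x j = x j" if "j \<in> I" for c x j
    using that insert.hyps by (auto simp: ext_def)
  have mv_k: "mv_on (insert k I) A (ext c x) k = c" for c x
    using insert.hyps \<alpha> by (simp add: mv_on_def ext_in) (simp add: ext_def)
  have mv_i: "mv_on (insert k I) A (ext c x) i = mv_on I A' x i + A i k * c / ?\<alpha>" for c x i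
    using insert.hyps \<alpha>
    by (simp add: mv_on_def ext_in A'_def)
      (simp add: ext_def algebra_simps sum_subtractf diff_divide_distrib sum_divide_distrib sum_distrib_left)
  have "\<exists>x. \<forall>i\<in>I. mv_on I A' x i = b i - A i k * b k / ?\<alpha>"
  proof (rule insert.IH)
    fix x :: "'a \<Rightarrow> real" assume nz: "\<exists>i\<in>I. x i \<noteq> 0"
    then have "\<exists>i\<in>insert k I. ext 0 x i \<noteq> 0" using ext_in by auto
    from insert.prems[OF this] show "0 < (\<Sum>i\<in>I. x i * mv_on I A' x i)"
      using insert.hyps by (simp add: mv_k) (simp add: mv_i ext_in)
  qed
  then obtain x where "\<forall>i\<in>I. mv_on I A' x i = b i - A i k * b k / ?\<alpha>" by blast
  then have "\<forall>i\<in>insert k I. mv_on (insert k I) A (ext (b k) x) i = b i"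
    using mv_k[of "b k" x] mv_i[of "b k" x] by auto
  then show ?case by blast
qed simp

lemma coercive_on_zero:
  assumes "finite I" "0 < c" "coercive_on I c A" "\<And>i. i \<in> I \<Longrightarrow> mv_on I A x i = 0" "i \<in> I"
  shows "x i = 0"
proof -
  have "c * (\<Sum>i\<in>I. (x i)\<^sup>2) \<le> 0"
    using assms(3,4) unfolding coercive_on_def by (metis (no_types, lifting) mult_zero_right sum.neutral)
  then have "(\<Sum>i\<in>I. (x i)\<^sup>2) \<le> 0" using assms(2) by (simp add: mult_le_0_iff)
  then have "(\<Sum>i\<in>I. (x i)\<^sup>2) = 0" by (simp add: sum_nonneg order_antisym)
  then show ?thesis using assms(1,5) by (simp add: sum_nonneg_eq_0_iff)
qed

text \<open>Solving against the unit vectors gives a right inverse \<open>B\<close>. It is also a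
  left inverse, because \<open>A\<close> annihilates every column of \<open>B A - 1\<close> and a
  coercive matrix has trivial kernel.\<close>

lemma coercive_on_invertible:
  assumes I: "finite I" and "0 < c" "coercive_on I c A"
  shows "invertible_on I A"
proof -
  have "\<exists>x. \<forall>i\<in>I. mv_on I A x i = b i" for b
  proof (rule positive_form_solvable[OF I])
    fix x assume "\<exists>i\<in>I. x i \<noteq> (0::real)"
    then have "0 < c * (\<Sum>i\<in>I. (x i)\<^sup>2)"
      using assms by (intro mult_pos_pos) (auto intro: sum_pos2)
    then show "0 < (\<Sum>i\<in>I. x i * mv_on I A x i)"
      using assms(3) unfolding coercive_on_def by (meson less_le_trans)
  qed
  note solvable = this
  define y where "y = (\<lambda>j. SOME x. \<forall>i\<in>I. mv_on I A x i = of_bool (i = j))"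
  have y: "mv_on I A (y j) i = of_bool (i = j)" if "i \<in> I" for i j
    using someI_ex[OF solvable, of "\<lambda>i. of_bool (i = j)"] that unfolding y_def by blast
  define B where "B = (\<lambda>i j. y j i)"
  have AB: "mm_on I A B i j = of_bool (i = j)" if "i \<in> I" for i j
    using y[OF that, of j] by (simp add: mm_on_def mv_on_def B_def)
  have "mm_on I B A i j = of_bool (i = j)" if "i \<in> I" "j \<in> I" for i j
  proof -
    have "mm_on I B A i j - of_bool (i = j) = 0"
    proof (rule coercive_on_zero[OF assms, of "\<lambda>i. mm_on I B A i j - of_bool (i = j)"])
      fix l assume l: "l \<in> I"
      have "mv_on I A (\<lambda>i. mm_on I B A i j) l = mv_on I (mm_on I A B) (\<lambda>i. A i j) l"
        by (subst mv_on_mm) (simp add: mm_on_def mv_on_def)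
      also have "\<dots> = A l j"
        using I l by (simp add: mv_on_def AB if_distrib[of "\<lambda>c. c * _"] of_bool_def cong: if_cong)
      moreover have "mv_on I A (\<lambda>i. of_bool (i = j)) l = A l j"
        using I \<open>j \<in> I\<close> by (simp add: mv_on_def of_bool_def if_distrib[of "\<lambda>c. _ * c"] cong: if_cong)
      ultimately show "mv_on I A (\<lambda>i. mm_on I B A i j - of_bool (i = j)) l = 0"
        by (simp add: mv_on_diff)
    qed (fact that(1))
    then show ?thesis by simp
  qed
  with AB show ?thesis
    unfolding invertible_on_def inverse_pair_on_def by blast
qed

lemma inv_on_unique:
  assumes "finite I" "inverse_pair_on I A B" "\<And>i. i \<in> I \<Longrightarrow> mv_on I A y i = b i" "i \<in> I"
  shows "y i = mv_on I B b i"
proof -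
  have "mv_on I B (mv_on I A y) i = mv_on I B b i"
    using assms(3) by (intro mv_on_cong) auto
  then show ?thesis using mv_on_inverse(2)[OF assms(2,1,4)] by simp
qed

section \<open>The network matrix\<close>

locale pricing_instance =
  fixes pbar abar bbar \<zeta> :: real and n :: nat and D :: "('v, 'w) pricing"
  assumes pbar: "0 < pbar" and \<zeta>: "0 < \<zeta>" and n: "1 \<le> n"
    and model: "pricing_model pbar abar bbar \<zeta> n D"
begin

abbreviation "A \<equiv> agents D"
abbreviation "X \<equiv> VO D"
abbreviation "Y \<equiv> VL D"
abbreviation "G \<equiv> weight D"
abbreviation "M \<equiv> M_mat D"
abbreviation "W \<equiv> H_inv D"
abbreviation "P \<equiv> pspace D"
text \<open>Inverse over all agents, latent ones included. Signs and norms follow for it from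
  diagonal dominance, and \<open>H_inv\<close>, \<open>v_vec\<close> and \<open>eps\<close> are read
  off from it, so that the Schur complement needs no estimate of its own beyond
  invertibility.\<close>

definition "Minv = inv_on A M"

lemma finX: "finite X" and finY: "finite Y" and disj: "X \<inter> Y = {}" and A_eq: "A = X \<union> Y"
  and finA: "finite A"
  and G_nonneg: "\<And>i j. i \<in> A \<Longrightarrow> j \<in> A \<Longrightarrow> 0 \<le> G i j"
  and a_bounds: "\<And>i. i \<in> A \<Longrightarrow> 0 < acoef D i" "\<And>i. i \<in> A \<Longrightarrow> acoef D i \<le> abar"
  and b_bounds: "\<And>i. i \<in> A \<Longrightarrow> 0 < bcoef D i" "\<And>i. i \<in> A \<Longrightarrow> bcoef D i \<le> bbar"
  and row_dom: "\<And>i. i \<in> A \<Longrightarrow> (\<Sum>j\<in>A. G i j) + \<zeta> \<le> 2 * bcoef D i"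
  and col_dom: "\<And>i. i \<in> A \<Longrightarrow> (\<Sum>j\<in>A. G j i) + \<zeta> \<le> 2 * bcoef D i"
  using model unfolding pricing_model_def by (auto simp: agents_def)

lemma X_sub: "k \<in> X \<Longrightarrow> k \<in> A" and Y_sub: "k \<in> Y \<Longrightarrow> k \<in> A"
  by (auto simp: A_eq)

lemma prob: "prob_space P"
  using model unfolding pricing_model_def by auto

lemma mv_M: "finite B \<Longrightarrow> i \<in> B \<Longrightarrow> mv_on B M x i = 2 * bcoef D i * x i - (\<Sum>j\<in>B. G i j * x j)"
  by (simp add: mv_on_def M_mat_def left_diff_distrib sum_subtractf if_distrib[of "\<lambda>c. c * _"] cong: if_cong)

text \<open>The bound x_i x_j \<le> (x_i^2 + x_j^2) / 2 turns the network form into the mean of a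
  row-sum and a column-sum expression, which is why dominance of both rows and columns enters.
  Passing to a principal block only drops nonnegative weights; the blocks \<open>A\<close> and
  \<open>Y\<close> occur below.\<close>

lemma M_coercive:
  assumes B: "B \<subseteq> A"
  shows "coercive_on B \<zeta> M"
  unfolding coercive_on_def
proof
  fix x :: "'v \<Rightarrow> real"
  have fin: "finite B" using B finA finite_subset by blast
  have "(\<Sum>i\<in>B. \<Sum>j\<in>B. x i * (G i j * x j)) \<le> (\<Sum>i\<in>B. \<Sum>j\<in>B. G i j * (x i)\<^sup>2 / 2 + G i j * (x j)\<^sup>2 / 2)"
  proof (intro sum_mono)
    fix i j assume "i \<in> B" "j \<in> B"
    then have "0 \<le> G i j" using B G_nonneg by auto
    moreover have "x i * x j \<le> (x i)\<^sup>2 / 2 + (x j)\<^sup>2 / 2" using sum_squares_bound[of "x i" "x j"] by simp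
    ultimately have "G i j * (x i * x j) \<le> G i j * ((x i)\<^sup>2 / 2 + (x j)\<^sup>2 / 2)"
      by (rule mult_left_mono[rotated])
    then show "x i * (G i j * x j) \<le> G i j * (x i)\<^sup>2 / 2 + G i j * (x j)\<^sup>2 / 2"
      by (simp add: algebra_simps)
  qed
  also have "\<dots> = (\<Sum>i\<in>B. (x i)\<^sup>2 * (\<Sum>j\<in>B. G i j)) / 2 + (\<Sum>j\<in>B. (x j)\<^sup>2 * (\<Sum>i\<in>B. G i j)) / 2"
  proof -
    have "(\<Sum>i\<in>B. \<Sum>j\<in>B. G i j * (x j)\<^sup>2 / 2) = (\<Sum>j\<in>B. (x j)\<^sup>2 * (\<Sum>i\<in>B. G i j)) / 2"
      by (subst sum.swap) (simp add: sum_distrib_left sum_divide_distrib mult_ac)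
    moreover have "(\<Sum>i\<in>B. \<Sum>j\<in>B. G i j * (x i)\<^sup>2 / 2) = (\<Sum>i\<in>B. (x i)\<^sup>2 * (\<Sum>j\<in>B. G i j)) / 2"
      unfolding sum_distrib_left sum_divide_distrib by (simp add: mult_ac)
    ultimately show ?thesis by (simp only: sum.distrib)
  qed
  also have "\<dots> \<le> (\<Sum>i\<in>B. (x i)\<^sup>2 * (2 * bcoef D i - \<zeta>)) / 2 + (\<Sum>i\<in>B. (x i)\<^sup>2 * (2 * bcoef D i - \<zeta>)) / 2"
  proof -
    have "(\<Sum>j\<in>B. G i j) \<le> 2 * bcoef D i - \<zeta>" "(\<Sum>j\<in>B. G j i) \<le> 2 * bcoef D i - \<zeta>" if "i \<in> B" for i
    proof -
      have "(\<Sum>j\<in>B. G i j) \<le> (\<Sum>j\<in>A. G i j)" "(\<Sum>j\<in>B. G j i) \<le> (\<Sum>j\<in>A. G j i)"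
        using that B finA G_nonneg by (auto intro!: sum_mono2)
      then show "(\<Sum>j\<in>B. G i j) \<le> 2 * bcoef D i - \<zeta>" "(\<Sum>j\<in>B. G j i) \<le> 2 * bcoef D i - \<zeta>"
        using row_dom[of i] col_dom[of i] that B by auto
    qed
    then show ?thesis
      by (intro add_mono divide_right_mono sum_mono mult_left_mono) auto
  qed
  finally have "(\<Sum>i\<in>B. \<Sum>j\<in>B. x i * (G i j * x j)) \<le> (\<Sum>i\<in>B. (x i)\<^sup>2 * (2 * bcoef D i - \<zeta>))" by simp
  then have "\<zeta> * (\<Sum>i\<in>B. (x i)\<^sup>2) \<le> (\<Sum>i\<in>B. x i * (2 * bcoef D i * x i - (\<Sum>j\<in>B. G i j * x j)))"
    by (simp add: right_diff_distrib sum_subtractf sum_distrib_left power2_eq_square mult_ac)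
  then show "\<zeta> * (\<Sum>i\<in>B. (x i)\<^sup>2) \<le> (\<Sum>i\<in>B. x i * mv_on B M x i)"
    using fin by (simp add: mv_M)
qed

lemma M_inverse: "inverse_pair_on A M Minv"
  unfolding Minv_def
  by (intro inv_on_inverse coercive_on_invertible[OF finA \<zeta>] M_coercive) simp

lemma MY_inverse: "inverse_pair_on Y M (inv_on Y M)"
  by (intro inv_on_inverse coercive_on_invertible[OF finY \<zeta>] M_coercive) (auto simp: A_eq)

lemma mv_A: "mv_on A B x i = mv_on X B x i + mv_on Y B x i"
  unfolding mv_on_def A_eq using finX finY disj by (rule sum.union_disjoint)

lemma M_Minv: "i \<in> A \<Longrightarrow> mv_on A M (mv_on A Minv b) i = b i"
  by (rule mv_on_inverse(1)[OF M_inverse finA])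

lemma Minv_unique: "(\<And>i. i \<in> A \<Longrightarrow> mv_on A M y i = b i) \<Longrightarrow> i \<in> A \<Longrightarrow> y i = mv_on A Minv b i"
  by (rule inv_on_unique[OF finA M_inverse])

text \<open>Solving the latent rows for the latent coordinates reduces the network matrix to its Schur
  complement.\<close>

definition fill :: "('v \<Rightarrow> real) \<Rightarrow> ('v \<Rightarrow> real) \<Rightarrow> 'v \<Rightarrow> real" where
  "fill x w i = (if i \<in> X then x i else mv_on Y (inv_on Y M) (\<lambda>l. w l - mv_on X M x l) i)"

lemma M_fill:
  shows "i \<in> X \<Longrightarrow> mv_on A M (fill x w) i = mv_on X (H_mat D) x i + mv_on Y (S_mat D) w i"
    and "i \<in> Y \<Longrightarrow> mv_on A M (fill x w) i = w i"
proof -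
  have X: "mv_on X M (fill x w) i = mv_on X M x i" for i
    by (rule mv_on_cong) (auto simp: fill_def)
  have Y: "mv_on Y M (fill x w) i = mv_on Y M (mv_on Y (inv_on Y M) (\<lambda>l. w l - mv_on X M x l)) i" for i
    using disj by (intro mv_on_cong) (auto simp: fill_def)
  have SX: "mv_on X (mm_on Y (S_mat D) M) x i = mv_on Y (S_mat D) (mv_on X M x) i" for i
    by (rule mv_on_mm)
  show "mv_on A M (fill x w) i = mv_on X (H_mat D) x i + mv_on Y (S_mat D) w i" if "i \<in> X"
  proof -
    have "mv_on X (H_mat D) x i = mv_on X M x i - mv_on Y (S_mat D) (mv_on X M x) i"
      unfolding SX[symmetric] by (simp add: H_mat_def mv_on_def left_diff_distrib sum_subtractf)
    then show ?thesis
      unfolding mv_A X Y by (simp add: S_mat_def mv_on_mm mv_on_diff)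
        (simp add: mv_on_def sum_subtractf right_diff_distrib)
  qed
  show "mv_on A M (fill x w) i = w i" if "i \<in> Y"
    unfolding mv_A X Y using mv_on_inverse(1)[OF MY_inverse finY that] by simp
qed

text \<open>At \<open>fill x (\<lambda>_. 0)\<close> the latent components of the image under
  \<open>M\<close> vanish, so the form of \<open>M\<close> there is the form of
  \<open>H_mat D\<close> at \<open>x\<close>, while the sum of squares can only grow by the latent
  coordinates.\<close>

lemma H_coercive: "coercive_on X \<zeta> (H_mat D)"
  unfolding coercive_on_def
proof
  fix x :: "'v \<Rightarrow> real"
  have "\<zeta> * (\<Sum>i\<in>X. (x i)\<^sup>2) \<le> \<zeta> * (\<Sum>i\<in>A. (fill x (\<lambda>_. 0) i)\<^sup>2)"
    using \<zeta> finA by (intro mult_left_mono)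
      (auto simp: fill_def A_eq finX finY sum.union_disjoint[OF finX finY disj] intro!: sum_nonneg)
  also have "\<dots> \<le> (\<Sum>i\<in>A. fill x (\<lambda>_. 0) i * mv_on A M (fill x (\<lambda>_. 0)) i)"
    using M_coercive[of A] unfolding coercive_on_def by auto
  also have "\<dots> = (\<Sum>i\<in>X. x i * mv_on X (H_mat D) x i)"
    unfolding A_eq sum.union_disjoint[OF finX finY disj]
    by (simp add: M_fill[unfolded A_eq]) (auto simp: fill_def mv_on_def intro!: sum.cong)
  finally show "\<zeta> * (\<Sum>i\<in>X. (x i)\<^sup>2) \<le> (\<Sum>i\<in>X. x i * mv_on X (H_mat D) x i)" .
qed

lemma H_inverse: "inverse_pair_on X (H_mat D) W"
  unfolding H_inv_def
  by (intro inv_on_inverse coercive_on_invertible[OF finX \<zeta>] H_coercive)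

text \<open>The left-hand side is the pattern common to \<open>v_vec\<close> and \<open>eps\<close>.
  Filling in the latent coordinates gives a solution of the full system with right-hand side
  \<open>b\<close>, and uniqueness identifies it with the one given by \<open>Minv\<close>.\<close>

lemma schur_solution:
  assumes "k \<in> X"
  shows "mv_on X W b k - mv_on X W (mv_on Y (S_mat D) b) k = mv_on A Minv b k"
proof -
  define x where "x = mv_on X W (\<lambda>i. b i - mv_on Y (S_mat D) b i)"
  have "fill x b k = mv_on A Minv b k"
  proof (rule Minv_unique)
    fix i assume "i \<in> A"
    then consider "i \<in> X" | "i \<in> Y" by (auto simp: A_eq)
    then show "mv_on A M (fill x b) i = b i"
      by cases (simp_all add: M_fill x_def mv_on_inverse(1)[OF H_inverse finX])
  qed (use assms X_sub in auto)
  then show ?thesis using assms by (simp add: fill_def x_def mv_on_diff)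
qed

text \<open>For a right-hand side that vanishes on the latent agents the correction by
  \<open>S_mat\<close> drops out: the inverse of \<open>H_mat\<close> is the observable block of
  \<open>Minv\<close>.\<close>

lemma W_eq_Minv: "k \<in> X \<Longrightarrow> mv_on X W b k = mv_on A Minv (\<lambda>i. if i \<in> X then b i else 0) k"
proof -
  assume k: "k \<in> X"
  have "mv_on Y (S_mat D) (\<lambda>i. if i \<in> X then b i else 0) = (\<lambda>_. 0)"
    using disj by (auto simp: mv_on_def fun_eq_iff intro!: sum.neutral)
  then have "mv_on X W (mv_on Y (S_mat D) (\<lambda>i. if i \<in> X then b i else 0)) k = 0"
    by (simp add: mv_on_def)
  moreover have "mv_on X W (\<lambda>i. if i \<in> X then b i else 0) k = mv_on X W b k"
    by (rule mv_on_cong) auto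
  ultimately show ?thesis using schur_solution[OF k, of "\<lambda>i. if i \<in> X then b i else 0"] by simp
qed

lemma v_eq_Minv:
  assumes k: "k \<in> X"
  shows "v_vec D pbar k = mv_on A Minv (\<lambda>i. if i \<in> X then acoef D i else acoef D i - pbar) k"
proof -
  let ?b = "\<lambda>i. if i \<in> X then acoef D i else acoef D i - pbar"
  have "mv_on X W (mv_on Y (S_mat D) ?b) k = mv_on X W (mv_on Y (S_mat D) (\<lambda>l. acoef D l - pbar)) k"
    using disj by (intro mv_on_cong) auto
  moreover have "mv_on X W ?b k = mv_on X W (acoef D) k"
    by (rule mv_on_cong) auto
  ultimately show ?thesis
    using schur_solution[OF k, of ?b] by (simp add: v_vec_def)
qed

lemma eps_eq_Minv: "k \<in> X \<Longrightarrow> eps D t \<omega> k = mv_on A Minv (shock D t \<omega>) k"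
  unfolding eps_def by (rule schur_solution)

text \<open>Rephrases the reduced form as a linear system over all agents, with latent prices at
  \<open>pbar\<close> and no separate loop term. In this shape it can be compared with the
  first-order conditions of an equilibrium.\<close>

lemma affine_eq_Minv:
  assumes k: "k \<in> X"
  shows "v_vec D pbar k - mv_on X W p k + eps D t \<omega> k
    = mv_on A Minv (\<lambda>i. acoef D i + shock D t \<omega> i - all_prices D pbar p i) k"
proof -
  have "mv_on A Minv (\<lambda>i. acoef D i + shock D t \<omega> i - all_prices D pbar p i) k
     = mv_on A Minv (\<lambda>i. (if i \<in> X then acoef D i else acoef D i - pbar)
         - (if i \<in> X then p i else 0) + shock D t \<omega> i) k"
    by (rule mv_on_cong) (auto simp: all_prices_def)
  then show ?thesis
    by (simp add: mv_on_add mv_on_diff v_eq_Minv[OF k] W_eq_Minv[OF k] eps_eq_Minv[OF k])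
qed

text \<open>At an index \<open>l\<close> where \<open>y\<close> is smallest, the network term is at
  least the row sum times \<open>y l\<close>; strict dominance of the row then leaves a positive
  multiple of \<open>y l\<close> that must be nonnegative. Once \<open>y\<close> is nonnegative,
  dropping the network term gives the quantitative bound.\<close>

lemma M_min_principle:
  assumes "\<And>i. i \<in> A \<Longrightarrow> 0 \<le> mv_on A M y i" "i \<in> A"
  shows "0 \<le> y i" "mv_on A M y i / (2 * bbar) \<le> y i"
proof -
  have nonneg: "0 \<le> y i" if "i \<in> A" for i
  proof -
    have ne: "A \<noteq> {}" using that by auto
    define l where "l = arg_min_on y A"
    have l: "l \<in> A" "\<And>j. j \<in> A \<Longrightarrow> y l \<le> y j"
      using arg_min_if_finite[OF finA ne, of y] arg_min_least[OF finA ne, of _ y] by (auto simp: l_def not_le[symmetric])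
    have "(\<Sum>j\<in>A. G l j) * y l \<le> (\<Sum>j\<in>A. G l j * y j)"
      unfolding sum_distrib_right using l G_nonneg by (intro sum_mono mult_left_mono) auto
    moreover have "(\<Sum>j\<in>A. G l j * y j) \<le> 2 * bcoef D l * y l"
      using assms(1)[OF l(1)] by (simp add: mv_M finA l)
    ultimately have "0 \<le> (2 * bcoef D l - (\<Sum>j\<in>A. G l j)) * y l" by (simp add: algebra_simps)
    moreover have "0 < 2 * bcoef D l - (\<Sum>j\<in>A. G l j)" using row_dom[OF l(1)] \<zeta> by simp
    ultimately have "0 \<le> y l" by (simp add: zero_le_mult_iff)
    then show ?thesis using l(2)[OF that] by simp
  qed
  show "0 \<le> y i" using nonneg assms(2) .
  have "0 \<le> (\<Sum>j\<in>A. G i j * y j)" using nonneg G_nonneg assms(2) by (intro sum_nonneg) auto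
  then have "mv_on A M y i \<le> 2 * bcoef D i * y i" by (simp add: mv_M finA assms(2))
  also have "\<dots> \<le> 2 * bbar * y i" using b_bounds[OF assms(2)] nonneg[OF assms(2)] by (intro mult_right_mono) auto
  finally show "mv_on A M y i / (2 * bbar) \<le> y i"
    using b_bounds[OF assms(2)] by (simp add: divide_le_eq mult_ac)
qed

lemma Minv_nonneg:
  assumes "\<And>i. i \<in> A \<Longrightarrow> 0 \<le> b i" "i \<in> A"
  shows "b i / (2 * bbar) \<le> mv_on A Minv b i" "0 \<le> mv_on A Minv b i"
  using M_min_principle[of "mv_on A Minv b" i] assms by (auto simp: M_Minv)

lemma Minv_entry_nonneg: "i \<in> A \<Longrightarrow> j \<in> A \<Longrightarrow> 0 \<le> Minv i j"
  using Minv_nonneg(2)[of "\<lambda>l. if l = j then 1 else 0" i] by (simp add: mv_on_unit finA)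

text \<open>At an index where the modulus of the solution is largest, the diagonal exceeds the row
  sum of the weights by \<zeta>, so \<zeta> times that modulus is at most the modulus of the
  right-hand side there.\<close>

lemma Minv_sup_bound:
  assumes "\<And>i. i \<in> A \<Longrightarrow> \<bar>b i\<bar> \<le> \<beta>" "i \<in> A"
  shows "\<bar>mv_on A Minv b i\<bar> \<le> \<beta> / \<zeta>"
proof -
  define y where "y = mv_on A Minv b"
  have ne: "A \<noteq> {}" using assms(2) by auto
  define l where "l = arg_min_on (\<lambda>i. - \<bar>y i\<bar>) A"
  have l: "l \<in> A" "\<And>j. j \<in> A \<Longrightarrow> \<bar>y j\<bar> \<le> \<bar>y l\<bar>"
    using arg_min_if_finite[OF finA ne, of "\<lambda>i. - \<bar>y i\<bar>"] arg_min_least[OF finA ne, of _ "\<lambda>i. - \<bar>y i\<bar>"]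
    by (auto simp: l_def not_le[symmetric])
  have "2 * bcoef D l * y l = b l + (\<Sum>j\<in>A. G l j * y j)"
    using M_Minv[OF l(1), of b] by (simp add: mv_M finA l y_def)
  then have "\<bar>2 * bcoef D l * y l\<bar> \<le> \<bar>b l\<bar> + \<bar>\<Sum>j\<in>A. G l j * y j\<bar>" by simp
  moreover have "\<bar>\<Sum>j\<in>A. G l j * y j\<bar> \<le> (\<Sum>j\<in>A. G l j * \<bar>y l\<bar>)"
    using l G_nonneg by (intro sum_abs[THEN order_trans] sum_mono) (auto simp: abs_mult intro!: mult_mono)
  moreover have "\<bar>2 * bcoef D l * y l\<bar> = 2 * bcoef D l * \<bar>y l\<bar>"
    using b_bounds[OF l(1)] by (simp add: abs_mult)
  moreover have "(\<Sum>j\<in>A. G l j * \<bar>y l\<bar>) \<le> (2 * bcoef D l - \<zeta>) * \<bar>y l\<bar>"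
    unfolding sum_distrib_right[symmetric] using row_dom[OF l(1)] by (intro mult_right_mono) auto
  ultimately have "\<zeta> * \<bar>y l\<bar> \<le> \<bar>b l\<bar>" by (simp add: algebra_simps)
  then have "\<zeta> * \<bar>y i\<bar> \<le> \<beta>"
    using l(2)[OF assms(2)] assms(1)[OF l(1)] \<zeta> by (meson mult_left_mono order_trans less_imp_le)
  then show ?thesis using \<zeta> by (simp add: y_def field_simps)
qed

lemma W_sup_bound: "(\<And>i. i \<in> X \<Longrightarrow> \<bar>b i\<bar> \<le> \<beta>) \<Longrightarrow> 0 \<le> \<beta> \<Longrightarrow> k \<in> X \<Longrightarrow> \<bar>mv_on X W b k\<bar> \<le> \<beta> / \<zeta>"
  by (subst W_eq_Minv) (auto intro!: Minv_sup_bound X_sub)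

text \<open>Testing against the signs of the row turns the sum into a single value of the operator,
  to which the bound in the maximum norm applies.\<close>

lemma W_row_sum: assumes "k \<in> X" shows "(\<Sum>j\<in>X. \<bar>W k j\<bar>) \<le> 1 / \<zeta>"
proof -
  have "(\<Sum>j\<in>X. \<bar>W k j\<bar>) = mv_on X W (\<lambda>j. sgn (W k j)) k"
    by (simp add: mv_on_def abs_sgn)
  also have "\<dots> \<le> \<bar>mv_on X W (\<lambda>j. sgn (W k j)) k\<bar>" by simp
  also have "\<dots> \<le> 1 / \<zeta>" using assms by (intro W_sup_bound) (auto simp: sgn_real_def)
  finally show ?thesis .
qed

lemma v_bound: assumes "k \<in> X" shows "\<bar>v_vec D pbar k\<bar> \<le> (abar + pbar) / \<zeta>"
  unfolding v_eq_Minv[OF assms]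
proof (rule Minv_sup_bound)
  fix i assume "i \<in> A"
  then show "\<bar>if i \<in> X then acoef D i else acoef D i - pbar\<bar> \<le> abar + pbar"
    using a_bounds[of i] pbar by auto
qed (use assms X_sub in auto)

lemma bbar_pos: "k \<in> X \<Longrightarrow> 0 < bbar"
  using b_bounds[of k] X_sub by fastforce

text \<open>Schur test: row and column sums of the weights are at most \<open>2 * bbar\<close>,
  hence so is their spectral norm, and the diagonal contributes at most the same again.\<close>

lemma M_norm: "(\<Sum>i\<in>A. (mv_on A M y i)\<^sup>2) \<le> (4 * bbar)\<^sup>2 * (\<Sum>i\<in>A. (y i)\<^sup>2)"
proof -
  have CS: "(\<Sum>j\<in>A. G i j * y j)\<^sup>2 \<le> (2 * bbar) * (\<Sum>j\<in>A. G i j * (y j)\<^sup>2)" if i: "i \<in> A" for i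
  proof -
    have "(\<Sum>j\<in>A. sqrt (G i j) * (sqrt (G i j) * y j))\<^sup>2 \<le>
        (\<Sum>j\<in>A. (sqrt (G i j))\<^sup>2) * (\<Sum>j\<in>A. (sqrt (G i j) * y j)\<^sup>2)"
      by (rule Cauchy_Schwarz_ineq_sum)
    also have "(\<Sum>j\<in>A. sqrt (G i j) * (sqrt (G i j) * y j)) = (\<Sum>j\<in>A. G i j * y j)"
      using G_nonneg i by (intro sum.cong) (auto simp flip: mult.assoc)
    also have "(\<Sum>j\<in>A. (sqrt (G i j))\<^sup>2) = (\<Sum>j\<in>A. G i j)"
      using G_nonneg i by (intro sum.cong) auto
    also have "(\<Sum>j\<in>A. (sqrt (G i j) * y j)\<^sup>2) = (\<Sum>j\<in>A. G i j * (y j)\<^sup>2)"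
      using G_nonneg i by (intro sum.cong) (auto simp: power_mult_distrib)
    also have "(\<Sum>j\<in>A. G i j) * (\<Sum>j\<in>A. G i j * (y j)\<^sup>2) \<le> (2 * bbar) * (\<Sum>j\<in>A. G i j * (y j)\<^sup>2)"
      using row_dom[OF i] b_bounds[OF i] \<zeta> G_nonneg i by (intro mult_right_mono sum_nonneg) auto
    finally show ?thesis .
  qed
  have "(\<Sum>i\<in>A. (mv_on A M y i)\<^sup>2) \<le> (\<Sum>i\<in>A. 2 * (2 * bbar)\<^sup>2 * (y i)\<^sup>2 + 2 * (2 * bbar) * (\<Sum>j\<in>A. G i j * (y j)\<^sup>2))"
  proof (rule sum_mono)
    fix i assume i: "i \<in> A"
    have "(mv_on A M y i)\<^sup>2 \<le> 2 * (2 * bcoef D i * y i)\<^sup>2 + 2 * (\<Sum>j\<in>A. G i j * y j)\<^sup>2"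
      using sum_squares_bound[of "2 * bcoef D i * y i" "- (\<Sum>j\<in>A. G i j * y j)"]
      by (simp add: mv_M finA i power2_diff)
    moreover have "(2 * bcoef D i * y i)\<^sup>2 \<le> (2 * bbar)\<^sup>2 * (y i)\<^sup>2"
      unfolding power_mult_distrib[of _ "y i"] using b_bounds[OF i]
      by (intro mult_right_mono power_mono) auto
    ultimately show "(mv_on A M y i)\<^sup>2 \<le> 2 * (2 * bbar)\<^sup>2 * (y i)\<^sup>2 + 2 * (2 * bbar) * (\<Sum>j\<in>A. G i j * (y j)\<^sup>2)"
      using CS[OF i] by simp
  qed
  also have "\<dots> = 2 * (2 * bbar)\<^sup>2 * (\<Sum>i\<in>A. (y i)\<^sup>2) + 2 * (2 * bbar) * (\<Sum>j\<in>A. (\<Sum>i\<in>A. G i j) * (y j)\<^sup>2)"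
  proof -
    have "(\<Sum>i\<in>A. \<Sum>j\<in>A. G i j * (y j)\<^sup>2) = (\<Sum>j\<in>A. (\<Sum>i\<in>A. G i j) * (y j)\<^sup>2)"
      by (subst sum.swap) (simp add: sum_distrib_right)
    then show ?thesis by (simp only: sum.distrib sum_distrib_left[symmetric])
  qed
  also have "\<dots> \<le> 2 * (2 * bbar)\<^sup>2 * (\<Sum>i\<in>A. (y i)\<^sup>2) + 2 * (2 * bbar) * (\<Sum>j\<in>A. (2 * bbar) * (y j)\<^sup>2)"
  proof (cases "A = {}")
    case False
    then have "0 < bbar" using b_bounds by fastforce
    have "(\<Sum>i\<in>A. G i j) \<le> 2 * bbar" if "j \<in> A" for j
      using col_dom[OF that] b_bounds[OF that] \<zeta> by simp
    then show ?thesis using \<open>0 < bbar\<close>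
      by (intro add_left_mono mult_left_mono sum_mono mult_right_mono) auto
  qed simp
  also have "\<dots> = (4 * bbar)\<^sup>2 * (\<Sum>i\<in>A. (y i)\<^sup>2)"
    by (simp only: mult.assoc sum_distrib_left[symmetric]) (simp add: power2_eq_square)
  finally show ?thesis .
qed

text \<open>With \<open>b\<close> the extension of \<open>x\<close> by zero and \<open>y\<close> the
  solution for \<open>b\<close>, the form is the pairing of \<open>M y\<close> with
  \<open>y\<close>, hence at least \<zeta> times the sum of squares of \<open>y\<close>. The lower
  bound follows since \<open>M\<close> stretches by at most \<open>4 * bbar\<close>, the upper bound
  by Young's inequality with weight \<zeta>.\<close>

lemma W_form:
  assumes "X \<noteq> {}"
  shows "\<zeta> / (4 * bbar)\<^sup>2 * (\<Sum>i\<in>X. (x i)\<^sup>2) \<le> (\<Sum>i\<in>X. x i * mv_on X W x i)" (is ?l)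
    and "(\<Sum>i\<in>X. x i * mv_on X W x i) \<le> (\<Sum>i\<in>X. (x i)\<^sup>2) / \<zeta>" (is ?u)
proof -
  define b where "b = (\<lambda>i. if i \<in> X then x i else 0)"
  define y where "y = mv_on A Minv b"
  have bbar: "0 < bbar" using bbar_pos assms by blast
  have My: "mv_on A M y i = b i" if "i \<in> A" for i using that M_Minv by (simp add: y_def)
  have sq: "(\<Sum>i\<in>A. (b i)\<^sup>2) = (\<Sum>i\<in>X. (x i)\<^sup>2)"
    unfolding A_eq using disj by (subst sum.union_disjoint[OF finX finY disj]) (auto simp: b_def intro!: sum.neutral)
  have form: "(\<Sum>i\<in>X. x i * mv_on X W x i) = (\<Sum>i\<in>A. b i * y i)"
  proof -
    have "(\<Sum>i\<in>A. b i * y i) = (\<Sum>i\<in>X. b i * y i) + (\<Sum>i\<in>Y. b i * y i)"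
      unfolding A_eq by (rule sum.union_disjoint[OF finX finY disj])
    also have "(\<Sum>i\<in>Y. b i * y i) = 0" using disj by (auto simp: b_def intro!: sum.neutral)
    also have "(\<Sum>i\<in>X. b i * y i) = (\<Sum>i\<in>X. x i * mv_on X W x i)"
      by (intro sum.cong) (auto simp: W_eq_Minv y_def b_def)
    finally show ?thesis by simp
  qed
  have co: "\<zeta> * (\<Sum>i\<in>A. (y i)\<^sup>2) \<le> (\<Sum>i\<in>A. b i * y i)"
  proof -
    have "\<zeta> * (\<Sum>i\<in>A. (y i)\<^sup>2) \<le> (\<Sum>i\<in>A. y i * mv_on A M y i)"
      using M_coercive[of A] by (auto simp: coercive_on_def)
    then show ?thesis by (simp add: My mult_ac)
  qed
  have "(\<Sum>i\<in>A. (b i)\<^sup>2) \<le> (4 * bbar)\<^sup>2 * (\<Sum>i\<in>A. (y i)\<^sup>2)"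
    using M_norm[of y] by (simp add: My)
  then have "\<zeta> * (\<Sum>i\<in>A. (b i)\<^sup>2) \<le> (4 * bbar)\<^sup>2 * (\<zeta> * (\<Sum>i\<in>A. (y i)\<^sup>2))"
    using \<zeta> by (simp add: mult.left_commute)
  also have "\<dots> \<le> (4 * bbar)\<^sup>2 * (\<Sum>i\<in>A. b i * y i)"
    using co by (intro mult_left_mono) auto
  finally show ?l
    unfolding form sq using bbar by (simp add: field_simps)
  have "(\<Sum>i\<in>A. 2 * \<zeta> * (b i * y i)) \<le> (\<Sum>i\<in>A. (b i)\<^sup>2 + \<zeta>\<^sup>2 * (y i)\<^sup>2)"
    using sum_squares_bound[of "b _" "\<zeta> * y _"] by (intro sum_mono) (simp add: power_mult_distrib mult_ac)
  also have "\<dots> = (\<Sum>i\<in>A. (b i)\<^sup>2) + \<zeta> * (\<zeta> * (\<Sum>i\<in>A. (y i)\<^sup>2))"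
    by (simp add: sum.distrib sum_distrib_left power2_eq_square mult_ac)
  also have "\<dots> \<le> (\<Sum>i\<in>A. (b i)\<^sup>2) + \<zeta> * (\<Sum>i\<in>A. b i * y i)"
    using co \<zeta> by (intro add_left_mono mult_left_mono) auto
  finally have "\<zeta> * (\<Sum>i\<in>A. b i * y i) \<le> (\<Sum>i\<in>A. (b i)\<^sup>2)"
    by (simp add: sum_distrib_left[symmetric])
  then show ?u unfolding form sq using \<zeta> by (simp add: field_simps)
qed

end

section \<open>Equilibria and expected revenue\<close>

lemma (in prob_space) AE_witness:
  assumes "AE x in M. Q x" shows "\<exists>x\<in>space M. Q x"
proof (rule ccontr)
  assume "\<not> (\<exists>x\<in>space M. Q x)"
  then have "AE x in M. Q x \<longrightarrow> False" by (intro AE_I2) auto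
  then have "AE x in M. False" by (rule AE_mp[OF assms])
  then show False by simp
qed

text \<open>\<open>equilibrium_consumption\<close> is defined by a choice and need not be
  measurable. On the completion it is enough that it agrees almost everywhere with a measurable
  function.\<close>

lemma borel_measurable_completion_AE:
  assumes "g \<in> borel_measurable M" "AE x in M. f x = g x"
  shows "f \<in> borel_measurable (completion M)"
proof (rule measurableI)
  fix S :: "'b set" assume S: "S \<in> sets borel"
  have g: "g -` S \<inter> space M \<in> sets (completion M)"
    using measurable_sets[OF assms(1) S] by auto
  have "AE x in completion M. (x \<in> g -` S \<inter> space M) = (x \<in> f -` S \<inter> space M)"
    using assms(2) by (intro AE_completion) (auto elim!: eventually_mono)
  then show "f -` S \<inter> space (completion M) \<in> sets (completion M)"
    using completion.in_sets_AE[OF _ g, of "f -` S \<inter> space M"] by auto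
qed auto

lemma integral_completion_AE:
  fixes f g :: "'a \<Rightarrow> real"
  assumes "g \<in> borel_measurable M" "AE x in M. f x = g x"
  shows "(\<integral>x. f x \<partial>completion M) = (\<integral>x. g x \<partial>M)"
proof -
  have "(\<integral>x. f x \<partial>completion M) = (\<integral>x. g x \<partial>completion M)"
    using borel_measurable_completion_AE[OF assms] assms
    by (intro integral_cong_AE) (auto intro: AE_completion measurable_completion)
  also have "\<dots> = (\<integral>x. g x \<partial>M)" by (rule integral_completion[OF assms(1)])
  finally show ?thesis .
qed

text \<open>Strict concavity is part of the conclusion: with positive slope at 0 and
  \<open>d\<close> not positive the function keeps growing, so there is no maximizer. The rest is
  completing the square.\<close>

lemma is_arg_max_quadratic:
  fixes c d y :: real
  assumes c: "0 < c"
  shows "is_arg_max (\<lambda>z. c * z - d * z\<^sup>2) (\<lambda>z. 0 \<le> z) y \<longleftrightarrow> 0 < d \<and> y = c / (2 * d)"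
proof
  assume am: "is_arg_max (\<lambda>z. c * z - d * z\<^sup>2) (\<lambda>z. 0 \<le> z) y"
  then have y: "0 \<le> y" and le: "\<And>z. 0 \<le> z \<Longrightarrow> c * z - d * z\<^sup>2 \<le> c * y - d * y\<^sup>2"
    by (auto simp: is_arg_max_def not_less)
  have d: "0 < d"
  proof (rule ccontr)
    assume "\<not> 0 < d"
    then have "d * y\<^sup>2 \<ge> d * (y + 1)\<^sup>2" using y by (intro mult_left_mono_neg power_mono) auto
    then show False using le[of "y + 1"] y c by (simp add: algebra_simps)
  qed
  have "d * (y - c / (2 * d))\<^sup>2 = (c * (c / (2 * d)) - d * (c / (2 * d))\<^sup>2) - (c * y - d * y\<^sup>2)"
    using d by (simp add: field_simps power2_eq_square)
  also have "\<dots> \<le> 0" using le[of "c / (2 * d)"] c d by simp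
  finally have "(y - c / (2 * d))\<^sup>2 \<le> 0" using d by (simp add: mult_le_0_iff)
  then show "0 < d \<and> y = c / (2 * d)" using d by simp
next
  assume d: "0 < d \<and> y = c / (2 * d)"
  have "c * z - d * z\<^sup>2 \<le> c * y - d * y\<^sup>2" for z
  proof -
    have "(c * y - d * y\<^sup>2) - (c * z - d * z\<^sup>2) = d * (z - c / (2 * d))\<^sup>2"
      using d by (simp add: field_simps power2_eq_square)
    also have "\<dots> \<ge> 0" using d by simp
    finally show ?thesis by simp
  qed
  then show "is_arg_max (\<lambda>z. c * z - d * z\<^sup>2) (\<lambda>z. 0 \<le> z) y"
    using c d by (auto simp: is_arg_max_def not_less)
qed

context pricing_instance
begin

text \<open>A self loop enters the payoff as \<open>G i i\<close> times the square of the own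
  consumption, because the network sum is evaluated at the updated profile. Dominance alone does not
  make this effective curvature positive.\<close>

abbreviation "curv i \<equiv> bcoef D i - G i i"
abbreviation "net \<xi> p i \<equiv> acoef D i + \<xi> i - all_prices D pbar p i"

lemma payoff_quadratic:
  assumes "i \<in> A"
  shows "payoff D \<xi> i z y (all_prices D pbar p i)
    = (net \<xi> p i + (\<Sum>j\<in>A - {i}. G i j * y j)) * z - curv i * z\<^sup>2"
proof -
  have "(\<Sum>j\<in>A. G i j * z * (y(i := z)) j) = G i i * z * z + (\<Sum>j\<in>A - {i}. G i j * z * (y(i := z)) j)"
    using assms finA by (subst sum.remove[of A i]) auto
  also have "(\<Sum>j\<in>A - {i}. G i j * z * (y(i := z)) j) = (\<Sum>j\<in>A - {i}. G i j * y j) * z"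
    unfolding sum_distrib_right by (intro sum.cong) auto
  finally show ?thesis unfolding payoff_def by (simp add: algebra_simps power2_eq_square)
qed

text \<open>Positive net intercepts and nonnegative consumption of the others make every marginal
  payoff at zero positive, so nobody sits at the corner. An equilibrium is then a nonnegative
  solution of linear equations, and its existence forces positive curvature.\<close>

lemma equilibrium_iff:
  assumes pos: "\<And>i. i \<in> A \<Longrightarrow> 0 < net \<xi> p i"
  shows "consumption_equilibrium D \<xi> (all_prices D pbar p) y \<longleftrightarrow>
    (\<forall>i\<in>A. 0 \<le> y i \<and> 0 < curv i \<and> 2 * curv i * y i = net \<xi> p i + (\<Sum>j\<in>A - {i}. G i j * y j))"
proof -
  have *: "is_arg_max (\<lambda>z. payoff D \<xi> i z y (all_prices D pbar p i)) (\<lambda>z. 0 \<le> z) (y i)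
      \<longleftrightarrow> 0 < curv i \<and> 2 * curv i * y i = net \<xi> p i + (\<Sum>j\<in>A - {i}. G i j * y j)"
    if "\<forall>j\<in>A. 0 \<le> y j" "i \<in> A" for i
  proof -
    have "0 \<le> (\<Sum>j\<in>A - {i}. G i j * y j)"
      using that G_nonneg by (intro sum_nonneg) auto
    then have "0 < net \<xi> p i + (\<Sum>j\<in>A - {i}. G i j * y j)" using pos[OF that(2)] by simp
    from is_arg_max_quadratic[OF this, of "curv i" "y i"] show ?thesis
      unfolding payoff_quadratic[OF that(2)] by (auto simp: field_simps)
  qed
  show ?thesis
  proof
    assume eq: "consumption_equilibrium D \<xi> (all_prices D pbar p) y"
    then have "\<forall>j\<in>A. 0 \<le> y j" by (auto simp: consumption_equilibrium_def is_arg_max_def)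
    with eq * show "\<forall>i\<in>A. 0 \<le> y i \<and> 0 < curv i \<and> 2 * curv i * y i = net \<xi> p i + (\<Sum>j\<in>A - {i}. G i j * y j)"
      by (auto simp: consumption_equilibrium_def)
  next
    assume "\<forall>i\<in>A. 0 \<le> y i \<and> 0 < curv i \<and> 2 * curv i * y i = net \<xi> p i + (\<Sum>j\<in>A - {i}. G i j * y j)"
    with * show "consumption_equilibrium D \<xi> (all_prices D pbar p) y"
      by (auto simp: consumption_equilibrium_def)
  qed
qed

text \<open>The first-order condition carries the loop weight twice, the matrix \<open>M\<close>
  carries it once; the difference is the extra term on the right.\<close>

lemma equilibrium_network_eq:
  assumes "\<And>i. i \<in> A \<Longrightarrow> 0 < net \<xi> p i" "consumption_equilibrium D \<xi> (all_prices D pbar p) y" "i \<in> A"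
  shows "mv_on A M y i = net \<xi> p i + G i i * y i"
proof -
  have "2 * curv i * y i = net \<xi> p i + (\<Sum>j\<in>A - {i}. G i j * y j)"
    using assms equilibrium_iff by blast
  moreover have "(\<Sum>j\<in>A. G i j * y j) = G i i * y i + (\<Sum>j\<in>A - {i}. G i j * y j)"
    using assms(3) finA by (subst sum.remove[of A i]) auto
  ultimately show ?thesis by (simp add: mv_M finA assms(3) algebra_simps)
qed

text \<open>Monotone iteration: a scaled reference equilibrium is an upper barrier.\<close>

lemma equilibrium_exists:
  assumes "\<And>i. i \<in> A \<Longrightarrow> 0 < net \<xi>0 p0 i" "consumption_equilibrium D \<xi>0 (all_prices D pbar p0) y0"
    and pos: "\<And>i. i \<in> A \<Longrightarrow> 0 < net \<xi> p i"
  shows "\<exists>y. consumption_equilibrium D \<xi> (all_prices D pbar p) y"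
proof -
  have y0: "0 \<le> y0 i" "0 < curv i" "2 * curv i * y0 i = net \<xi>0 p0 i + (\<Sum>j\<in>A - {i}. G i j * y0 j)"
    if "i \<in> A" for i
    using equilibrium_iff[of \<xi>0 p0 y0] assms that by blast+
  \<comment> \<open>The largest ratio of the two intercepts makes \<open>K * y0\<close> a
    supersolution of the best-response map. The inserted 0 keeps the maximum defined for an empty
    network and makes \<open>K\<close> nonnegative.\<close>
  define K where "K = Max (insert 0 ((\<lambda>i. net \<xi> p i / net \<xi>0 p0 i) ` A))"
  have K0: "0 \<le> K" using finA by (simp add: K_def)
  have K: "net \<xi> p i \<le> K * net \<xi>0 p0 i" if "i \<in> A" for i
  proof -
    have "net \<xi> p i / net \<xi>0 p0 i \<le> K" unfolding K_def using finA that by (intro Max_ge) auto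
    then show ?thesis using assms(1)[OF that] by (simp add: divide_le_eq)
  qed
  define step where "step = (\<lambda>u i. (net \<xi> p i + (\<Sum>j\<in>A - {i}. G i j * u j)) / (2 * curv i))"
  define u where "u = (\<lambda>m. (step ^^ m) (\<lambda>_. 0))"
  have u_Suc: "u (Suc m) = step (u m)" for m by (simp add: u_def)
  have mono: "step v i \<le> step w i" if "\<And>j. j \<in> A \<Longrightarrow> v j \<le> w j" "i \<in> A" for v w i
    unfolding step_def using that y0(2)[OF that(2)] G_nonneg
    by (intro divide_right_mono add_left_mono sum_mono mult_left_mono) auto
  have incr: "0 \<le> u m i \<and> u m i \<le> u (Suc m) i \<and> u m i \<le> K * y0 i" if "i \<in> A" for m i
    using that
  proof (induction m arbitrary: i)
    case 0
    have "0 \<le> step (\<lambda>_. 0) i" using pos[OF 0] y0(2)[OF 0] by (simp add: step_def)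
    then show ?case using y0(1)[OF 0] K0 by (simp add: u_Suc) (simp add: u_def)
  next
    case (Suc m)
    have "u (Suc m) i \<le> u (Suc (Suc m)) i"
      unfolding u_Suc[of "Suc m"] unfolding u_Suc[of m]
      using Suc.IH Suc.prems unfolding u_Suc by (intro mono) blast+
    moreover have "0 \<le> u (Suc m) i" using Suc.IH[OF Suc.prems] by simp
    moreover have "u (Suc m) i \<le> K * y0 i"
    proof -
      have "u (Suc m) i \<le> step (\<lambda>j. K * y0 j) i"
        unfolding u_Suc by (rule mono) (use Suc in auto)
      also have "\<dots> \<le> (K * net \<xi>0 p0 i + (\<Sum>j\<in>A - {i}. G i j * (K * y0 j))) / (2 * curv i)"
        unfolding step_def using K[OF Suc.prems] y0(2)[OF Suc.prems] by (intro divide_right_mono add_right_mono) auto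
      also have "\<dots> = K * (2 * curv i * y0 i) / (2 * curv i)"
        unfolding y0(3)[OF Suc.prems] by (simp add: algebra_simps sum_distrib_left)
      also have "\<dots> = K * y0 i" using y0(2)[OF Suc.prems] by simp
      finally show ?thesis .
    qed
    ultimately show ?case by simp
  qed
  define y where "y = (\<lambda>i. lim (\<lambda>m. u m i))"
  have lim: "(\<lambda>m. u m i) \<longlonglongrightarrow> y i" if "i \<in> A" for i
  proof -
    have "incseq (\<lambda>m. u m i)" using incr[OF that] by (intro incseq_SucI) blast
    moreover have "\<forall>m. u m i \<le> K * y0 i" using incr[OF that] by blast
    ultimately obtain l where "(\<lambda>m. u m i) \<longlonglongrightarrow> l" by (rule incseq_convergent)
    then show ?thesis by (simp add: y_def limI)
  qed
  have "2 * curv i * y i = net \<xi> p i + (\<Sum>j\<in>A - {i}. G i j * y j)" if i: "i \<in> A" for i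
  proof -
    have "(\<lambda>m. step (u m) i) \<longlonglongrightarrow> step y i"
      unfolding step_def using y0(2)[OF i] lim by (intro tendsto_intros) auto
    moreover have "(\<lambda>m. step (u m) i) \<longlonglongrightarrow> y i"
      using LIMSEQ_Suc[OF lim[OF i]] by (simp add: u_Suc)
    ultimately have "y i = step y i" using LIMSEQ_unique by blast
    then show ?thesis using y0(2)[OF i] by (simp add: step_def field_simps)
  qed
  moreover have "0 \<le> y i" if "i \<in> A" for i
    by (rule LIMSEQ_le_const[OF lim[OF that]]) (use incr that in blast)
  ultimately show ?thesis using equilibrium_iff[of \<xi> p y] pos y0(2) by blast
qed

lemma AE_net_pos:
  assumes "t \<in> {1..n}"
  shows "AE \<omega> in P. \<forall>i\<in>A. pbar < acoef D i + shock D t \<omega> i"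
  using model assms finA unfolding pricing_model_def by (simp add: AE_finite_all)

lemma net_pos:
  assumes "\<forall>i\<in>A. pbar < acoef D i + \<xi> i" "\<And>k. k \<in> X \<Longrightarrow> p k \<le> pbar" "i \<in> A"
  shows "0 < net \<xi> p i"
  using assms by (fastforce simp: all_prices_def)

end

section \<open>Consumption and revenue at arbitrary prices, derived from the sampled reduced
  form\<close>

locale sampled_pricing = pricing_instance pbar abar bbar \<zeta> n D
  for pbar abar bbar \<zeta> n and D :: "('v, 'w) pricing" +
  assumes sampling: "regular_sampling pbar n D"
begin

lemma AE_data:
  assumes "t \<in> {1..n}"
  shows "AE \<omega> in P. (\<forall>k\<in>X. 0 \<le> price D t \<omega> k \<and> price D t \<omega> k \<le> pbar) \<and>
     (\<forall>k\<in>X. cons D t \<omega> k = v_vec D pbar k - mv_on X W (price D t \<omega>) k + eps D t \<omega> k)"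
proof (rule AE_conjI)
  show "AE \<omega> in P. \<forall>k\<in>X. 0 \<le> price D t \<omega> k \<and> price D t \<omega> k \<le> pbar"
    using model assms finX unfolding pricing_model_def by (simp add: AE_finite_all)
  show "AE \<omega> in P. \<forall>k\<in>X. cons D t \<omega> k = v_vec D pbar k - mv_on X W (price D t \<omega>) k + eps D t \<omega> k"
    using sampling assms unfolding regular_sampling_def by simp
qed

text \<open>The model admits self loops, which enter the first-order conditions with weight \<open>2 G i i\<close>
  instead of \<open>G i i\<close>. The sampled consumptions obey the reduced form, so no self loop
  can influence an observable agent.\<close>

lemma
  shows reference_equilibrium: "\<exists>\<xi> p y. (\<forall>i\<in>A. 0 < net \<xi> p i) \<and> consumption_equilibrium D \<xi> (all_prices D pbar p) y"
    and self_loop: "k \<in> X \<Longrightarrow> i \<in> A \<Longrightarrow> Minv k i * G i i = 0"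
proof -
  interpret prob_space P by (rule prob)
  have t: "1 \<in> {1..n}" using n by simp
  have "AE \<omega> in P. consumption_equilibrium D (shock D 1 \<omega>) (all_prices D pbar (price D 1 \<omega>)) (cons D 1 \<omega>)"
    using model t unfolding pricing_model_def by simp
  with AE_data[OF t] AE_net_pos[OF t]
  have "AE \<omega> in P. (\<forall>i\<in>A. pbar < acoef D i + shock D 1 \<omega> i) \<and> (\<forall>k\<in>X. price D 1 \<omega> k \<le> pbar) \<and>
     (\<forall>k\<in>X. cons D 1 \<omega> k = v_vec D pbar k - mv_on X W (price D 1 \<omega>) k + eps D 1 \<omega> k) \<and>
     consumption_equilibrium D (shock D 1 \<omega>) (all_prices D pbar (price D 1 \<omega>)) (cons D 1 \<omega>)"
    by (elim eventually_rev_mp) (auto intro!: AE_I2)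
  then obtain \<omega> where \<omega>: "\<forall>i\<in>A. pbar < acoef D i + shock D 1 \<omega> i" "\<forall>k\<in>X. price D 1 \<omega> k \<le> pbar"
     "\<forall>k\<in>X. cons D 1 \<omega> k = v_vec D pbar k - mv_on X W (price D 1 \<omega>) k + eps D 1 \<omega> k"
     "consumption_equilibrium D (shock D 1 \<omega>) (all_prices D pbar (price D 1 \<omega>)) (cons D 1 \<omega>)"
    using AE_witness by blast
  define y where "y = cons D 1 \<omega>"
  have pos: "0 < net (shock D 1 \<omega>) (price D 1 \<omega>) i" if "i \<in> A" for i
    using \<omega>(1,2) that by (intro net_pos) auto
  then show "\<exists>\<xi> p y. (\<forall>i\<in>A. 0 < net \<xi> p i) \<and> consumption_equilibrium D \<xi> (all_prices D pbar p) y"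
    using \<omega>(4) by blast
  assume k: "k \<in> X" and i: "i \<in> A"
  have y: "0 < y j" if "j \<in> A" for j
  proof -
    note eqs = iffD1[OF equilibrium_iff[OF pos] \<omega>(4), folded y_def]
    have "0 \<le> (\<Sum>l\<in>A - {j}. G j l * y l)"
      using eqs that G_nonneg by (intro sum_nonneg mult_nonneg_nonneg) auto
    moreover have "0 < curv j" "2 * curv j * y j = net (shock D 1 \<omega>) (price D 1 \<omega>) j + (\<Sum>l\<in>A - {j}. G j l * y l)"
      using eqs that by blast+
    ultimately have "0 < curv j" "0 < 2 * curv j * y j" using pos[OF that] by linarith+
    then show ?thesis by (simp add: zero_less_mult_iff)
  qed
  have "y k = mv_on A Minv (\<lambda>j. net (shock D 1 \<omega>) (price D 1 \<omega>) j + G j j * y j) k"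
    using equilibrium_network_eq[OF pos \<omega>(4)] k X_sub by (intro Minv_unique) (auto simp: y_def)
  moreover have "y k = mv_on A Minv (net (shock D 1 \<omega>) (price D 1 \<omega>)) k"
    using \<omega>(3) k affine_eq_Minv[OF k] by (simp add: y_def)
  \<comment> \<open>Two representations of \<open>y k\<close> through \<open>Minv\<close> differ
    exactly by the loop terms, so these sum to zero. All of them are nonnegative, hence each
    vanishes, and strict positivity of consumption lets \<open>y i\<close> be cancelled.\<close>
  ultimately have "(\<Sum>j\<in>A. Minv k j * (G j j * y j)) = 0"
    by (simp add: mv_on_add) (simp add: mv_on_def)
  moreover have "\<forall>j\<in>A. 0 \<le> Minv k j * (G j j * y j)"
    using Minv_entry_nonneg X_sub[OF k] G_nonneg y by (intro ballI mult_nonneg_nonneg) (auto intro: less_imp_le)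
  ultimately have "Minv k i * (G i i * y i) = 0"
    using finA i by (simp add: sum_nonneg_eq_0_iff)
  then show "Minv k i * G i i = 0" using y[OF i] by auto
qed

text \<open>An equilibrium exists by comparison with the reference one, and every equilibrium solves
  the linear system up to loop terms that do not reach the observable agents. On these the choice
  made in the definition is therefore immaterial.\<close>

lemma equilibrium_consumption_affine:
  assumes "\<forall>i\<in>A. pbar < acoef D i + shock D t \<omega> i" "\<And>k. k \<in> X \<Longrightarrow> p k \<le> pbar" "k \<in> X"
  shows "equilibrium_consumption D pbar t p \<omega> k = v_vec D pbar k - mv_on X W p k + eps D t \<omega> k"
proof -
  have pos: "0 < net (shock D t \<omega>) p i" if "i \<in> A" for i using assms(1,2) that by (intro net_pos)
  obtain \<xi>0 p0 y0 where ref: "\<forall>i\<in>A. 0 < net \<xi>0 p0 i" "consumption_equilibrium D \<xi>0 (all_prices D pbar p0) y0"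
    using reference_equilibrium by blast
  define y where "y = equilibrium_consumption D pbar t p \<omega>"
  have "\<exists>y. consumption_equilibrium D (shock D t \<omega>) (all_prices D pbar p) y"
    by (rule equilibrium_exists[OF _ ref(2) pos]) (use ref in auto)
  then have "consumption_equilibrium D (shock D t \<omega>) (all_prices D pbar p) y"
    unfolding y_def equilibrium_consumption_def by (rule someI_ex)
  then have "mv_on A M y i = net (shock D t \<omega>) p i + G i i * y i" if "i \<in> A" for i
    using equilibrium_network_eq[OF pos] that by blast
  then have "y k = mv_on A Minv (\<lambda>i. net (shock D t \<omega>) p i + G i i * y i) k"
    using X_sub[OF assms(3)] by (intro Minv_unique) auto
  also have "\<dots> = mv_on A Minv (net (shock D t \<omega>) p) k + mv_on A Minv (\<lambda>i. G i i * y i) k"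
    by (rule mv_on_add)
  also have "mv_on A Minv (\<lambda>i. G i i * y i) k = 0"
    unfolding mv_on_def using self_loop[OF assms(3)] by (intro sum.neutral) auto
  finally show ?thesis using affine_eq_Minv[OF assms(3)] by (simp add: y_def)
qed

lemma eps_integrable:
  assumes "t \<in> {1..n}" "k \<in> X"
  shows "integrable P (\<lambda>\<omega>. eps D t \<omega> k)" "(\<integral>\<omega>. eps D t \<omega> k \<partial>P) = 0"
proof -
  have sh: "integrable P (\<lambda>\<omega>. shock D t \<omega> i)" "(\<integral>\<omega>. shock D t \<omega> i \<partial>P) = 0" if "i \<in> A" for i
    using model assms(1) that unfolding pricing_model_def by auto
  have eq: "eps D t \<omega> k = (\<Sum>i\<in>A. Minv k i * shock D t \<omega> i)" for \<omega>
    using eps_eq_Minv[OF assms(2)] by (simp add: mv_on_def)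
  show "integrable P (\<lambda>\<omega>. eps D t \<omega> k)" unfolding eq using sh by (intro Bochner_Integration.integrable_sum) auto
  show "(\<integral>\<omega>. eps D t \<omega> k \<partial>P) = 0" unfolding eq using sh by (subst Bochner_Integration.integral_sum) auto
qed

text \<open>The noise has mean zero, and almost sure agreement with the affine form suffices because
  the revenue is integrated over the completion.\<close>

lemma expected_revenue_quadratic:
  assumes t: "t \<in> {1..n}" and p: "\<And>k. k \<in> X \<Longrightarrow> p k \<le> pbar"
  shows "expected_revenue D pbar t p = (\<Sum>k\<in>X. p k * (v_vec D pbar k - mv_on X W p k))"
proof -
  interpret prob_space P by (rule prob)
  let ?g = "\<lambda>\<omega>. \<Sum>k\<in>X. p k * (v_vec D pbar k - mv_on X W p k) + p k * eps D t \<omega> k"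
  have "expected_revenue D pbar t p = (\<integral>\<omega>. ?g \<omega> \<partial>P)"
    unfolding expected_revenue_def
  proof (rule integral_completion_AE)
    show "?g \<in> borel_measurable P" using eps_integrable[OF t] by measurable
    show "AE \<omega> in P. (\<Sum>k\<in>X. p k * equilibrium_consumption D pbar t p \<omega> k) = ?g \<omega>"
      using AE_net_pos[OF t]
    proof eventually_elim
      case (elim \<omega>)
      then show ?case
        by (intro sum.cong) (simp_all add: equilibrium_consumption_affine p distrib_left)
    qed
  qed
  also have "\<dots> = (\<Sum>k\<in>X. p k * (v_vec D pbar k - mv_on X W p k))"
    using eps_integrable[OF t] by (subst Bochner_Integration.integral_sum) (auto simp: prob_space)
  finally show ?thesis .
qed

end

section \<open>Revenue near the optimum\<close>

lemma quadratic_max_interior: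
  fixes g w \<eta> :: real
  assumes "0 < \<eta>" "\<And>h. \<bar>h\<bar> < \<eta> \<Longrightarrow> h * g - h\<^sup>2 * w \<le> 0"
  shows "g = 0"
proof (rule ccontr)
  assume g: "g \<noteq> 0"
  \<comment> \<open>A step in the direction of \<open>g\<close>, so short that the quadratic term is
    less than the linear one, and short enough to stay admissible.\<close>
  define h where "h = sgn g * min (\<eta> / 2) (\<bar>g\<bar> / (2 * (\<bar>w\<bar> + 1)))"
  have m: "0 < min (\<eta> / 2) (\<bar>g\<bar> / (2 * (\<bar>w\<bar> + 1)))" using assms(1) g by simp
  then have h: "\<bar>h\<bar> = min (\<eta> / 2) (\<bar>g\<bar> / (2 * (\<bar>w\<bar> + 1)))" using g by (simp add: h_def abs_mult abs_sgn_eq)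
  have "\<bar>h\<bar> < \<eta>" unfolding h using assms(1) by linarith
  from assms(2)[OF this] have "h * g \<le> h\<^sup>2 * w" by simp
  moreover have "h * g = \<bar>h\<bar> * \<bar>g\<bar>" unfolding h unfolding h_def by (simp add: abs_sgn mult_ac)
  moreover have "h\<^sup>2 * w \<le> \<bar>h\<bar> * (\<bar>h\<bar> * \<bar>w\<bar>)"
    using mult_left_mono[of w "\<bar>w\<bar>" "h\<^sup>2"] by (simp add: power2_eq_square mult.assoc[symmetric] flip: abs_mult)
  ultimately have "\<bar>h\<bar> * \<bar>g\<bar> \<le> \<bar>h\<bar> * (\<bar>h\<bar> * \<bar>w\<bar>)" by linarith
  then have "\<bar>g\<bar> \<le> \<bar>h\<bar> * \<bar>w\<bar>" using m h by (simp add: mult_le_cancel_left)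
  also have "\<bar>h\<bar> * \<bar>w\<bar> \<le> \<bar>g\<bar> / (2 * (\<bar>w\<bar> + 1)) * \<bar>w\<bar>" unfolding h by (intro mult_right_mono) auto
  also have "\<dots> < \<bar>g\<bar>" using g by (simp add: field_simps) (smt (verit) mult_nonneg_nonneg)
  finally show False by simp
qed

section \<open>Exact second-order expansion of the revenue at the optimal prices\<close>

context sampled_pricing
begin

lemma bilinear_swap: "(\<Sum>k\<in>X. x k * mv_on X W y k) = (\<Sum>k\<in>X. y k * mv_on X (\<lambda>i j. W j i) x k)"
  unfolding mv_on_def sum_distrib_left by (subst sum.swap) (simp add: mult_ac)

text \<open>The expansion is exact. The gradient involves \<open>W\<close> plus its transpose
  because the price enters both as factor and as argument; the remainder is the form of
  \<open>W\<close> itself.\<close>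

lemma revenue_increment:
  "(\<Sum>k\<in>X. (p k + d k) * (v k - mv_on X W (\<lambda>j. p j + d j) k)) - (\<Sum>k\<in>X. p k * (v k - mv_on X W p k))
   = (\<Sum>k\<in>X. d k * (v k - mv_on X (\<lambda>i j. W i j + W j i) p k)) - (\<Sum>k\<in>X. d k * mv_on X W d k)"
proof -
  have s: "mv_on X (\<lambda>i j. W i j + W j i) p k = mv_on X W p k + mv_on X (\<lambda>i j. W j i) p k" for k
    by (simp add: mv_on_def distrib_right sum.distrib)
  have "(\<Sum>k\<in>X. p k * mv_on X W d k) = (\<Sum>k\<in>X. d k * mv_on X (\<lambda>i j. W j i) p k)"
    by (rule bilinear_swap)
  then show ?thesis
    unfolding s mv_on_add by (simp add: algebra_simps sum.distrib sum_subtractf)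
qed

context
  fixes t :: nat and pstar :: "'v \<Rightarrow> real"
  assumes t: "t \<in> {1..n}" and opt: "optimal_prices D pbar t pstar"
    and interior: "\<And>k. k \<in> X \<Longrightarrow> 0 < pstar k \<and> pstar k < pbar"
begin

lemma optimality:
  assumes "\<And>k. k \<in> X \<Longrightarrow> 0 \<le> q k \<and> q k \<le> pbar"
  shows "(\<Sum>k\<in>X. q k * (v_vec D pbar k - mv_on X W q k)) \<le> (\<Sum>k\<in>X. pstar k * (v_vec D pbar k - mv_on X W pstar k))"
proof -
  have "expected_revenue D pbar t q \<le> expected_revenue D pbar t pstar"
    using opt assms unfolding optimal_prices_def is_arg_max_def by (auto simp: not_less)
  then show ?thesis
    using assms interior by (simp add: expected_revenue_quadratic[OF t] less_imp_le)
qed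

text \<open>Interior optimality allows perturbations of both signs in a single coordinate;
  \<open>\<eta>\<close> is the distance to the nearer end of the price interval.\<close>

lemma first_order_condition:
  assumes k: "k \<in> X"
  shows "mv_on X (\<lambda>i j. W i j + W j i) pstar k = v_vec D pbar k"
proof -
  define \<eta> where "\<eta> = min (pstar k) (pbar - pstar k)"
  define g where "g = v_vec D pbar k - mv_on X (\<lambda>i j. W i j + W j i) pstar k"
  have "0 < \<eta>" using interior[OF k] by (simp add: \<eta>_def)
  moreover have "h * g - h\<^sup>2 * W k k \<le> 0" if "\<bar>h\<bar> < \<eta>" for h
  proof -
    define d where "d = (\<lambda>j. if j = k then h else 0)"
    have "0 \<le> pstar l + d l \<and> pstar l + d l \<le> pbar" if "l \<in> X" for l
      using interior[OF that] \<open>\<bar>h\<bar> < \<eta>\<close> by (auto simp: d_def \<eta>_def)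
    from optimality[of "\<lambda>l. pstar l + d l", OF this]
    have "(\<Sum>l\<in>X. d l * (v_vec D pbar l - mv_on X (\<lambda>i j. W i j + W j i) pstar l)) - (\<Sum>l\<in>X. d l * mv_on X W d l) \<le> 0"
      using revenue_increment[of pstar d "v_vec D pbar"] by simp
    moreover have "(\<Sum>l\<in>X. d l * f l) = h * f k" for f
      using finX k by (simp add: d_def if_distrib[of "\<lambda>c. c * _"] cong: if_cong)
    moreover have "mv_on X W d k = h * W k k" unfolding d_def by (rule mv_on_unit[OF finX k])
    ultimately show ?thesis by (simp add: g_def power2_eq_square mult_ac)
  qed
  ultimately have "g = 0" by (rule quadratic_max_interior)
  then show ?thesis by (simp add: g_def)
qed

text \<open>Comparison with the uniform price \<open>pbar / 2\<close>. Shocks have mean zero while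
  intercept plus shock exceeds \<open>pbar\<close> almost surely, so every intercept is at least
  \<open>pbar\<close>. All net intercepts are then nonnegative, the observable ones at least
  \<open>pbar / 2\<close>, and nonnegativity of \<open>Minv\<close> bounds each consumption by
  \<open>pbar / (4 * bbar)\<close> from below.\<close>

lemma optimal_revenue_lower:
  "real (card X) * (pbar\<^sup>2 / (8 * bbar)) \<le> expected_revenue D pbar t pstar"
proof -
  have "(\<Sum>k\<in>X. pbar / 2 * (pbar / 2 / (2 * bbar))) \<le> (\<Sum>k\<in>X. pbar / 2 * (v_vec D pbar k - mv_on X W (\<lambda>_. pbar / 2) k))"
  proof (intro sum_mono mult_left_mono)
    fix k assume k: "k \<in> X"
    interpret prob_space P by (rule prob)
    have "pbar \<le> acoef D i" if "i \<in> A" for i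
    proof -
      have "integrable P (\<lambda>\<omega>. shock D t \<omega> i)" "(\<integral>\<omega>. shock D t \<omega> i \<partial>P) = 0"
        using model t that unfolding pricing_model_def by auto
      moreover have "AE \<omega> in P. pbar - acoef D i \<le> shock D t \<omega> i"
        using AE_net_pos[OF t] that by (auto elim!: eventually_mono)
      ultimately have "pbar - acoef D i \<le> 0" using integral_ge_const[of "\<lambda>\<omega>. shock D t \<omega> i" "pbar - acoef D i"] by simp
      then show ?thesis by simp
    qed
    note a = this
    have "v_vec D pbar k - mv_on X W (\<lambda>_. pbar / 2) k
        = mv_on A Minv (\<lambda>i. (if i \<in> X then acoef D i else acoef D i - pbar) - (if i \<in> X then pbar / 2 else 0)) k"
      unfolding mv_on_diff v_eq_Minv[OF k] W_eq_Minv[OF k] by simp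
    also have "\<dots> \<ge> (acoef D k - pbar / 2) / (2 * bbar)"
      using Minv_nonneg(1)[of "\<lambda>i. (if i \<in> X then acoef D i else acoef D i - pbar) - (if i \<in> X then pbar / 2 else 0)" k]
        a pbar X_sub[OF k] k by fastforce
    also have "(acoef D k - pbar / 2) / (2 * bbar) \<ge> pbar / 2 / (2 * bbar)"
      using a[OF X_sub[OF k]] bbar_pos[OF k] by (intro divide_right_mono) auto
    finally show "pbar / 2 / (2 * bbar) \<le> v_vec D pbar k - mv_on X W (\<lambda>_. pbar / 2) k" .
  qed (use pbar in auto)
  also have "\<dots> \<le> expected_revenue D pbar t pstar"
    using optimality[of "\<lambda>_. pbar / 2"] interior pbar
    by (simp add: expected_revenue_quadratic[OF t] less_imp_le)
  finally show ?thesis by (simp add: power2_eq_square)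
qed

text \<open>At \<open>pstar\<close> the first-order term vanishes, so the loss is exactly the form
  of \<open>W\<close> at the price error. Numerator and optimal revenue both scale with the number
  of observable agents, which leaves an average.\<close>

lemma regret_bound:
  assumes X: "X \<noteq> {}" and p: "\<And>k. k \<in> X \<Longrightarrow> 0 \<le> p k \<and> p k \<le> pbar"
  shows "regret D pbar t pstar p \<le> 8 * bbar / (\<zeta> * pbar\<^sup>2) * ((\<Sum>k\<in>X. (p k - pstar k)\<^sup>2) / real (card X))"
proof -
  define d where "d = (\<lambda>k. p k - pstar k)"
  have bb: "0 < bbar" using X bbar_pos by blast
  have card: "0 < real (card X)" using X finX by (simp add: card_gt_0_iff)
  have "expected_revenue D pbar t p - expected_revenue D pbar t pstar = - (\<Sum>k\<in>X. d k * mv_on X W d k)"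
    using revenue_increment[of pstar d "v_vec D pbar"] p interior
    by (simp add: expected_revenue_quadratic[OF t] less_imp_le first_order_condition d_def)
  then have num: "expected_revenue D pbar t pstar - expected_revenue D pbar t p \<le> (\<Sum>k\<in>X. (d k)\<^sup>2) / \<zeta>"
    using W_form(2)[OF X, of d] by simp
  have low: "0 < real (card X) * (pbar\<^sup>2 / (8 * bbar))" using card pbar bb by simp
  have "regret D pbar t pstar p \<le> ((\<Sum>k\<in>X. (d k)\<^sup>2) / \<zeta>) / expected_revenue D pbar t pstar"
    unfolding regret_def using num low optimal_revenue_lower by (intro divide_right_mono) auto
  also have "\<dots> \<le> ((\<Sum>k\<in>X. (d k)\<^sup>2) / \<zeta>) / (real (card X) * (pbar\<^sup>2 / (8 * bbar)))"
    using optimal_revenue_lower \<zeta>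
    by (intro divide_left_mono[OF _ _ mult_pos_pos[OF less_le_trans[OF low optimal_revenue_lower] low]] divide_nonneg_pos sum_nonneg) auto
  also have "\<dots> = 8 * bbar / (\<zeta> * pbar\<^sup>2) * ((\<Sum>k\<in>X. (p k - pstar k)\<^sup>2) / real (card X))"
    by (simp add: d_def mult_ac)
  finally show ?thesis .
qed

end

end

section \<open>Thresholding\<close>

lemma sum_le_norm_inf_on: "finite I \<Longrightarrow> i \<in> I \<Longrightarrow> (\<Sum>j\<in>I. \<bar>A i j\<bar>) \<le> norm_inf_on I A"
  unfolding norm_inf_on_def by (intro Max_ge) auto

lemma sum_le_norm_1_on: "finite I \<Longrightarrow> j \<in> I \<Longrightarrow> (\<Sum>i\<in>I. \<bar>A i j\<bar>) \<le> norm_1_on I A"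
  unfolding norm_1_on_def by (intro Max_ge) auto

text \<open>A deleted entry has true modulus at most \<mu> plus the estimation error, hence at most
  3/2 \<mu>. For a kept entry the factor 2 in the hypothesis puts the true modulus above \<mu> / 2
  and the error below it, so thresholding never does worse than estimating by zero.\<close>

lemma threshold_entry_error:
  assumes "2 * \<bar>Wc k j - w\<bar> \<le> \<mu> k j"
  shows "\<bar>threshold \<mu> Wc k j - w\<bar> \<le> 3 / 2 * \<mu> k j" "\<bar>threshold \<mu> Wc k j - w\<bar> \<le> \<bar>w\<bar>"
  using assms abs_triangle_ineq[of "Wc k j - w" w] abs_triangle_ineq2_sym[of w "Wc k j"]
  unfolding threshold_def by (auto split: if_splits)

lemma sum_sparse_bound:
  fixes e u :: "'i \<Rightarrow> real"
  assumes "finite I" "card {j\<in>I. u j \<noteq> 0} \<le> s" "0 \<le> \<beta>"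
    "\<And>j. j \<in> I \<Longrightarrow> e j \<le> \<beta>" "\<And>j. j \<in> I \<Longrightarrow> u j = 0 \<Longrightarrow> e j \<le> f j" "\<And>j. 0 \<le> f j"
  shows "(\<Sum>j\<in>I. e j) \<le> real s * \<beta> + (\<Sum>j\<in>I. f j)"
proof -
  have "(\<Sum>j\<in>I. e j) \<le> (\<Sum>j\<in>I. (if u j \<noteq> 0 then \<beta> else 0) + f j)"
    using assms(3-6) by (intro sum_mono) (smt (verit))
  also have "\<dots> = real (card {j\<in>I. u j \<noteq> 0}) * \<beta> + (\<Sum>j\<in>I. f j)"
    using assms(1) by (simp only: sum.distrib flip: sum.inter_filter) simp
  also have "\<dots> \<le> real s * \<beta> + (\<Sum>j\<in>I. f j)"
    using assms(2,3) by (intro add_right_mono mult_right_mono) auto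
  finally show ?thesis .
qed

text \<open>On the support of the sparse approximant \<open>U\<close> there are at most
  \<open>s\<close> entries per row and column, each with error at most
  \<open>3 / 2 * \<beta>\<close>. Off the support the error is at most the entry of
  \<open>W\<close>, which there equals the entry of \<open>W - U\<close>.\<close>

lemma threshold_sum_error:
  fixes W Wc \<mu> :: "'i \<Rightarrow> 'i \<Rightarrow> real" and \<beta> r :: real
  assumes I: "finite I"
    and approx: "sparse_approximable_on I W s r"
    and err: "\<And>k j. k \<in> I \<Longrightarrow> j \<in> I \<Longrightarrow> 2 * \<bar>Wc k j - W k j\<bar> \<le> \<mu> k j \<and> \<mu> k j \<le> \<beta>"
    and k: "k \<in> I"
  shows "(\<Sum>j\<in>I. \<bar>threshold \<mu> Wc k j - W k j\<bar>) \<le> 3 / 2 * real s * \<beta> + r"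
    and "(\<Sum>j\<in>I. \<bar>threshold \<mu> Wc j k - W j k\<bar>) \<le> 3 / 2 * real s * \<beta> + r"
proof -
  obtain U where U: "sparse_on I s U"
      "max (norm_1_on I (\<lambda>i j. W i j - U i j)) (norm_inf_on I (\<lambda>i j. W i j - U i j)) \<le> r"
    using approx unfolding sparse_approximable_on_def by blast
  have "0 \<le> 2 * \<bar>Wc k k - W k k\<bar>" by simp
  also have "\<dots> \<le> \<mu> k k" using err[OF k k] by blast
  also have "\<dots> \<le> \<beta>" using err[OF k k] by blast
  finally have b: "0 \<le> \<beta>" .
  have e: "\<bar>threshold \<mu> Wc i j - W i j\<bar> \<le> 3 / 2 * \<beta>" "\<bar>threshold \<mu> Wc i j - W i j\<bar> \<le> \<bar>W i j\<bar>"
    if "i \<in> I" "j \<in> I" for i j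
    using threshold_entry_error[of Wc i j "W i j" \<mu>] err[OF that] by force+
  have "(\<Sum>j\<in>I. \<bar>threshold \<mu> Wc k j - W k j\<bar>) \<le> real s * (3 / 2 * \<beta>) + (\<Sum>j\<in>I. \<bar>W k j - U k j\<bar>)"
    using U(1) k e[OF k] b by (intro sum_sparse_bound[of I "U k"] I) (auto simp: sparse_on_def)
  also have "(\<Sum>j\<in>I. \<bar>W k j - U k j\<bar>) \<le> r"
    using sum_le_norm_inf_on[OF I k, of "\<lambda>i j. W i j - U i j"] U(2) by simp
  finally show "(\<Sum>j\<in>I. \<bar>threshold \<mu> Wc k j - W k j\<bar>) \<le> 3 / 2 * real s * \<beta> + r" by simp
  have "(\<Sum>j\<in>I. \<bar>threshold \<mu> Wc j k - W j k\<bar>) \<le> real s * (3 / 2 * \<beta>) + (\<Sum>j\<in>I. \<bar>W j k - U j k\<bar>)"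
    using U(1) k e[OF _ k] b by (intro sum_sparse_bound[of I "\<lambda>j. U j k"] I) (auto simp: sparse_on_def)
  also have "(\<Sum>j\<in>I. \<bar>W j k - U j k\<bar>) \<le> r"
    using sum_le_norm_1_on[OF I k, of "\<lambda>i j. W i j - U i j"] U(2) by simp
  finally show "(\<Sum>j\<in>I. \<bar>threshold \<mu> Wc j k - W j k\<bar>) \<le> 3 / 2 * real s * \<beta> + r" by simp
qed

text \<open>Schur test in its quadratic-form version, by the same splitting of products as for
  coercivity of the network matrix.\<close>

lemma bilinear_schur_bound:
  fixes E :: "'i \<Rightarrow> 'i \<Rightarrow> real"
  assumes I: "finite I"
    and row: "\<And>i. i \<in> I \<Longrightarrow> (\<Sum>j\<in>I. \<bar>E i j\<bar>) \<le> \<delta>" and col: "\<And>j. j \<in> I \<Longrightarrow> (\<Sum>i\<in>I. \<bar>E i j\<bar>) \<le> \<delta>"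
  shows "\<bar>\<Sum>i\<in>I. x i * mv_on I E x i\<bar> \<le> \<delta> * (\<Sum>i\<in>I. (x i)\<^sup>2)"
proof -
  have "\<bar>\<Sum>i\<in>I. x i * mv_on I E x i\<bar> \<le> (\<Sum>i\<in>I. \<Sum>j\<in>I. \<bar>x i * (E i j * x j)\<bar>)"
    unfolding mv_on_def sum_distrib_left by (intro sum_abs[THEN order_trans] sum_mono sum_abs)
  also have "\<dots> \<le> (\<Sum>i\<in>I. \<Sum>j\<in>I. \<bar>E i j\<bar> * (x i)\<^sup>2 / 2 + \<bar>E i j\<bar> * (x j)\<^sup>2 / 2)"
  proof (intro sum_mono)
    fix i j
    have "\<bar>x i\<bar> * \<bar>x j\<bar> \<le> (x i)\<^sup>2 / 2 + (x j)\<^sup>2 / 2"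
      using sum_squares_bound[of "\<bar>x i\<bar>" "\<bar>x j\<bar>"] by simp
    then have "\<bar>E i j\<bar> * (\<bar>x i\<bar> * \<bar>x j\<bar>) \<le> \<bar>E i j\<bar> * ((x i)\<^sup>2 / 2 + (x j)\<^sup>2 / 2)"
      by (rule mult_left_mono) simp
    then show "\<bar>x i * (E i j * x j)\<bar> \<le> \<bar>E i j\<bar> * (x i)\<^sup>2 / 2 + \<bar>E i j\<bar> * (x j)\<^sup>2 / 2"
      by (simp add: abs_mult algebra_simps)
  qed
  also have "\<dots> = (\<Sum>i\<in>I. (\<Sum>j\<in>I. \<bar>E i j\<bar>) * (x i)\<^sup>2 / 2) + (\<Sum>j\<in>I. (\<Sum>i\<in>I. \<bar>E i j\<bar>) * (x j)\<^sup>2 / 2)"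
  proof -
    have "(\<Sum>i\<in>I. \<Sum>j\<in>I. \<bar>E i j\<bar> * (x j)\<^sup>2 / 2) = (\<Sum>j\<in>I. (\<Sum>i\<in>I. \<bar>E i j\<bar>) * (x j)\<^sup>2 / 2)"
      by (subst sum.swap) (simp add: sum_distrib_right sum_divide_distrib)
    then show ?thesis by (simp add: sum.distrib sum_distrib_right sum_divide_distrib)
  qed
  also have "\<dots> \<le> (\<Sum>i\<in>I. \<delta> * (x i)\<^sup>2 / 2) + (\<Sum>j\<in>I. \<delta> * (x j)\<^sup>2 / 2)"
    using row col by (intro add_mono sum_mono divide_right_mono mult_right_mono) auto
  also have "\<dots> = \<delta> * (\<Sum>i\<in>I. (x i)\<^sup>2)"
    by (simp add: sum_divide_distrib[symmetric] sum_distrib_left[symmetric])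
  finally show ?thesis .
qed

text \<open>For the difference \<open>d\<close> of the two solutions, \<open>Q d\<close> equals the
  error of the right-hand side minus \<open>(Q - R) p\<close>, and coercivity gives that
  \<open>c\<close> times the norm of \<open>d\<close> is at most the norm of \<open>Q d\<close>. The
  invertibility of \<open>Q\<close>, without which \<open>inv_on\<close> is unspecified, is part of
  the argument.\<close>

lemma coercive_perturbation_solution:
  fixes Q R :: "'i \<Rightarrow> 'i \<Rightarrow> real"
  assumes I: "finite I" and c: "0 < c" and co: "coercive_on I c Q"
    and p: "\<And>i. i \<in> I \<Longrightarrow> mv_on I R p i = v i"
    and diff: "\<And>i. i \<in> I \<Longrightarrow> \<bar>mv_on I (\<lambda>i j. Q i j - R i j) p i\<bar> \<le> \<gamma>"
  shows "c\<^sup>2 * (\<Sum>i\<in>I. (mv_on I (inv_on I Q) v' i - p i)\<^sup>2) \<le> 2 * (\<Sum>i\<in>I. (v' i - v i)\<^sup>2) + 2 * real (card I) * \<gamma>\<^sup>2"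
proof -
  define d where "d = (\<lambda>i. mv_on I (inv_on I Q) v' i - p i)"
  define h where "h = mv_on I (\<lambda>i j. Q i j - R i j) p"
  have Q: "inverse_pair_on I Q (inv_on I Q)"
    by (intro inv_on_inverse coercive_on_invertible[OF I c co])
  have Qd: "mv_on I Q d i = v' i - v i - h i" if "i \<in> I" for i
  proof -
    have "mv_on I Q p i = h i + mv_on I R p i"
      by (simp add: h_def mv_on_def left_diff_distrib sum_subtractf)
    then show ?thesis
      unfolding d_def mv_on_diff using mv_on_inverse(1)[OF Q I that] p[OF that] by simp
  qed
  have "2 * c * (c * (\<Sum>i\<in>I. (d i)\<^sup>2)) \<le> 2 * c * (\<Sum>i\<in>I. d i * mv_on I Q d i)"
    using co c unfolding coercive_on_def by (intro mult_left_mono) auto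
  also have "\<dots> = (\<Sum>i\<in>I. 2 * (c * d i) * mv_on I Q d i)" by (simp add: sum_distrib_left mult_ac)
  also have "\<dots> \<le> (\<Sum>i\<in>I. (c * d i)\<^sup>2 + (mv_on I Q d i)\<^sup>2)"
    by (intro sum_mono sum_squares_bound)
  also have "\<dots> = c * (c * (\<Sum>i\<in>I. (d i)\<^sup>2)) + (\<Sum>i\<in>I. (mv_on I Q d i)\<^sup>2)"
    by (simp add: sum.distrib sum_distrib_left power_mult_distrib power2_eq_square mult_ac)
  finally have "c\<^sup>2 * (\<Sum>i\<in>I. (d i)\<^sup>2) \<le> (\<Sum>i\<in>I. (mv_on I Q d i)\<^sup>2)"
    by (simp add: power2_eq_square mult_ac)
  also have "\<dots> \<le> (\<Sum>i\<in>I. 2 * (v' i - v i)\<^sup>2 + 2 * \<gamma>\<^sup>2)"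
  proof (rule sum_mono)
    fix i assume i: "i \<in> I"
    have "(h i)\<^sup>2 \<le> \<gamma>\<^sup>2" using diff[OF i] by (auto simp: h_def intro!: power2_le_iff_abs_le[THEN iffD2])
    moreover have "(v' i - v i - h i)\<^sup>2 \<le> 2 * (v' i - v i)\<^sup>2 + 2 * (h i)\<^sup>2"
      using zero_le_power2[of "v' i - v i + h i"] by (simp add: power2_sum power2_diff[of "v' i - v i"])
    ultimately show "(mv_on I Q d i)\<^sup>2 \<le> 2 * (v' i - v i)\<^sup>2 + 2 * \<gamma>\<^sup>2" by (simp add: Qd[OF i])
  qed
  finally show ?thesis by (simp add: d_def sum.distrib sum_distrib_left)
qed

section \<open>From errors of the thresholded matrix and the intercept to errors of the
  prices\<close>

context sampled_pricing
begin

lemma price_estimate_box: "0 \<le> price_estimate X pbar V v k \<and> price_estimate X pbar V v k \<le> pbar"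
  unfolding price_estimate_def using pbar by auto

text \<open>Twice the form of \<open>W\<close> gives \<open>2 * c\<close>, and an error whose row
  and column sums are at most \<open>c / 2\<close> takes away at most \<open>c\<close>, so the
  symmetrized estimate stays coercive with constant \<open>c\<close>. By the first-order condition
  \<open>pstar\<close> solves the same system with the true matrix and intercept.\<close>

lemma price_estimate_error:
  fixes \<mu> Wc
  defines "c \<equiv> \<zeta> / (4 * bbar)\<^sup>2"
  assumes X: "X \<noteq> {}" and t: "t \<in> {1..n}" and opt: "optimal_prices D pbar t pstar"
    and interior: "\<And>k. k \<in> X \<Longrightarrow> 0 < pstar k \<and> pstar k < pbar"
    and approx: "sparse_approximable_on X W s r"
    and err: "\<And>k j. k \<in> X \<Longrightarrow> j \<in> X \<Longrightarrow> 2 * \<bar>Wc k j - W k j\<bar> \<le> \<mu> k j \<and> \<mu> k j \<le> \<beta>"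
    and small: "3 / 2 * real s * \<beta> + r \<le> c / 2"
  shows "c\<^sup>2 * (\<Sum>k\<in>X. (price_estimate X pbar (threshold \<mu> Wc) vc k - pstar k)\<^sup>2) \<le>
    2 * (\<Sum>k\<in>X. (vc k - v_vec D pbar k)\<^sup>2) + 2 * real (card X) * (2 * (3 / 2 * real s * \<beta> + r) * pbar)\<^sup>2"
proof -
  define \<delta> where "\<delta> = 3 / 2 * real s * \<beta> + r"
  define V where "V = threshold \<mu> Wc"
  define Q where "Q = (\<lambda>k j. V k j + V j k)"
  have bb: "0 < bbar" using X bbar_pos by blast
  have c: "0 < c" using bb \<zeta> by (simp add: c_def)
  have row: "(\<Sum>j\<in>X. \<bar>V k j - W k j\<bar>) \<le> \<delta>" and col: "(\<Sum>j\<in>X. \<bar>V j k - W j k\<bar>) \<le> \<delta>" if "k \<in> X" for k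
    unfolding V_def \<delta>_def using threshold_sum_error[OF finX approx err that] by blast+
  have co: "coercive_on X c Q"
    unfolding coercive_on_def
  proof
    fix x :: "'v \<Rightarrow> real"
    have "(\<Sum>k\<in>X. x k * mv_on X Q x k) = (\<Sum>k\<in>X. x k * mv_on X V x k) + (\<Sum>k\<in>X. x k * mv_on X (\<lambda>k j. V j k) x k)"
      unfolding Q_def mv_on_def by (simp add: distrib_left distrib_right sum.distrib)
    also have "(\<Sum>k\<in>X. x k * mv_on X (\<lambda>k j. V j k) x k) = (\<Sum>k\<in>X. x k * mv_on X V x k)"
      unfolding mv_on_def sum_distrib_left by (subst sum.swap) (simp add: mult_ac)
    finally have Qx: "(\<Sum>k\<in>X. x k * mv_on X Q x k) = 2 * (\<Sum>k\<in>X. x k * mv_on X V x k)" by simp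
    have "(\<Sum>k\<in>X. x k * mv_on X V x k) = (\<Sum>k\<in>X. x k * mv_on X W x k) + (\<Sum>k\<in>X. x k * mv_on X (\<lambda>i j. V i j - W i j) x k)"
      unfolding mv_on_def by (simp add: left_diff_distrib right_diff_distrib sum_subtractf)
    moreover have "\<bar>\<Sum>k\<in>X. x k * mv_on X (\<lambda>i j. V i j - W i j) x k\<bar> \<le> \<delta> * (\<Sum>k\<in>X. (x k)\<^sup>2)"
      using row col by (intro bilinear_schur_bound finX) auto
    moreover have "\<delta> * (\<Sum>k\<in>X. (x k)\<^sup>2) \<le> c / 2 * (\<Sum>k\<in>X. (x k)\<^sup>2)"
      using small by (intro mult_right_mono sum_nonneg) (auto simp: \<delta>_def)
    moreover have "c * (\<Sum>k\<in>X. (x k)\<^sup>2) \<le> (\<Sum>k\<in>X. x k * mv_on X W x k)"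
      unfolding c_def by (rule W_form(1)[OF X])
    ultimately show "c * (\<Sum>k\<in>X. (x k)\<^sup>2) \<le> (\<Sum>k\<in>X. x k * mv_on X Q x k)"
      unfolding Qx by linarith
  qed
  have diff: "\<bar>mv_on X (\<lambda>i j. Q i j - (W i j + W j i)) pstar k\<bar> \<le> 2 * \<delta> * pbar" if k: "k \<in> X" for k
  proof -
    have "\<bar>mv_on X (\<lambda>i j. Q i j - (W i j + W j i)) pstar k\<bar> \<le> (\<Sum>j\<in>X. (\<bar>V k j - W k j\<bar> + \<bar>V j k - W j k\<bar>) * pbar)"
    proof -
      have "\<bar>pstar j\<bar> \<le> pbar" if "j \<in> X" for j using interior[OF that] by auto
      then show ?thesis
        unfolding mv_on_def Q_def
        by (intro sum_abs[THEN order_trans] sum_mono) (auto simp: abs_mult intro!: mult_mono)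
    qed
    also have "\<dots> = ((\<Sum>j\<in>X. \<bar>V k j - W k j\<bar>) + (\<Sum>j\<in>X. \<bar>V j k - W j k\<bar>)) * pbar"
      by (simp only: sum_distrib_right[symmetric] sum.distrib)
    also have "\<dots> \<le> 2 * \<delta> * pbar"
      using row[OF k] col[OF k] pbar by (intro mult_right_mono) auto
    finally show ?thesis .
  qed
  \<comment> \<open>Clipping is the projection onto a box that contains \<open>pstar\<close>, hence
    does not increase the distance in any coordinate.\<close>
  have "(price_estimate X pbar V vc k - pstar k)\<^sup>2 \<le> (mv_on X (inv_on X Q) vc k - pstar k)\<^sup>2" if "k \<in> X" for k
  proof -
    have "\<bar>price_estimate X pbar V vc k - pstar k\<bar> \<le> \<bar>mv_on X (inv_on X Q) vc k - pstar k\<bar>"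
      using interior[OF that] unfolding price_estimate_def Q_def by (auto simp: min_def max_def)
    then show ?thesis by (simp add: abs_le_square_iff)
  qed
  then have "c\<^sup>2 * (\<Sum>k\<in>X. (price_estimate X pbar V vc k - pstar k)\<^sup>2) \<le> c\<^sup>2 * (\<Sum>k\<in>X. (mv_on X (inv_on X Q) vc k - pstar k)\<^sup>2)"
    by (intro mult_left_mono sum_mono) auto
  also have "\<dots> \<le> 2 * (\<Sum>k\<in>X. (vc k - v_vec D pbar k)\<^sup>2) + 2 * real (card X) * (2 * \<delta> * pbar)\<^sup>2"
    by (rule coercive_perturbation_solution[OF finX c co first_order_condition[OF t opt interior] diff])
  finally show ?thesis by (simp add: V_def \<delta>_def)
qed

text \<open>For \<open>s = 0\<close> the approximant vanishes, so \<open>r\<close> is at least a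
  diagonal entry of \<open>W\<close>, which coercivity bounds away from zero. A small
  \<open>r\<close> therefore excludes \<open>s = 0\<close>, and the rate cannot drop below the error
  of the intercept.\<close>

lemma sparse_approximation_bounds:
  assumes X: "X \<noteq> {}" and approx: "sparse_approximable_on X W s r"
  shows "0 \<le> r" "s = 0 \<Longrightarrow> \<zeta> / (4 * bbar)\<^sup>2 \<le> r"
proof -
  obtain U where U: "sparse_on X s U"
      "max (norm_1_on X (\<lambda>i j. W i j - U i j)) (norm_inf_on X (\<lambda>i j. W i j - U i j)) \<le> r"
    using approx unfolding sparse_approximable_on_def by blast
  obtain k where k: "k \<in> X" using X by blast
  have le: "(\<Sum>j\<in>X. \<bar>W k j - U k j\<bar>) \<le> r"
    using sum_le_norm_inf_on[OF finX k, of "\<lambda>i j. W i j - U i j"] U(2) by simp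
  then show "0 \<le> r" by (rule order_trans[OF sum_nonneg, rotated]) simp
  assume "s = 0"
  then have "{j\<in>X. U k j \<noteq> 0} = {}" using U(1) k finX by (auto simp: sparse_on_def)
  then have "U k k = 0" using k by auto
  then have "W k k \<le> (\<Sum>j\<in>X. \<bar>W k j - U k j\<bar>)"
    using member_le_sum[OF k, of "\<lambda>j. \<bar>W k j - U k j\<bar>"] finX by simp
  moreover have "\<zeta> / (4 * bbar)\<^sup>2 \<le> W k k"
  proof -
    have *: "(\<Sum>i\<in>X. (if i = k then 1 else 0) * f i) = f k" for f :: "'v \<Rightarrow> real"
      using finX k by (simp add: if_distrib[of "\<lambda>c. c * _"] cong: if_cong)
    have "(\<Sum>i\<in>X. (if i = k then 1 else (0::real))\<^sup>2) = 1"
      using finX k by (simp add: if_distrib[of "\<lambda>c. c\<^sup>2"] cong: if_cong)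
    then show ?thesis
      using W_form(1)[OF X, of "\<lambda>i. if i = k then 1 else 0"] finX k
      by (simp add: * mv_on_unit)
  qed
  ultimately show "\<zeta> / (4 * bbar)\<^sup>2 \<le> r" using le by linarith
qed

end

section \<open>Tail bounds for truncated sums\<close>

text \<open>For negative \<open>x\<close> the claim reduces to (1 + x + x^2) (1 - x) = 1 - x^3 \<ge>
  1 together with 1 - x \<le> exp (- x).\<close>

lemma exp_le_quadratic:
  fixes x :: real
  assumes "x \<le> 1"
  shows "exp x \<le> 1 + x + x\<^sup>2"
proof (cases "0 \<le> x")
  case True
  then show ?thesis using assms by (intro exp_bound) auto
next
  case False
  then have "1 \<le> (1 + x + x\<^sup>2) * (1 - x)"
    using mult_nonpos_nonneg[of x "x * x"] by (simp add: algebra_simps power2_eq_square)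
  also have "\<dots> \<le> (1 + x + x\<^sup>2) * exp (- x)"
  proof (rule mult_left_mono)
    show "1 - x \<le> exp (- x)" using exp_ge_add_one_self[of "- x"] by simp
    have "1 + x + x\<^sup>2 = (x + 1/2)\<^sup>2 + 3/4" by (simp add: power2_eq_square algebra_simps)
    also have "\<dots> \<ge> 0" by simp
    finally show "0 \<le> 1 + x + x\<^sup>2" .
  qed
  finally have "1 \<le> (1 + x + x\<^sup>2) / exp x" by (simp add: exp_minus field_simps)
  then show ?thesis by (simp add: pos_le_divide_eq)
qed

text \<open>Chernoff's method with an upper bound on the variables only. The means are merely
  bounded above by \<open>m\<close>, because truncation destroys exact centring.\<close>

lemma (in prob_space) exponential_tail_bound:
  fixes Y :: "'i \<Rightarrow> 'a \<Rightarrow> real"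
  assumes I: "finite I" and indep: "indep_vars (\<lambda>_. borel) Y I" and \<theta>: "0 < \<theta>"
    and le1: "\<And>t \<omega>. t \<in> I \<Longrightarrow> \<theta> * Y t \<omega> \<le> 1"
    and int: "\<And>t. t \<in> I \<Longrightarrow> integrable M (Y t)" "\<And>t. t \<in> I \<Longrightarrow> integrable M (\<lambda>\<omega>. (Y t \<omega>)\<^sup>2)"
    and m: "\<And>t. t \<in> I \<Longrightarrow> expectation (Y t) \<le> m"
    and q: "\<And>t. t \<in> I \<Longrightarrow> expectation (\<lambda>\<omega>. (Y t \<omega>)\<^sup>2) \<le> q"
  shows "prob {\<omega>\<in>space M. x \<le> (\<Sum>t\<in>I. Y t \<omega>)} \<le> exp (- \<theta> * x + real (card I) * (\<theta> * m + \<theta>\<^sup>2 * q))"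
proof -
  have meas: "Y t \<in> borel_measurable M" if "t \<in> I" for t using int(1)[OF that] by simp
  have indep': "indep_vars (\<lambda>_. borel) (\<lambda>t \<omega>. exp (\<theta> * Y t \<omega>)) I"
    by (rule indep_vars_compose2[OF indep, of "\<lambda>_ y. exp (\<theta> * y)"]) simp
  have int_exp: "integrable M (\<lambda>\<omega>. exp (\<theta> * Y t \<omega>))" if "t \<in> I" for t
    using meas[OF that] le1[OF that] by (intro integrable_const_bound[of _ "exp 1"]) auto
  have each: "expectation (\<lambda>\<omega>. exp (\<theta> * Y t \<omega>)) \<le> exp (\<theta> * m + \<theta>\<^sup>2 * q)" if t: "t \<in> I" for t
  proof -
    have "expectation (\<lambda>\<omega>. exp (\<theta> * Y t \<omega>)) \<le> expectation (\<lambda>\<omega>. 1 + \<theta> * Y t \<omega> + \<theta>\<^sup>2 * (Y t \<omega>)\<^sup>2)"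
      using int_exp[OF t] int[OF t] le1[OF t]
      using exp_le_quadratic[OF le1[OF t]] by (intro integral_mono) (auto simp: power_mult_distrib)
    also have "\<dots> = 1 + (\<theta> * expectation (Y t) + \<theta>\<^sup>2 * expectation (\<lambda>\<omega>. (Y t \<omega>)\<^sup>2))"
      using int[OF t] by (simp add: prob_space)
    also have "\<dots> \<le> 1 + (\<theta> * m + \<theta>\<^sup>2 * q)"
      using m[OF t] q[OF t] \<theta> by (intro add_left_mono add_mono mult_left_mono) auto
    also have "\<dots> \<le> exp (\<theta> * m + \<theta>\<^sup>2 * q)" by (rule exp_ge_add_one_self)
    finally show ?thesis .
  qed
  have int_prod: "integrable M (\<lambda>\<omega>. \<Prod>t\<in>I. exp (\<theta> * Y t \<omega>))"
    by (rule indep_vars_integrable[OF I indep' int_exp])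
  have "prob {\<omega>\<in>space M. x \<le> (\<Sum>t\<in>I. Y t \<omega>)} \<le> prob {\<omega>\<in>space M. exp (\<theta> * x) \<le> (\<Prod>t\<in>I. exp (\<theta> * Y t \<omega>))}"
    using meas \<theta> I by (intro finite_measure_mono) (auto simp: exp_sum[symmetric] sum_distrib_left[symmetric])
  also have "\<dots> \<le> expectation (\<lambda>\<omega>. \<Prod>t\<in>I. exp (\<theta> * Y t \<omega>)) / exp (\<theta> * x)"
    by (rule integral_Markov_inequality_measure[OF int_prod, of "{}", simplified]) (auto intro!: prod_nonneg)
  also have "expectation (\<lambda>\<omega>. \<Prod>t\<in>I. exp (\<theta> * Y t \<omega>)) = (\<Prod>t\<in>I. expectation (\<lambda>\<omega>. exp (\<theta> * Y t \<omega>)))"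
    by (rule indep_vars_lebesgue_integral[OF I indep' int_exp])
  also have "\<dots> \<le> (\<Prod>t\<in>I. exp (\<theta> * m + \<theta>\<^sup>2 * q))"
    using each by (intro prod_mono) auto
  also have "\<dots> / exp (\<theta> * x) = exp (- \<theta> * x + real (card I) * (\<theta> * m + \<theta>\<^sup>2 * q))"
  proof -
    have "exp c ^ card I / exp (\<theta> * x) = exp (- \<theta> * x + real (card I) * c)" for c
      by (simp add: exp_diff exp_of_nat_mult)
    then show ?thesis by simp
  qed
  finally show ?thesis by (simp add: divide_right_mono)
qed

text \<open>Large values are replaced by zero. On the event that all values stay below
  \<open>L\<close> the truncation is the identity, so bounds for truncated sums carry over to the
  sums themselves.\<close>

definition trunc :: "real \<Rightarrow> real \<Rightarrow> real" where
  "trunc L z = (if \<bar>z\<bar> \<le> L then z else 0)"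

lemma trunc_measurable[measurable]: "trunc L \<in> borel_measurable borel"
  unfolding trunc_def by measurable

lemma abs_trunc: "0 \<le> L \<Longrightarrow> \<bar>trunc L z\<bar> \<le> L" "\<bar>trunc L z\<bar> \<le> \<bar>z\<bar>"
  by (auto simp: trunc_def)

lemma trunc_minus: "trunc L (- z) = - trunc L z"
  by (simp add: trunc_def)

lemma trunc_remainder:
  assumes "0 < L" shows "\<bar>z - trunc L z\<bar> \<le> z ^ 4 / L ^ 3"
proof (cases "\<bar>z\<bar> \<le> L")
  case False
  then have "L ^ 3 * \<bar>z\<bar> \<le> \<bar>z\<bar> ^ 3 * \<bar>z\<bar>" using assms by (intro mult_right_mono power_mono) auto
  also have "\<dots> = z ^ 4" by (simp add: power_abs[symmetric] numeral_eq_Suc power_even_abs)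
  finally show ?thesis using False assms by (simp add: trunc_def field_simps)
qed (use assms in \<open>auto simp: trunc_def\<close>)

lemma square_le_fourth: "(z::real)\<^sup>2 \<le> 1 + z ^ 4"
proof -
  have "2 * z\<^sup>2 \<le> (z\<^sup>2)\<^sup>2 + 1" using sum_squares_bound[of "z\<^sup>2" 1] by simp
  then have "2 * z\<^sup>2 \<le> z ^ 4 + 1" by simp
  then show ?thesis using zero_le_power2[of z] by linarith
qed

section \<open>Truncated moments and a maximal inequality under fourth moments\<close>

context prob_space
begin

lemma fourth_moment_integrable:
  assumes "Z \<in> borel_measurable M" "integrable M (\<lambda>\<omega>. Z \<omega> ^ 4)"
  shows "integrable M (\<lambda>\<omega>. (Z \<omega>)\<^sup>2)" "integrable M (Z :: 'a \<Rightarrow> real)"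
proof -
  have i: "integrable M (\<lambda>\<omega>. 1 + Z \<omega> ^ 4)" using assms by auto
  show "integrable M (\<lambda>\<omega>. (Z \<omega>)\<^sup>2)"
    using assms(1) square_le_fourth by (intro Bochner_Integration.integrable_bound[OF i]) (auto intro!: AE_I2)
  then have j: "integrable M (\<lambda>\<omega>. 1 + (Z \<omega>)\<^sup>2)" by auto
  have "\<bar>z\<bar> \<le> 1 + z\<^sup>2" for z :: real
    using sum_squares_bound[of "\<bar>z\<bar>" 1] by simp
  then show "integrable M Z"
    using assms(1) by (intro Bochner_Integration.integrable_bound[OF j]) (auto intro!: AE_I2)
qed

lemma trunc_moments:
  assumes Z: "Z \<in> borel_measurable M" "integrable M (\<lambda>\<omega>. Z \<omega> ^ 4)" "expectation (\<lambda>\<omega>. Z \<omega> ^ 4) \<le> C"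
    and mean: "expectation Z = 0" and L: "0 < L"
  shows "expectation (\<lambda>\<omega>. trunc L (Z \<omega>)) \<le> C / L ^ 3"
    and "expectation (\<lambda>\<omega>. (trunc L (Z \<omega>))\<^sup>2) \<le> 1 + C"
    and "expectation (\<lambda>\<omega>. ((trunc L (Z \<omega>))\<^sup>2)\<^sup>2) \<le> C"
    and "integrable M (\<lambda>\<omega>. trunc L (Z \<omega>))" "integrable M (\<lambda>\<omega>. (trunc L (Z \<omega>))\<^sup>2)"
      "integrable M (\<lambda>\<omega>. ((trunc L (Z \<omega>))\<^sup>2)\<^sup>2)"
proof -
  have tm: "(\<lambda>\<omega>. trunc L (Z \<omega>)) \<in> borel_measurable M" using Z(1) by measurable
  have pw: "\<bar>trunc L z\<bar> ^ k \<le> L ^ k" "\<bar>trunc L z\<bar> ^ k \<le> \<bar>z\<bar> ^ k" for z k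
    using abs_trunc[of L z] L by (auto intro!: power_mono)
  show i1: "integrable M (\<lambda>\<omega>. trunc L (Z \<omega>))"
    using tm abs_trunc(1)[of L] L by (intro integrable_const_bound[of _ L]) auto
  show i2: "integrable M (\<lambda>\<omega>. (trunc L (Z \<omega>))\<^sup>2)"
    using tm pw(1)[of _ 2] by (intro integrable_const_bound[of _ "L ^ 2"]) auto
  have sq: "(z\<^sup>2)\<^sup>2 = \<bar>z\<bar> ^ 4" for z :: real by auto
  show i4: "integrable M (\<lambda>\<omega>. ((trunc L (Z \<omega>))\<^sup>2)\<^sup>2)"
    unfolding sq using tm pw(1)[of _ 4] by (intro integrable_const_bound[of _ "L ^ 4"]) auto
  note Z1 = fourth_moment_integrable(2)[OF Z(1,2)]
  have "expectation (\<lambda>\<omega>. trunc L (Z \<omega>)) = expectation (\<lambda>\<omega>. trunc L (Z \<omega>) - Z \<omega>)"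
    using i1 Z1 mean by simp
  also have "\<dots> \<le> expectation (\<lambda>\<omega>. Z \<omega> ^ 4 / L ^ 3)"
  proof (rule integral_mono)
    fix \<omega> show "trunc L (Z \<omega>) - Z \<omega> \<le> Z \<omega> ^ 4 / L ^ 3" using trunc_remainder[OF L, of "Z \<omega>"] by linarith
  qed (use i1 Z1 Z(2) in auto)
  also have "\<dots> \<le> C / L ^ 3" using Z(3) L by (simp add: divide_right_mono)
  finally show "expectation (\<lambda>\<omega>. trunc L (Z \<omega>)) \<le> C / L ^ 3" .
  have "expectation (\<lambda>\<omega>. (trunc L (Z \<omega>))\<^sup>2) \<le> expectation (\<lambda>\<omega>. 1 + Z \<omega> ^ 4)"
  proof (rule integral_mono)
    fix \<omega> show "(trunc L (Z \<omega>))\<^sup>2 \<le> 1 + Z \<omega> ^ 4" using pw(2)[of "Z \<omega>" 2] square_le_fourth[of "Z \<omega>"] by simp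
  qed (use i2 Z(2) in auto)
  also have "\<dots> \<le> 1 + C" using Z by (simp add: prob_space)
  finally show "expectation (\<lambda>\<omega>. (trunc L (Z \<omega>))\<^sup>2) \<le> 1 + C" .
  have "expectation (\<lambda>\<omega>. ((trunc L (Z \<omega>))\<^sup>2)\<^sup>2) \<le> expectation (\<lambda>\<omega>. Z \<omega> ^ 4)"
  proof (rule integral_mono)
    fix \<omega> show "((trunc L (Z \<omega>))\<^sup>2)\<^sup>2 \<le> Z \<omega> ^ 4" unfolding sq using pw(2)[of "Z \<omega>" 4] by simp
  qed (use i4 Z(2) in auto)
  then show "expectation (\<lambda>\<omega>. ((trunc L (Z \<omega>))\<^sup>2)\<^sup>2) \<le> C" using Z(3) by linarith
qed

text \<open>The exponential parameter is 1 / L for the sum and 1 / L^2 for the sum of squares. With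
  L^2 = n / l the terms from mean and variance add up to at most (2 C + 1) l, and
  \<open>2 * C + 5\<close> leaves a surplus of 4 l. For l = ln|V_O| the failure probability is |V_O|
  to the power -4, enough for a union over pairs of indices.\<close>

lemma truncated_mean_tail:
  fixes Z :: "nat \<Rightarrow> 'a \<Rightarrow> real" and l C :: real
  assumes n: "1 \<le> n" and l: "0 < l" "l \<le> real n" and C: "0 \<le> C"
    and indep: "indep_vars (\<lambda>_. borel) Z {1..n}"
    and fourth: "\<And>t. t \<in> {1..n} \<Longrightarrow> integrable M (\<lambda>\<omega>. Z t \<omega> ^ 4)"
      "\<And>t. t \<in> {1..n} \<Longrightarrow> expectation (\<lambda>\<omega>. Z t \<omega> ^ 4) \<le> C"
    and mean: "\<And>t. t \<in> {1..n} \<Longrightarrow> expectation (Z t) = 0"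
  defines "L \<equiv> sqrt (real n / l)"
  shows "prob {\<omega>\<in>space M. (2 * C + 5) * sqrt (real n * l) \<le> (\<Sum>t=1..n. trunc L (Z t \<omega>))} \<le> exp (- 4 * l)"
    and "prob {\<omega>\<in>space M. (2 * C + 5) * real n \<le> (\<Sum>t=1..n. (trunc L (Z t \<omega>))\<^sup>2)} \<le> exp (- 4 * l)"
proof -
  have L: "0 < L" using n l by (simp add: L_def)
  have L2: "L\<^sup>2 = real n / l" using n l by (simp add: L_def)
  have nl: "real n * l / real n = l" using n by simp
  have meas: "Z t \<in> borel_measurable M" if "t \<in> {1..n}" for t
    using indep that by (auto simp: indep_vars_def2)
  note tm = trunc_moments[OF meas fourth mean L]
  have CL: "C * l\<^sup>2 / real n \<le> C * l"
    using l n C by (simp add: power2_eq_square field_simps mult_left_mono)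
  have "prob {\<omega>\<in>space M. (2 * C + 5) * sqrt (real n * l) \<le> (\<Sum>t=1..n. trunc L (Z t \<omega>))}
      \<le> exp (- (1 / L) * ((2 * C + 5) * sqrt (real n * l)) + real (card {1..n}) * ((1 / L) * (C / L ^ 3) + (1 / L)\<^sup>2 * (1 + C)))"
  proof (rule exponential_tail_bound)
    show "indep_vars (\<lambda>_. borel) (\<lambda>t \<omega>. trunc L (Z t \<omega>)) {1..n}"
      by (rule indep_vars_compose2[OF indep]) simp
    show "1 / L * trunc L (Z t \<omega>) \<le> 1" for t \<omega>
      using abs_trunc(1)[of L "Z t \<omega>"] L by (simp add: divide_le_eq)
  qed (use tm L in auto)
  also have "\<dots> \<le> exp (- 4 * l)"
  proof -
    have "1 / L * sqrt (real n * l) = l"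
      using n l by (simp add: L_def real_sqrt_mult real_sqrt_divide field_simps)
    then have a: "1 / L * ((2 * C + 5) * sqrt (real n * l)) = (2 * C + 5) * l" by (metis mult.left_commute)
    have "1 / L * (C / L ^ 3) = C / (L\<^sup>2)\<^sup>2" by (simp add: numeral_eq_Suc)
    then have "real n * (1 / L * (C / L ^ 3)) = real n * (C / (real n / l)\<^sup>2)" unfolding L2 by (rule arg_cong)
    also have "\<dots> = C * l\<^sup>2 / real n"
      using n l by (simp add: power2_eq_square)
    finally have b: "real n * (1 / L * (C / L ^ 3)) = C * l\<^sup>2 / real n" .
    have c: "real n * ((1 / L)\<^sup>2 * (1 + C)) = (1 + C) * l"
      using n l by (simp add: power_divide L2 field_simps)
    have "- (1 / L) * ((2 * C + 5) * sqrt (real n * l)) + real (card {1..n}) * (1 / L * (C / L ^ 3) + (1 / L)\<^sup>2 * (1 + C))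
       = - ((2 * C + 5) * l) + (C * l\<^sup>2 / real n + (1 + C) * l)"
    proof -
      have "- (1 / L) * ((2 * C + 5) * sqrt (real n * l)) + real (card {1..n}) * (1 / L * (C / L ^ 3) + (1 / L)\<^sup>2 * (1 + C))
         = - (1 / L * ((2 * C + 5) * sqrt (real n * l))) + (real n * (1 / L * (C / L ^ 3)) + real n * ((1 / L)\<^sup>2 * (1 + C)))"
        by (simp add: algebra_simps)
      then show ?thesis unfolding a b c .
    qed
    also have "\<dots> \<le> - 4 * l" using CL by (simp add: algebra_simps)
    finally show ?thesis by simp
  qed
  finally show "prob {\<omega>\<in>space M. (2 * C + 5) * sqrt (real n * l) \<le> (\<Sum>t=1..n. trunc L (Z t \<omega>))} \<le> exp (- 4 * l)" .
  have "prob {\<omega>\<in>space M. (2 * C + 5) * real n \<le> (\<Sum>t=1..n. (trunc L (Z t \<omega>))\<^sup>2)}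
      \<le> exp (- (1 / L\<^sup>2) * ((2 * C + 5) * real n) + real (card {1..n}) * ((1 / L\<^sup>2) * (1 + C) + (1 / L\<^sup>2)\<^sup>2 * C))"
  proof (rule exponential_tail_bound)
    show "indep_vars (\<lambda>_. borel) (\<lambda>t \<omega>. (trunc L (Z t \<omega>))\<^sup>2) {1..n}"
      by (rule indep_vars_compose2[OF indep, of "\<lambda>_ z. (trunc L z)\<^sup>2"]) simp
    show "1 / L\<^sup>2 * (trunc L (Z t \<omega>))\<^sup>2 \<le> 1" for t \<omega>
      using power_mono[OF abs_trunc(1)[of L "Z t \<omega>"], of 2] L by (simp add: divide_le_eq)
  qed (use tm L in auto)
  also have "\<dots> \<le> exp (- 4 * l)"
  proof -
    have "- (1 / L\<^sup>2) * ((2 * C + 5) * real n) + real (card {1..n}) * (1 / L\<^sup>2 * (1 + C) + (1 / L\<^sup>2)\<^sup>2 * C)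
       = - ((2 * C + 5) * l) + ((1 + C) * l + C * l\<^sup>2 / real n)"
    proof -
      have il: "1 / L\<^sup>2 = l / real n" by (simp add: L2)
      show ?thesis unfolding il using n l by (simp add: field_simps power2_eq_square)
    qed
    also have "\<dots> \<le> - 4 * l" using CL by (simp add: algebra_simps)
    finally show ?thesis by simp
  qed
  finally show "prob {\<omega>\<in>space M. (2 * C + 5) * real n \<le> (\<Sum>t=1..n. (trunc L (Z t \<omega>))\<^sup>2)} \<le> exp (- 4 * l)" .
qed

text \<open>For nonnegative variables the square of the truncation is at most \<open>B * Y\<close>,
  so the mean also controls the second moment. This serves fourth powers of the scores, for which no
  higher moment is at hand.\<close>

lemma nonneg_mean_tail:
  fixes Y :: "nat \<Rightarrow> 'a \<Rightarrow> real"
  assumes B: "0 < B" and C: "0 \<le> C"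
    and indep: "indep_vars (\<lambda>_. borel) Y {1..n}"
    and nonneg: "\<And>t \<omega>. t \<in> {1..n} \<Longrightarrow> 0 \<le> Y t \<omega>"
    and int: "\<And>t. t \<in> {1..n} \<Longrightarrow> integrable M (Y t)"
    and mean: "\<And>t. t \<in> {1..n} \<Longrightarrow> expectation (Y t) \<le> C"
  shows "prob {\<omega>\<in>space M. (2 * C + 1) * real n \<le> (\<Sum>t=1..n. trunc B (Y t \<omega>))} \<le> exp (- real n / B)"
proof -
  have meas: "Y t \<in> borel_measurable M" if "t \<in> {1..n}" for t
    using indep that by (auto simp: indep_vars_def2)
  have tr: "0 \<le> trunc B (Y t \<omega>)" "trunc B (Y t \<omega>) \<le> Y t \<omega>" "(trunc B (Y t \<omega>))\<^sup>2 \<le> B * Y t \<omega>"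
    "(trunc B (Y t \<omega>))\<^sup>2 \<le> B\<^sup>2" if "t \<in> {1..n}" for t \<omega>
    using nonneg[OF that, of \<omega>] B by (auto simp: trunc_def power2_eq_square intro!: mult_mono)
  have i1: "integrable M (\<lambda>\<omega>. trunc B (Y t \<omega>))" if "t \<in> {1..n}" for t
    using meas[OF that] abs_trunc(1)[of B] B by (intro integrable_const_bound[of _ B]) auto
  have i2: "integrable M (\<lambda>\<omega>. (trunc B (Y t \<omega>))\<^sup>2)" if "t \<in> {1..n}" for t
    using meas[OF that] tr(4)[OF that] by (intro integrable_const_bound[of _ "B\<^sup>2"]) auto
  have "prob {\<omega>\<in>space M. (2 * C + 1) * real n \<le> (\<Sum>t=1..n. trunc B (Y t \<omega>))}
     \<le> exp (- (1 / B) * ((2 * C + 1) * real n) + real (card {1..n}) * ((1 / B) * C + (1 / B)\<^sup>2 * (B * C)))"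
  proof (rule exponential_tail_bound)
    show "indep_vars (\<lambda>_. borel) (\<lambda>t \<omega>. trunc B (Y t \<omega>)) {1..n}"
      by (rule indep_vars_compose2[OF indep]) simp
    show "1 / B * trunc B (Y t \<omega>) \<le> 1" for t \<omega>
      using abs_trunc(1)[of B "Y t \<omega>"] B by (simp add: divide_le_eq)
    fix t assume t: "t \<in> {1..n}"
    have "expectation (\<lambda>\<omega>. trunc B (Y t \<omega>)) \<le> expectation (Y t)"
      using i1[OF t] int[OF t] tr[OF t] by (intro integral_mono) auto
    then show "expectation (\<lambda>\<omega>. trunc B (Y t \<omega>)) \<le> C" using mean[OF t] by simp
    have "expectation (\<lambda>\<omega>. (trunc B (Y t \<omega>))\<^sup>2) \<le> expectation (\<lambda>\<omega>. B * Y t \<omega>)"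
      using i2[OF t] int[OF t] tr[OF t] by (intro integral_mono) auto
    also have "\<dots> \<le> B * C" using mean[OF t] B by simp
    finally show "expectation (\<lambda>\<omega>. (trunc B (Y t \<omega>))\<^sup>2) \<le> B * C" .
  qed (use i1 i2 B in auto)
  also have "- (1 / B) * ((2 * C + 1) * real n) + real (card {1..n}) * ((1 / B) * C + (1 / B)\<^sup>2 * (B * C)) = - real n / B"
    using B by (simp add: field_simps power2_eq_square)
  finally show ?thesis .
qed

text \<open>Boundedness by the truncation level stands inside the implication, since it holds on an
  event that is controlled separately through the moments of maxima. The factor 3 counts the bad
  events per index: the two tails of the sum and the upper tail of the sum of squares.\<close>

lemma maximal_inequality:
  fixes Z :: "'j \<Rightarrow> nat \<Rightarrow> 'a \<Rightarrow> real" and l C :: real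
  assumes J: "finite J" and n: "1 \<le> n" and l: "0 < l" "l \<le> real n" and C: "0 \<le> C"
    and indep: "\<And>j. j \<in> J \<Longrightarrow> indep_vars (\<lambda>_. borel) (Z j) {1..n}"
    and fourth: "\<And>j t. j \<in> J \<Longrightarrow> t \<in> {1..n} \<Longrightarrow> integrable M (\<lambda>\<omega>. Z j t \<omega> ^ 4)"
      "\<And>j t. j \<in> J \<Longrightarrow> t \<in> {1..n} \<Longrightarrow> expectation (\<lambda>\<omega>. Z j t \<omega> ^ 4) \<le> C"
    and mean: "\<And>j t. j \<in> J \<Longrightarrow> t \<in> {1..n} \<Longrightarrow> expectation (Z j t) = 0"
  shows "\<exists>E\<in>events. 1 - 3 * real (card J) * exp (- 4 * l) \<le> prob E \<and>
    (\<forall>\<omega>\<in>E. (\<forall>j\<in>J. \<forall>t\<in>{1..n}. \<bar>Z j t \<omega>\<bar> \<le> sqrt (real n / l)) \<longrightarrow>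
      (\<forall>j\<in>J. \<bar>avg n (\<lambda>t. Z j t \<omega>)\<bar> \<le> (2 * C + 5) * sqrt (l / real n) \<and>
             avg n (\<lambda>t. (Z j t \<omega>)\<^sup>2) \<le> 2 * C + 5))"
proof -
  define L where "L = sqrt (real n / l)"
  define K where "K = 2 * C + 5"
  define B1 where "B1 = (\<lambda>j. {\<omega>\<in>space M. K * sqrt (real n * l) \<le> (\<Sum>t=1..n. trunc L (Z j t \<omega>))})"
  define B2 where "B2 = (\<lambda>j. {\<omega>\<in>space M. K * sqrt (real n * l) \<le> (\<Sum>t=1..n. trunc L (- Z j t \<omega>))})"
  define B3 where "B3 = (\<lambda>j. {\<omega>\<in>space M. K * real n \<le> (\<Sum>t=1..n. (trunc L (Z j t \<omega>))\<^sup>2)})"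
  define bad where "bad = (\<Union>j\<in>J. B1 j \<union> B2 j \<union> B3 j)"
  have meas: "Z j t \<in> borel_measurable M" if "j \<in> J" "t \<in> {1..n}" for j t
    using indep that by (auto simp: indep_vars_def2)
  have ev: "B1 j \<in> events" "B2 j \<in> events" "B3 j \<in> events" if "j \<in> J" for j
  proof -
    note m = meas[OF that]
    have "(\<lambda>\<omega>. \<Sum>t=1..n. trunc L (Z j t \<omega>)) \<in> borel_measurable M"
      "(\<lambda>\<omega>. \<Sum>t=1..n. trunc L (- Z j t \<omega>)) \<in> borel_measurable M"
      "(\<lambda>\<omega>. \<Sum>t=1..n. (trunc L (Z j t \<omega>))\<^sup>2) \<in> borel_measurable M"
      using m by (auto intro!: borel_measurable_sum borel_measurable_power measurable_compose[OF _ trunc_measurable])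
    then show "B1 j \<in> events" "B2 j \<in> events" "B3 j \<in> events"
      unfolding B1_def B2_def B3_def by measurable
  qed
  then have bad: "bad \<in> events" unfolding bad_def using J by (intro sets.finite_UN) auto
  have pr: "prob (B1 j) \<le> exp (- 4 * l)" "prob (B2 j) \<le> exp (- 4 * l)" "prob (B3 j) \<le> exp (- 4 * l)" if j: "j \<in> J" for j
  proof -
    note tails = truncated_mean_tail[OF n l C, folded L_def, folded K_def]
    show "prob (B1 j) \<le> exp (- 4 * l)" "prob (B3 j) \<le> exp (- 4 * l)"
      unfolding B1_def B3_def using j by (intro tails indep fourth mean; simp)+
    have "indep_vars (\<lambda>_. borel) (\<lambda>t \<omega>. - Z j t \<omega>) {1..n}"
      by (rule indep_vars_compose2[OF indep[OF j], of "\<lambda>_ z. - z"]) simp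
    then show "prob (B2 j) \<le> exp (- 4 * l)"
      unfolding B2_def using j fourth mean by (intro tails(1)) auto
  qed
  have "prob bad \<le> (\<Sum>j\<in>J. prob (B1 j \<union> B2 j \<union> B3 j))"
    unfolding bad_def using ev J by (intro finite_measure_subadditive_finite) auto
  also have "\<dots> \<le> (\<Sum>j\<in>J. 3 * exp (- 4 * l))"
  proof (rule sum_mono)
    fix j assume j: "j \<in> J"
    have "prob (B1 j \<union> B2 j \<union> B3 j) \<le> prob (B1 j) + prob (B2 j) + prob (B3 j)"
      using measure_Un_le[OF ev(1,2)[OF j]] measure_Un_le[OF sets.Un[OF ev(1,2)[OF j]] ev(3)[OF j]] by auto
    then show "prob (B1 j \<union> B2 j \<union> B3 j) \<le> 3 * exp (- 4 * l)" using pr[OF j] by linarith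
  qed
  finally have pbad: "prob bad \<le> 3 * real (card J) * exp (- 4 * l)" by simp
  show ?thesis
  proof (intro bexI conjI ballI impI)
    show "space M - bad \<in> events" using bad by auto
    show "1 - 3 * real (card J) * exp (- 4 * l) \<le> prob (space M - bad)"
      using pbad by (simp add: prob_compl[OF bad])
    fix \<omega> j
    assume \<omega>: "\<omega> \<in> space M - bad" and le: "\<forall>j\<in>J. \<forall>t\<in>{1..n}. \<bar>Z j t \<omega>\<bar> \<le> sqrt (real n / l)" and j: "j \<in> J"
    have tr: "trunc L (Z j t \<omega>) = Z j t \<omega>" if "t \<in> {1..n}" for t
      using le j that by (auto simp: trunc_def L_def)
    have "\<not> K * sqrt (real n * l) \<le> (\<Sum>t=1..n. trunc L (Z j t \<omega>))"
      "\<not> K * sqrt (real n * l) \<le> (\<Sum>t=1..n. trunc L (- Z j t \<omega>))"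
      "\<not> K * real n \<le> (\<Sum>t=1..n. (trunc L (Z j t \<omega>))\<^sup>2)"
      using \<omega> j by (auto simp: bad_def B1_def B2_def B3_def)
    then have s: "\<bar>\<Sum>t=1..n. Z j t \<omega>\<bar> \<le> K * sqrt (real n * l)" "(\<Sum>t=1..n. (Z j t \<omega>)\<^sup>2) \<le> K * real n"
      using tr by (auto simp: trunc_minus sum_negf)
    have "sqrt (real n * l) / real n = sqrt (l / real n)"
      using n l by (simp add: real_sqrt_mult real_sqrt_divide real_div_sqrt field_simps)
    then have "K * sqrt (real n * l) / real n = (2 * C + 5) * sqrt (l / real n)"
      unfolding K_def by (metis times_divide_eq_right)
    then show "\<bar>avg n (\<lambda>t. Z j t \<omega>)\<bar> \<le> (2 * C + 5) * sqrt (l / real n)"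
      using divide_right_mono[OF s(1), of "real n"] n by (simp add: avg_def)
    show "avg n (\<lambda>t. (Z j t \<omega>)\<^sup>2) \<le> 2 * C + 5"
      using s(2) n by (simp add: avg_def K_def divide_le_eq)
  qed
qed

end

section \<open>The normal quantile\<close>

abbreviation "\<Phi> \<equiv> cdf std_normal_distribution"

interpretation std_normal: real_distribution std_normal_distribution
  by (rule real_dist_normal_dist)

text \<open>\<open>inv\<close> selects some preimage, so only its existence matters: the normal law
  has no atoms, and the intermediate value theorem applies between the limits 0 and 1.\<close>

lemma std_normal_quantile:
  assumes "0 < y" "y < 1"
  shows "\<Phi> (inv \<Phi> y) = y"
proof -
  have cont: "isCont \<Phi> x" for x
  proof -
    have "emeasure std_normal_distribution {x} = 0"
      by (subst emeasure_density) (auto simp: nn_integral_indicator_singleton')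
    then show ?thesis by (simp add: std_normal.isCont_cdf measure_def)
  qed
  have "\<forall>\<^sub>F x in at_top. y < \<Phi> x"
    by (rule order_tendstoD(1)[OF std_normal.cdf_lim_at_top_prob assms(2)])
  then obtain b where b: "\<And>x. b \<le> x \<Longrightarrow> y < \<Phi> x" by (auto simp: eventually_at_top_linorder)
  have "\<forall>\<^sub>F x in at_bot. \<Phi> x < y"
    by (rule order_tendstoD(2)[OF std_normal.cdf_lim_at_bot assms(1)])
  then obtain a where a: "\<And>x. x \<le> a \<Longrightarrow> \<Phi> x < y" by (auto simp: eventually_at_bot_linorder)
  have "\<exists>x. min a b \<le> x \<and> x \<le> max a b \<and> \<Phi> x = y"
    using a[of "min a b"] b[of "max a b"] cont by (intro IVT) (auto intro: less_imp_le)
  then have "y \<in> range \<Phi>" by auto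
  then show ?thesis by (rule f_inv_into_f)
qed

text \<open>Markov's inequality for exp (z^2 / 4). Times the density this is sqrt 2 times the normal
  density of variance 2, so its mean is sqrt 2.\<close>

lemma std_normal_tail_upper:
  assumes "0 \<le> x"
  shows "1 - \<Phi> x \<le> sqrt 2 * exp (- x\<^sup>2 / 4)"
proof -
  have dens: "std_normal_density z * exp (z\<^sup>2 / 4) = sqrt 2 * normal_density 0 (sqrt 2) z" for z
  proof -
    have "- z\<^sup>2 / 2 + z\<^sup>2 / 4 = - z\<^sup>2 / 4" by simp
    then have "exp (- z\<^sup>2 / 2) * exp (z\<^sup>2 / 4) = exp (- z\<^sup>2 / 4)" by (simp add: exp_add[symmetric])
    moreover have "sqrt 2 / sqrt (4 * pi) = 1 / sqrt (2 * pi)"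
    proof -
      have "sqrt (4 * pi) = sqrt 2 * sqrt (2 * pi)" by (simp add: real_sqrt_mult[symmetric])
      then show ?thesis by simp
    qed
    ultimately show ?thesis unfolding std_normal_density_def normal_density_def
      by (simp add: field_simps)
  qed
  have int: "integrable std_normal_distribution (\<lambda>z. exp (z\<^sup>2 / 4))"
    and val: "(\<integral>z. exp (z\<^sup>2 / 4) \<partial>std_normal_distribution) = sqrt 2"
  proof -
    have "integrable lborel (\<lambda>z. std_normal_density z * exp (z\<^sup>2 / 4))"
      unfolding dens by simp
    then show "integrable std_normal_distribution (\<lambda>z. exp (z\<^sup>2 / 4))"
      by (subst integrable_density) auto
    have "(\<integral>z. exp (z\<^sup>2 / 4) \<partial>std_normal_distribution) = (\<integral>z. std_normal_density z * exp (z\<^sup>2 / 4) \<partial>lborel)"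
      by (subst integral_density) auto
    also have "\<dots> = sqrt 2" unfolding dens by simp
    finally show "(\<integral>z. exp (z\<^sup>2 / 4) \<partial>std_normal_distribution) = sqrt 2" .
  qed
  have "1 - \<Phi> x = std_normal.prob (space std_normal_distribution - {..x})"
    by (subst std_normal.prob_compl) (auto simp: cdf_def)
  also have "\<dots> \<le> std_normal.prob {z \<in> space std_normal_distribution. exp (x\<^sup>2 / 4) \<le> exp (z\<^sup>2 / 4)}"
    using assms by (intro std_normal.finite_measure_mono) (auto intro!: power_mono)
  also have "\<dots> \<le> (\<integral>z. exp (z\<^sup>2 / 4) \<partial>std_normal_distribution) / exp (x\<^sup>2 / 4)"
    using integral_Markov_inequality_measure[OF int, of "{}" "exp (x\<^sup>2 / 4)"] by simp
  also have "\<dots> = sqrt 2 * exp (- x\<^sup>2 / 4)"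
  proof -
    have "exp (- x\<^sup>2 / 4) = inverse (exp (x\<^sup>2 / 4))" by (subst exp_minus[symmetric]) simp
    then show ?thesis unfolding val by (simp only: divide_inverse[of _ "exp (x\<^sup>2 / 4)"])
  qed
  finally show ?thesis .
qed

text \<open>The interval from x to x + 1 already carries this mass, the density being smallest at
  its right end.\<close>

lemma std_normal_tail_lower:
  assumes "0 \<le> x"
  shows "exp (- (x + 1)\<^sup>2 / 2) / sqrt (2 * pi) \<le> 1 - \<Phi> x"
proof -
  define \<phi> where "\<phi> = exp (- (x + 1)\<^sup>2 / 2) / sqrt (2 * pi)"
  have "ennreal \<phi> = (\<integral>\<^sup>+z. ennreal \<phi> * indicator {x<..x + 1} z \<partial>lborel)"
    by (simp add: nn_integral_cmult_indicator)
  also have "\<dots> \<le> (\<integral>\<^sup>+z. ennreal (std_normal_density z) * indicator {x<..x + 1} z \<partial>lborel)"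
  proof (rule nn_integral_mono)
    fix z :: real
    show "ennreal \<phi> * indicator {x<..x + 1} z \<le> ennreal (std_normal_density z) * indicator {x<..x + 1} z"
    proof (cases "z \<in> {x<..x + 1}")
      case True
      then have "z\<^sup>2 \<le> (x + 1)\<^sup>2" using assms by (intro power_mono) auto
      then have "\<phi> \<le> std_normal_density z"
        unfolding \<phi>_def std_normal_density_def by (simp add: divide_right_mono)
      then show ?thesis using True by (simp add: ennreal_leI)
    qed simp
  qed
  also have "\<dots> = emeasure std_normal_distribution {x<..x + 1}"
    by (subst emeasure_density) auto
  finally have "\<phi> \<le> std_normal.prob {x<..x + 1}"
    by (simp add: std_normal.emeasure_eq_measure)
  also have "\<dots> \<le> std_normal.prob (space std_normal_distribution - {..x})"
    by (intro std_normal.finite_measure_mono) auto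
  also have "\<dots> = 1 - \<Phi> x"
    by (subst std_normal.prob_compl) (auto simp: cdf_def)
  finally show ?thesis by (simp add: \<phi>_def)
qed

text \<open>Once ln n \<le> C' ln|V_O|, the quantile level is polynomial in |V_O|, so
  \<open>lam\<close> is of exact order sqrt (ln|V_O| / n). The lower bound makes the true parameters
  feasible in both programs, the upper bound enters the rate. Three observable agents ensure
  \<open>1 \<le> l\<close>.\<close>

lemma lam_bounds:
  fixes X :: "'v set"
  defines "l \<equiv> ln (real (card X))"
  assumes n: "1 \<le> n" and X: "3 \<le> card X" and C': "ln (real n) \<le> C' * l"
  shows "sqrt (l / real n) \<le> lam n X" "lam n X \<le> sqrt (4 * (6 + C')) * sqrt (l / real n)"
proof -
  define p where "p = real (card X)"
  have p: "3 \<le> p" using X by (simp add: p_def)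
  have l1: "1 \<le> l"
  proof -
    have "exp 1 \<le> p" using exp_le p by linarith
    then show ?thesis using p ln_ge_iff[of p 1] by (simp add: l_def p_def[symmetric])
  qed
  define \<delta> where "\<delta> = 1 / (3 * real n * p\<^sup>2)"
  define q where "q = inv \<Phi> (1 - \<delta>)"
  have den: "9 * p \<le> 3 * real n * p\<^sup>2"
  proof -
    have "9 * p \<le> 3 * 1 * (p * p)" using p by simp
    also have "\<dots> \<le> 3 * real n * (p * p)" using n p by (intro mult_right_mono mult_left_mono) auto
    finally show ?thesis by (simp add: power2_eq_square)
  qed
  have \<delta>: "0 < \<delta>" "\<delta> < 1" "\<delta> \<le> 1 / (9 * p)"
    using den p n by (auto simp: \<delta>_def divide_simps)
  have q: "\<Phi> q = 1 - \<delta>" unfolding q_def using \<delta> by (intro std_normal_quantile) auto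
  have q_low: "sqrt l \<le> q"
  proof (rule ccontr)
    assume "\<not> sqrt l \<le> q"
    then have "\<Phi> q \<le> \<Phi> (sqrt l)" by (intro std_normal.cdf_nondecreasing) auto
    then have "1 - \<Phi> (sqrt l) \<le> \<delta>" using q by simp
    then have "exp (- (sqrt l + 1)\<^sup>2 / 2) / sqrt (2 * pi) \<le> \<delta>"
      using std_normal_tail_lower[of "sqrt l"] l1 by simp
    also have "\<dots> \<le> 1 / (9 * p)" by (rule \<delta>(3))
    finally have le: "exp (- (sqrt l + 1)\<^sup>2 / 2) / sqrt (2 * pi) \<le> 1 / (9 * p)" .
    \<comment> \<open>The tail at \<open>sqrt l\<close> is more than exp (- l - 1) / 3, that is 1 /
      (3 e p), and e \<le> 3 makes this at least 1 / (9 p). Strictness comes from sqrt (2 pi) <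
      3.\<close>
    have "(sqrt l + 1)\<^sup>2 \<le> 2 * l + 2"
      using sum_squares_bound[of "sqrt l" 1] l1 by (simp add: power2_sum)
    then have "exp (- l - 1) \<le> exp (- (sqrt l + 1)\<^sup>2 / 2)" by simp
    moreover have "exp (- l - 1) = 1 / (p * exp 1)"
      using p by (simp add: exp_diff exp_minus l_def p_def[symmetric] divide_inverse)
    moreover have "sqrt (2 * pi) < 3"
      using pi_less_4 by (intro real_less_lsqrt) (auto simp: power2_eq_square)
    moreover have "1 / (p * exp 1) / 3 \<ge> 1 / (p * 3) / 3"
      using exp_le p by (intro divide_right_mono divide_left_mono mult_left_mono) auto
    moreover have "1 / (p * exp 1) / 3 < exp (- (sqrt l + 1)\<^sup>2 / 2) / sqrt (2 * pi)"
    proof -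
      have "1 / (p * exp 1) / 3 < 1 / (p * exp 1) / sqrt (2 * pi)"
        using p \<open>sqrt (2 * pi) < 3\<close> by (intro divide_strict_left_mono) auto
      also have "\<dots> \<le> exp (- (sqrt l + 1)\<^sup>2 / 2) / sqrt (2 * pi)"
        using \<open>exp (- l - 1) \<le> _\<close> \<open>exp (- l - 1) = _\<close> by (intro divide_right_mono) auto
      finally show ?thesis .
    qed
    ultimately show False using le by simp
  qed
  have lam: "lam n X = q / sqrt (real n)"
    by (simp add: lam_def q_def \<delta>_def p_def)
  show "sqrt (l / real n) \<le> lam n X"
    unfolding lam real_sqrt_divide using q_low by (intro divide_right_mono) auto
  have q0: "0 \<le> q" using q_low l1 by (intro order_trans[OF _ q_low]) auto
  have "\<delta> \<le> sqrt 2 * exp (- q\<^sup>2 / 4)" using std_normal_tail_upper[OF q0] q by simp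
  also have "\<dots> \<le> 5 / 3 * exp (- q\<^sup>2 / 4)"
    by (intro mult_right_mono real_le_lsqrt) (auto simp: power2_eq_square)
  finally have "\<delta> * exp (q\<^sup>2 / 4) \<le> 5 / 3" by (simp add: exp_minus field_simps)
  then have "exp (q\<^sup>2 / 4) \<le> 5 * (real n * p\<^sup>2)" using n p by (simp add: \<delta>_def field_simps)
  then have "q\<^sup>2 / 4 \<le> ln (5 * (real n * p\<^sup>2))"
    using n p by (subst ln_ge_iff) auto
  also have "\<dots> = ln 5 + (ln (real n) + 2 * l)"
    using n p by (simp add: ln_mult ln_realpow l_def p_def[symmetric])
  also have "ln 5 \<le> (4::real)" using ln_le_minus_one[of "5::real"] by simp
  also have "4 + (ln (real n) + 2 * l) \<le> (6 + C') * l" using C' l1 by (simp add: algebra_simps)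
  finally have "q\<^sup>2 \<le> 4 * (6 + C') * l" by (simp add: algebra_simps)
  then have "q \<le> sqrt (4 * (6 + C') * l)" by (rule real_le_rsqrt)
  then show "lam n X \<le> sqrt (4 * (6 + C')) * sqrt (l / real n)"
    unfolding lam by (simp add: real_sqrt_mult real_sqrt_divide divide_right_mono)
qed

section \<open>The empirical fourth-power norm\<close>

definition norm4 :: "nat \<Rightarrow> (nat \<Rightarrow> real) \<Rightarrow> real" where
  "norm4 n u = root 4 (avg n (\<lambda>t. \<bar>u t\<bar> ^ 4))"

lemma avg_nonneg: "(\<And>t. t \<in> {1..n} \<Longrightarrow> 0 \<le> f t) \<Longrightarrow> 0 \<le> avg n f"
  unfolding avg_def by (intro divide_nonneg_nonneg sum_nonneg) auto

lemma avg_mono: "(\<And>t. t \<in> {1..n} \<Longrightarrow> f t \<le> g t) \<Longrightarrow> avg n f \<le> avg n g"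
  unfolding avg_def by (intro divide_right_mono sum_mono) auto

lemma avg_cong: "(\<And>t. t \<in> {1..n} \<Longrightarrow> f t = g t) \<Longrightarrow> avg n f = avg n g"
  unfolding avg_def by (intro arg_cong2[where f = "(/)"] sum.cong) auto

lemma avg_add: "avg n (\<lambda>t. f t + g t) = avg n f + avg n g"
  by (simp add: avg_def sum.distrib add_divide_distrib)

lemma avg_diff: "avg n (\<lambda>t. f t - g t) = avg n f - avg n g"
  by (simp add: avg_def sum_subtractf diff_divide_distrib)

lemma avg_cmult: "avg n (\<lambda>t. c * f t) = c * avg n f"
  by (simp add: avg_def sum_distrib_left)

lemma avg_const: "1 \<le> n \<Longrightarrow> avg n (\<lambda>_. c) = c"
  by (simp add: avg_def)

lemma avg_sum: "avg n (\<lambda>t. \<Sum>j\<in>J. f j t) = (\<Sum>j\<in>J. avg n (f j))"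
  unfolding avg_def sum_divide_distrib by (rule sum.swap)

lemma avg_Cauchy_Schwarz: "(avg n (\<lambda>t. f t * g t))\<^sup>2 \<le> avg n (\<lambda>t. (f t)\<^sup>2) * avg n (\<lambda>t. (g t)\<^sup>2)"
  using Cauchy_Schwarz_ineq_sum[of f g "{1..n}"]
  by (simp add: avg_def power_divide power2_eq_square divide_right_mono)

lemma norm4_nonneg: "0 \<le> norm4 n u"
  unfolding norm4_def by (simp add: avg_nonneg)

lemma norm4_power: "norm4 n u ^ 4 = avg n (\<lambda>t. u t ^ 4)"
  unfolding norm4_def by (simp add: avg_nonneg)

lemma norm4_le_iff: "0 \<le> c \<Longrightarrow> norm4 n u \<le> c \<longleftrightarrow> avg n (\<lambda>t. u t ^ 4) \<le> c ^ 4"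
  unfolding norm4_power[symmetric] using norm4_nonneg[of n u] by (simp add: power_mono_iff)

lemma norm4_scale: "norm4 n (\<lambda>t. c * u t) = \<bar>c\<bar> * norm4 n u"
proof -
  have "norm4 n (\<lambda>t. c * u t) ^ 4 = (\<bar>c\<bar> * norm4 n u) ^ 4"
    unfolding norm4_power power_mult_distrib by (simp add: avg_cmult norm4_power)
  then show ?thesis
    by (rule power_eq_imp_eq_base) (simp_all add: norm4_nonneg)
qed

lemma avg_square_le_norm4: assumes "1 \<le> n" shows "avg n (\<lambda>t. (u t)\<^sup>2) \<le> (norm4 n u)\<^sup>2"
proof -
  have "(avg n (\<lambda>t. (u t)\<^sup>2 * 1))\<^sup>2 \<le> avg n (\<lambda>t. ((u t)\<^sup>2)\<^sup>2) * avg n (\<lambda>t. 1\<^sup>2)"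
    by (rule avg_Cauchy_Schwarz)
  also have "\<dots> = ((norm4 n u)\<^sup>2)\<^sup>2"
    using assms norm4_power[of n u] by (simp add: avg_const)
  finally have "(avg n (\<lambda>t. (u t)\<^sup>2))\<^sup>2 \<le> ((norm4 n u)\<^sup>2)\<^sup>2" by simp
  then show ?thesis by (rule power2_le_imp_le) simp
qed

lemma avg_le_norm4: assumes "1 \<le> n" shows "avg n u \<le> norm4 n u"
proof -
  have "(avg n (\<lambda>t. u t * 1))\<^sup>2 \<le> avg n (\<lambda>t. (u t)\<^sup>2) * avg n (\<lambda>t. 1\<^sup>2)"
    by (rule avg_Cauchy_Schwarz)
  also have "\<dots> \<le> (norm4 n u)\<^sup>2"
    using assms avg_square_le_norm4[OF assms] by (simp add: avg_const)
  finally have "(avg n u)\<^sup>2 \<le> (norm4 n u)\<^sup>2" by simp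
  then show ?thesis by (rule power2_le_imp_le) (rule norm4_nonneg)
qed

text \<open>Binomial expansion of the fourth power: Cauchy-Schwarz, applied twice for the odd terms,
  bounds each mixed average by the corresponding monomial in the two norms.\<close>

lemma norm4_triangle: "norm4 n (\<lambda>t. u t + v t) \<le> norm4 n u + norm4 n v"
proof -
  define a b where "a = norm4 n u" and "b = norm4 n v"
  have ab: "0 \<le> a" "0 \<le> b" by (simp_all add: a_def b_def norm4_nonneg)
  have a4: "avg n (\<lambda>t. u t ^ 4) = a ^ 4" and b4: "avg n (\<lambda>t. v t ^ 4) = b ^ 4"
    by (simp_all add: a_def b_def norm4_power)
  have CS: "\<bar>avg n (\<lambda>t. f t * g t)\<bar> \<le> c * d"
    if "avg n (\<lambda>t. (f t)\<^sup>2) = c\<^sup>2" "avg n (\<lambda>t. (g t)\<^sup>2) = d\<^sup>2" "0 \<le> c" "0 \<le> d" for f g c d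
  proof -
    have "(avg n (\<lambda>t. f t * g t))\<^sup>2 \<le> (c * d)\<^sup>2"
      using avg_Cauchy_Schwarz[of n f g] that by (simp add: power_mult_distrib)
    then show ?thesis using that by (simp add: power2_le_iff_abs_le)
  qed
  have "avg n (\<lambda>t. ((u t)\<^sup>2)\<^sup>2) = (a\<^sup>2)\<^sup>2" "avg n (\<lambda>t. ((v t)\<^sup>2)\<^sup>2) = (b\<^sup>2)\<^sup>2" using a4 b4 by simp_all
  note sq = this
  have m: "\<bar>avg n (\<lambda>t. (u t)\<^sup>2 * (v t)\<^sup>2)\<bar> \<le> a\<^sup>2 * b\<^sup>2" by (rule CS[OF sq]) simp_all
  have uv0: "0 \<le> avg n (\<lambda>t. (u t * v t)\<^sup>2)" by (intro avg_nonneg) simp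
  have uv: "sqrt (avg n (\<lambda>t. (u t * v t)\<^sup>2)) \<le> a * b"
    using m ab by (intro real_le_lsqrt) (simp_all add: power_mult_distrib)
  have "\<bar>avg n (\<lambda>t. (u t)\<^sup>2 * (u t * v t))\<bar> \<le> a\<^sup>2 * sqrt (avg n (\<lambda>t. (u t * v t)\<^sup>2))"
    by (rule CS[OF sq(1)]) (simp_all add: uv0)
  also have "\<dots> \<le> a\<^sup>2 * (a * b)" using uv by (intro mult_left_mono) auto
  finally have u3: "avg n (\<lambda>t. (u t)\<^sup>2 * (u t * v t)) \<le> a\<^sup>2 * (a * b)" by simp
  have "\<bar>avg n (\<lambda>t. (v t)\<^sup>2 * (u t * v t))\<bar> \<le> b\<^sup>2 * sqrt (avg n (\<lambda>t. (u t * v t)\<^sup>2))"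
    by (rule CS[OF sq(2)]) (simp_all add: uv0)
  also have "\<dots> \<le> b\<^sup>2 * (a * b)" using uv by (intro mult_left_mono) auto
  finally have v3: "avg n (\<lambda>t. (v t)\<^sup>2 * (u t * v t)) \<le> b\<^sup>2 * (a * b)" by simp
  have "avg n (\<lambda>t. (u t + v t) ^ 4) = avg n (\<lambda>t. u t ^ 4 + (4 * ((u t)\<^sup>2 * (u t * v t)) +
      (6 * ((u t)\<^sup>2 * (v t)\<^sup>2) + (4 * ((v t)\<^sup>2 * (u t * v t)) + v t ^ 4))))"
    by (intro avg_cong) (simp add: power2_eq_square power4_eq_xxxx algebra_simps)
  also have "\<dots> \<le> a ^ 4 + (4 * (a\<^sup>2 * (a * b)) + (6 * (a\<^sup>2 * b\<^sup>2) + (4 * (b\<^sup>2 * (a * b)) + b ^ 4)))"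
    unfolding avg_add avg_cmult a4 b4 using u3 v3 m by (intro add_mono mult_left_mono) auto
  also have "\<dots> = (a + b) ^ 4"
    by (simp add: power2_eq_square power4_eq_xxxx algebra_simps)
  finally show ?thesis using ab unfolding a_def[symmetric] b_def[symmetric] by (simp add: norm4_le_iff)
qed

text \<open>Pointwise the two sides differ by 6 (x^2 - y^2)^2. This is the quantitative form of
  strict convexity used for comparing directions.\<close>

lemma norm4_Clarkson: "norm4 n (\<lambda>t. u t + v t) ^ 4 + norm4 n (\<lambda>t. u t - v t) ^ 4 \<le> 8 * (norm4 n u ^ 4 + norm4 n v ^ 4)"
proof -
  have "(x + y) ^ 4 + (x - y) ^ 4 \<le> 8 * (x ^ 4 + y ^ 4)" for x y :: real
  proof -
    have "8 * (x ^ 4 + y ^ 4) - ((x + y) ^ 4 + (x - y) ^ 4) = 6 * (x\<^sup>2 - y\<^sup>2)\<^sup>2"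
      by (simp add: power2_eq_square power4_eq_xxxx algebra_simps)
    then show ?thesis using zero_le_power2[of "x\<^sup>2 - y\<^sup>2"] by linarith
  qed
  then show ?thesis unfolding norm4_power avg_add[symmetric] avg_cmult[symmetric] by (intro avg_mono) auto
qed

text \<open>Near equality in the triangle inequality survives normalization, so the unit vectors
  have a sum of norm at least 2 - 2 \<eta>. The Clarkson inequality then bounds the fourth power of
  the difference by 16 - (2 - 2 \<eta>)^4, and Bernoulli's inequality by 64 \<eta>.\<close>

lemma norm4_directions_close:
  fixes u v :: "nat \<Rightarrow> real" and n :: nat
  defines "a \<equiv> norm4 n u" and "b \<equiv> norm4 n v"
  assumes lower: "1 / 2 \<le> a" "1 / 2 \<le> b" and \<eta>: "0 \<le> \<eta>" "\<eta> \<le> 1"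
    and almost: "a + b - \<eta> \<le> norm4 n (\<lambda>t. u t + v t)"
  shows "norm4 n (\<lambda>t. u t / a - v t / b) ^ 4 \<le> 64 * \<eta>"
proof -
  \<comment> \<open>The longer vector is split: f + g is x times the sum of the normalized vectors
    plus a multiple of g of norm y - x. Dividing by \<open>x\<close>, which is at least 1/2, doubles
    the defect.\<close>
  have key: "2 - 2 * \<eta> \<le> norm4 n (\<lambda>t. f t / x + g t / y)"
    if "1 / 2 \<le> x" "x \<le> y" "norm4 n g = y" "x + y - \<eta> \<le> norm4 n (\<lambda>t. f t + g t)" for f g x y
  proof -
    have "(\<lambda>t. f t + g t) = (\<lambda>t. x * (f t / x + g t / y) + (y - x) / y * g t)"
      using that by (auto simp: fun_eq_iff field_simps)
    then have "x + y - \<eta> \<le> norm4 n (\<lambda>t. x * (f t / x + g t / y)) + norm4 n (\<lambda>t. (y - x) / y * g t)"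
      using that(4) norm4_triangle[of n "\<lambda>t. x * (f t / x + g t / y)" "\<lambda>t. (y - x) / y * g t"] by simp
    also have "\<dots> = x * norm4 n (\<lambda>t. f t / x + g t / y) + (y - x)"
      unfolding norm4_scale using that by simp
    finally have "x * (2 - norm4 n (\<lambda>t. f t / x + g t / y)) \<le> \<eta>" by (simp add: algebra_simps)
    moreover have "1 / 2 * (2 - norm4 n (\<lambda>t. f t / x + g t / y)) \<le> x * (2 - norm4 n (\<lambda>t. f t / x + g t / y))
        \<or> 2 - norm4 n (\<lambda>t. f t / x + g t / y) \<le> 0"
      using that(1) by (auto intro: mult_right_mono)
    ultimately show ?thesis using \<eta> by auto
  qed
  have nab: "norm4 n u = a" "norm4 n v = b" by (simp_all only: a_def b_def)
  have sum: "2 - 2 * \<eta> \<le> norm4 n (\<lambda>t. u t / a + v t / b)"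
  proof (cases "a \<le> b")
    case True
    then show ?thesis by (rule key[OF lower(1) _ nab(2) almost])
  next
    case False
    then have "b \<le> a" by simp
    moreover have "b + a - \<eta> \<le> norm4 n (\<lambda>t. v t + u t)"
      using almost by (simp only: add.commute)
    ultimately have "2 - 2 * \<eta> \<le> norm4 n (\<lambda>t. v t / b + u t / a)"
      by (rule key[OF lower(2) _ nab(1)])
    then show ?thesis by (simp only: add.commute)
  qed
  have unit: "norm4 n (\<lambda>t. u t / a) = 1" "norm4 n (\<lambda>t. v t / b) = 1"
    using norm4_scale[of n "1 / a" u] norm4_scale[of n "1 / b" v] lower unfolding nab by simp_all
  have "16 * (1 - 4 * \<eta>) \<le> (2 - 2 * \<eta>) ^ 4"
  proof -
    have "1 + real 4 * (- \<eta>) \<le> (1 + (- \<eta>)) ^ 4" using \<eta> by (intro Bernoulli_inequality) auto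
    moreover have "(2 - 2 * \<eta>) ^ 4 = 16 * (1 - \<eta>) ^ 4"
    proof -
      have "2 - 2 * \<eta> = 2 * (1 - \<eta>)" by simp
      then show ?thesis by (simp only: power_mult_distrib) simp
    qed
    ultimately show ?thesis by simp
  qed
  also have "(2 - 2 * \<eta>) ^ 4 \<le> norm4 n (\<lambda>t. u t / a + v t / b) ^ 4"
    using sum \<eta> by (intro power_mono) auto
  finally show ?thesis
    using norm4_Clarkson[of n "\<lambda>t. u t / a" "\<lambda>t. v t / b"] unit by simp
qed

section \<open>The row of the relaxed inverse that belongs to the intercept\<close>

definition score :: "'v set \<Rightarrow> (nat \<Rightarrow> 'v \<Rightarrow> real) \<Rightarrow> ('v option \<Rightarrow> real) \<Rightarrow> nat \<Rightarrow> real" where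
  "score X p \<psi> t = (\<Sum>i\<in>bar_ix X. \<psi> i * aug (p t) i)"

text \<open>The constraints of the second step on the row \<open>None\<close> alone, with the matrix
  products rewritten through the scores.\<close>

definition row_feasible :: "nat \<Rightarrow> 'v set \<Rightarrow> (nat \<Rightarrow> 'v \<Rightarrow> real) \<Rightarrow> real \<Rightarrow> ('v option \<Rightarrow> real) \<Rightarrow> bool" where
  "row_feasible n X p z \<psi> \<longleftrightarrow> (\<forall>j\<in>bar_ix X.
     \<bar>avg n (\<lambda>t. score X p \<psi> t * aug (p t) j) - of_bool (None = j)\<bar> \<le> lam n X * z \<and>
     sqrt (avg n (\<lambda>t. (score X p \<psi> t * aug (p t) j - of_bool (None = j))\<^sup>2)) \<le> z)"

lemma finite_bar_ix: "finite X \<Longrightarrow> finite (bar_ix X)"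
  by (simp add: bar_ix_def)

lemma None_bar_ix: "None \<in> bar_ix X"
  by (simp add: bar_ix_def)

lemma mv_on_score: "mv_on (bar_ix X) \<Psi> (aug (p t)) k = score X p (\<Psi> k) t"
  by (simp add: mv_on_def score_def)

lemma mm_on_Sigma_hat: "mm_on (bar_ix X) \<Psi> (Sigma_hat n p) k j = avg n (\<lambda>t. score X p (\<Psi> k) t * aug (p t) j)"
  unfolding mm_on_def Sigma_hat_def score_def sum_distrib_right mult.assoc avg_sum avg_cmult ..

lemma row_feasible_nonneg: "row_feasible n X p z \<psi> \<Longrightarrow> 0 \<le> z"
  unfolding row_feasible_def using None_bar_ix[of X] avg_nonneg[of n]
  by (metis (no_types, lifting) order_trans real_sqrt_ge_zero zero_le_power2)

text \<open>Objective and constraints decouple over the rows, so exchanging only the row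
  \<open>None\<close> of a minimizer shows that this row is minimal by itself.\<close>

lemma step2_row:
  assumes X: "finite X" and sol: "step2_solution n X p \<Psi>"
  shows "\<exists>z. row_feasible n X p z (\<Psi> None) \<and>
    (\<forall>z' \<psi>. row_feasible n X p z' \<psi> \<longrightarrow> norm4 n (score X p (\<Psi> None)) + z \<le> norm4 n (score X p \<psi>) + z')"
proof -
  obtain z where am: "is_arg_min (step2_objective n X p) (step2_feasible n X p) (z, \<Psi>)"
    using sol unfolding step2_solution_def by blast
  have feas: "step2_feasible n X p (z, \<Psi>)" using am by (simp add: is_arg_min_def)
  have split: "step2_objective n X p (y, \<Theta>) = norm4 n (score X p (\<Theta> None)) + y None
      + (\<Sum>k\<in>bar_ix X - {None}. norm4 n (score X p (\<Theta> k)) + y k)" for y \<Theta>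
    unfolding step2_objective_def norm4_def mv_on_score prod.case
    using finite_bar_ix[OF X] None_bar_ix[of X] by (subst sum.remove[of _ None]) auto
  have feas_iff: "step2_feasible n X p (y, \<Theta>) \<longleftrightarrow> row_feasible n X p (y None) (\<Theta> None) \<and>
     (\<forall>k\<in>bar_ix X - {None}. \<forall>j\<in>bar_ix X.
       \<bar>avg n (\<lambda>t. score X p (\<Theta> k) t * aug (p t) j) - of_bool (k = j)\<bar> \<le> lam n X * y k \<and>
       sqrt (avg n (\<lambda>t. (score X p (\<Theta> k) t * aug (p t) j - of_bool (k = j))\<^sup>2)) \<le> y k)" for y \<Theta>
    unfolding step2_feasible_def row_feasible_def prod.case mm_on_Sigma_hat mv_on_score
    using None_bar_ix[of X] by blast
  have "norm4 n (score X p (\<Psi> None)) + z None \<le> norm4 n (score X p \<psi>) + z'" if "row_feasible n X p z' \<psi>" for z' \<psi>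
  proof -
    have "step2_feasible n X p (z(None := z'), \<Psi>(None := \<psi>))"
      using feas that unfolding feas_iff by auto
    then have "step2_objective n X p (z, \<Psi>) \<le> step2_objective n X p (z(None := z'), \<Psi>(None := \<psi>))"
      using am unfolding is_arg_min_def by (meson not_le)
    moreover have "(\<Sum>k\<in>bar_ix X - {None}. norm4 n (score X p ((\<Psi>(None := \<psi>)) k)) + (z(None := z')) k)
        = (\<Sum>k\<in>bar_ix X - {None}. norm4 n (score X p (\<Psi> k)) + z k)"
      by (intro sum.cong) auto
    ultimately show ?thesis unfolding split fun_upd_same by linarith
  qed
  then show ?thesis using feas unfolding feas_iff by blast
qed

lemma score_linear: "score X p (\<lambda>i. (\<phi> i + \<psi> i) / 2) t = (score X p \<phi> t + score X p \<psi> t) / 2"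
  unfolding score_def by (simp add: sum.distrib[symmetric] sum_divide_distrib algebra_simps add_divide_distrib)

lemma sqrt_avg_triangle:
  "sqrt (avg n (\<lambda>t. ((f t + g t) / 2)\<^sup>2)) \<le> (sqrt (avg n (\<lambda>t. (f t)\<^sup>2)) + sqrt (avg n (\<lambda>t. (g t)\<^sup>2))) / 2"
proof -
  have "L2_set (\<lambda>t. f t + g t) {1..n} \<le> L2_set f {1..n} + L2_set g {1..n}" by (rule L2_set_triangle_ineq)
  then have "L2_set (\<lambda>t. f t + g t) {1..n} / sqrt (real n) / 2 \<le> (L2_set f {1..n} / sqrt (real n) + L2_set g {1..n} / sqrt (real n)) / 2"
    by (simp add: add_divide_distrib[symmetric] divide_right_mono)
  moreover have "sqrt (avg n (\<lambda>t. ((f t + g t) / 2)\<^sup>2)) = L2_set (\<lambda>t. f t + g t) {1..n} / sqrt (real n) / 2"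
  proof -
    have "avg n (\<lambda>t. ((f t + g t) / 2)\<^sup>2) = (\<Sum>t=1..n. (f t + g t)\<^sup>2) / real n / 4"
      by (simp add: avg_def power_divide sum_divide_distrib[symmetric])
    then show ?thesis by (simp add: L2_set_def real_sqrt_divide real_sqrt_mult)
  qed
  ultimately show ?thesis by (simp add: L2_set_def avg_def real_sqrt_divide)
qed

lemma row_feasible_midpoint:
  assumes "row_feasible n X p y \<phi>" "row_feasible n X p z \<psi>"
  shows "row_feasible n X p ((y + z) / 2) (\<lambda>i. (\<phi> i + \<psi> i) / 2)"
  unfolding row_feasible_def
proof (intro ballI conjI)
  fix j assume j: "j \<in> bar_ix X"
  let ?d = "of_bool (None = j) :: real"
  let ?f = "\<lambda>t. score X p \<phi> t * aug (p t) j - ?d" and ?g = "\<lambda>t. score X p \<psi> t * aug (p t) j - ?d"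
  have eq: "score X p (\<lambda>i. (\<phi> i + \<psi> i) / 2) t * aug (p t) j - ?d = (?f t + ?g t) / 2" for t
    unfolding score_linear by (simp add: algebra_simps add_divide_distrib)
  have "sqrt (avg n (\<lambda>t. ((?f t + ?g t) / 2)\<^sup>2)) \<le> (y + z) / 2"
    using sqrt_avg_triangle[of n ?f ?g] assms j unfolding row_feasible_def by fastforce
  then show "sqrt (avg n (\<lambda>t. (score X p (\<lambda>i. (\<phi> i + \<psi> i) / 2) t * aug (p t) j - ?d)\<^sup>2)) \<le> (y + z) / 2"
    unfolding eq .
  have mid: "\<bar>(a + b) / 2\<bar> \<le> (c + d) / 2" if "\<bar>a\<bar> \<le> c" "\<bar>b\<bar> \<le> d" for a b c d :: real
    using that by (auto simp: abs_le_iff field_simps)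
  have "avg n (\<lambda>t. score X p (\<lambda>i. (\<phi> i + \<psi> i) / 2) t * aug (p t) j) - ?d
     = ((avg n (\<lambda>t. score X p \<phi> t * aug (p t) j) - ?d) + (avg n (\<lambda>t. score X p \<psi> t * aug (p t) j) - ?d)) / 2"
  proof -
    have "avg n (\<lambda>t. score X p (\<lambda>i. (\<phi> i + \<psi> i) / 2) t * aug (p t) j)
       = avg n (\<lambda>t. (1 / 2) * (score X p \<phi> t * aug (p t) j + score X p \<psi> t * aug (p t) j))"
      unfolding score_linear by (intro avg_cong) (simp add: algebra_simps add_divide_distrib)
    then show ?thesis unfolding avg_cmult avg_add by (simp add: field_simps)
  qed
  moreover have "\<bar>avg n (\<lambda>t. score X p \<phi> t * aug (p t) j) - ?d\<bar> \<le> lam n X * y"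
    "\<bar>avg n (\<lambda>t. score X p \<psi> t * aug (p t) j) - ?d\<bar> \<le> lam n X * z"
    using assms j unfolding row_feasible_def by blast+
  moreover have "lam n X * ((y + z) / 2) = (lam n X * y + lam n X * z) / 2" by (simp add: algebra_simps add_divide_distrib)
  ultimately show "\<bar>avg n (\<lambda>t. score X p (\<lambda>i. (\<phi> i + \<psi> i) / 2) t * aug (p t) j) - ?d\<bar> \<le> lam n X * ((y + z) / 2)"
    by (simp only: mid)
qed

text \<open>The regressor with index \<open>None\<close> is constantly 1, so its constraint says
  that the average of the score is within \<open>lam * z\<close> of 1. This keeps the later
  normalization away from zero.\<close>

lemma row_score_lower:
  assumes "1 \<le> n" "row_feasible n X p z \<psi>" "lam n X * z \<le> 1 / 2"
  shows "1 / 2 \<le> norm4 n (score X p \<psi>)"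
proof -
  have "\<bar>avg n (score X p \<psi>) - 1\<bar> \<le> lam n X * z"
    using assms(2) None_bar_ix[of X] unfolding row_feasible_def by (auto simp: aug_def dest!: bspec[of _ _ None])
  then have "1 / 2 \<le> avg n (score X p \<psi>)" using assms(3) by linarith
  then show ?thesis using avg_le_norm4[OF assms(1)] by (rule order_trans)
qed

text \<open>The minimizing row is not unique in general, but the direction of its score vector is.\<close>

lemma near_minimizers_close:
  assumes n: "1 \<le> n" and lam: "0 \<le> lam n X"
    and min: "row_feasible n X p z \<psi>"
      "\<And>z' \<psi>'. row_feasible n X p z' \<psi>' \<Longrightarrow> norm4 n (score X p \<psi>) + z \<le> norm4 n (score X p \<psi>') + z'"
    and near: "row_feasible n X p y \<phi>" "norm4 n (score X p \<phi>) + y \<le> norm4 n (score X p \<psi>) + z + \<eta>"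
    and \<eta>: "0 \<le> \<eta>" "\<eta> \<le> 1" and small: "lam n X * (norm4 n (score X p \<psi>) + z + 1) \<le> 1 / 2"
  shows "norm4 n (\<lambda>t. score X p \<psi> t / norm4 n (score X p \<psi>) - score X p \<phi> t / norm4 n (score X p \<phi>)) ^ 4 \<le> 64 * \<eta>"
proof (rule norm4_directions_close)
  have "lam n X * z \<le> lam n X * (norm4 n (score X p \<psi>) + z + 1)"
    using lam norm4_nonneg[of n "score X p \<psi>"] by (intro mult_left_mono) auto
  then show "1 / 2 \<le> norm4 n (score X p \<psi>)"
    using small by (intro row_score_lower[OF n min(1)]) simp
  have "lam n X * y \<le> lam n X * (norm4 n (score X p \<psi>) + z + 1)"
    using lam near(2) \<eta> norm4_nonneg[of n "score X p \<phi>"] by (intro mult_left_mono) auto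
  then show "1 / 2 \<le> norm4 n (score X p \<phi>)"
    using small by (intro row_score_lower[OF n near(1)]) simp
  \<comment> \<open>The midpoint row is feasible, so its value is at least the minimum. The
    \<open>z\<close>-components average out, and near-minimality of the second row leaves a defect
    of at most \<eta> in the triangle inequality.\<close>
  have "norm4 n (score X p \<psi>) + z \<le> norm4 n (score X p (\<lambda>i. (\<psi> i + \<phi> i) / 2)) + (z + y) / 2"
    by (rule min(2)[OF row_feasible_midpoint[OF min(1) near(1)]])
  also have "score X p (\<lambda>i. (\<psi> i + \<phi> i) / 2) = (\<lambda>t. 1 / 2 * (score X p \<psi> t + score X p \<phi> t))"
    by (simp add: fun_eq_iff score_linear)
  also have "norm4 n \<dots> = norm4 n (\<lambda>t. score X p \<psi> t + score X p \<phi> t) / 2"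
    unfolding norm4_scale by simp
  finally show "norm4 n (score X p \<psi>) + norm4 n (score X p \<phi>) - \<eta> \<le> norm4 n (\<lambda>t. score X p \<psi> t + score X p \<phi> t)"
    using near(2) by (simp add: field_simps)
qed (use \<eta> in auto)

section \<open>A measurable near-minimizer\<close>

text \<open>Countably many candidates, so that a selection among them is a choice of a natural
  number and remains measurable.\<close>

definition rational_rows :: "'v set \<Rightarrow> (real \<times> ('v option \<Rightarrow> real)) set" where
  "rational_rows X = \<rat> \<times> PiE (bar_ix X) (\<lambda>_. \<rat>)"

definition rational_row :: "'v set \<Rightarrow> nat \<Rightarrow> real \<times> ('v option \<Rightarrow> real)" where
  "rational_row X = from_nat_into (rational_rows X)"

lemma range_rational_row:
  assumes "finite X" shows "range (rational_row X) = rational_rows X"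
proof -
  have "countable (rational_rows X)"
    unfolding rational_rows_def using assms countable_rat
    by (intro countable_SIGMA countable_PiE) (auto simp: finite_bar_ix)
  moreover have "(0, restrict (\<lambda>_. 0) (bar_ix X)) \<in> rational_rows X" by (auto simp: rational_rows_def)
  ultimately show ?thesis unfolding rational_row_def by (intro range_from_nat_into) auto
qed

definition row_value :: "nat \<Rightarrow> 'v set \<Rightarrow> (nat \<Rightarrow> 'v \<Rightarrow> real) \<Rightarrow> real \<times> ('v option \<Rightarrow> real) \<Rightarrow> real" where
  "row_value n X p r = norm4 n (score X p (snd r)) + fst r"

definition row_below :: "nat \<Rightarrow> 'v set \<Rightarrow> real \<Rightarrow> (nat \<Rightarrow> 'v \<Rightarrow> real) \<Rightarrow> nat \<Rightarrow> nat \<Rightarrow> bool" where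
  "row_below n X \<eta> p m i \<longleftrightarrow> row_feasible n X p (fst (rational_row X i)) (snd (rational_row X i)) \<and>
     row_value n X p (rational_row X i) \<le> real m * \<eta>"

text \<open>The infimum is located on a grid of mesh \<open>\<eta>\<close>, so that only least natural numbers are selected.\<close>

definition near_row :: "nat \<Rightarrow> 'v set \<Rightarrow> real \<Rightarrow> (nat \<Rightarrow> 'v \<Rightarrow> real) \<Rightarrow> real \<times> ('v option \<Rightarrow> real)" where
  "near_row n X \<eta> p = rational_row X (LEAST i. row_below n X \<eta> p (LEAST m. \<exists>i. row_below n X \<eta> p m i) i)"

text \<open>Rounding the value of any candidate up to the grid costs less than one mesh width, and
  the selected level is the least attained one.\<close>

lemma near_row_minimizes:
  assumes \<eta>: "0 < \<eta>" and feas: "row_feasible n X p (fst (rational_row X i)) (snd (rational_row X i))"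
  shows "row_feasible n X p (fst (near_row n X \<eta> p)) (snd (near_row n X \<eta> p))"
    "row_value n X p (near_row n X \<eta> p) \<le> row_value n X p (rational_row X i) + \<eta>"
proof -
  define v where "v = row_value n X p (rational_row X i)"
  define m where "m = (LEAST m. \<exists>i. row_below n X \<eta> p m i)"
  have v0: "0 \<le> v" using norm4_nonneg row_feasible_nonneg[OF feas] by (simp add: v_def row_value_def add_nonneg_nonneg)
  have "row_below n X \<eta> p (nat \<lceil>v / \<eta>\<rceil>) i"
    unfolding row_below_def using feas \<eta> v0 by (simp add: v_def[symmetric] pos_divide_le_eq[symmetric])
  then have ex: "\<exists>i. row_below n X \<eta> p (nat \<lceil>v / \<eta>\<rceil>) i" by blast
  then have "\<exists>i. row_below n X \<eta> p m i" unfolding m_def by (rule LeastI)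
  then have below: "row_below n X \<eta> p m (LEAST i. row_below n X \<eta> p m i)" by (rule LeastI_ex)
  then show "row_feasible n X p (fst (near_row n X \<eta> p)) (snd (near_row n X \<eta> p))"
    unfolding near_row_def m_def[symmetric] row_below_def by blast
  have "m \<le> nat \<lceil>v / \<eta>\<rceil>" unfolding m_def using ex by (rule Least_le)
  then have "real m \<le> real (nat \<lceil>v / \<eta>\<rceil>)" by (rule of_nat_mono)
  also have "\<dots> = of_int \<lceil>v / \<eta>\<rceil>" using v0 \<eta> by simp
  also have "\<dots> \<le> v / \<eta> + 1" by (rule of_int_ceiling_le_add_one)
  finally have "real m \<le> v / \<eta> + 1" .
  then have "real m * \<eta> \<le> v + \<eta>" using \<eta> by (simp add: field_simps)
  then show "row_value n X p (near_row n X \<eta> p) \<le> row_value n X p (rational_row X i) + \<eta>"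
    using below unfolding near_row_def m_def[symmetric] v_def[symmetric] row_below_def by linarith
qed

text \<open>Raising \<open>z\<close> slightly to a rational \<open>y\<close> makes all constraints
  strict at \<psi>, where \<open>0 < lam n X\<close> is used. The constraints are continuous in the
  row, so rational rows close to \<psi> are feasible and of almost the same value.\<close>

lemma rational_row_approximates:
  assumes X: "finite X" and lam: "0 < lam n X" and feas: "row_feasible n X p z \<psi>" and \<eta>: "0 < \<eta>"
  shows "\<exists>i. row_feasible n X p (fst (rational_row X i)) (snd (rational_row X i)) \<and>
    row_value n X p (rational_row X i) \<le> norm4 n (score X p \<psi>) + z + \<eta>"
proof -
  obtain y where y: "y \<in> \<rat>" "z < y" "y < z + \<eta> / 2"
    using Rats_dense_in_real[of z "z + \<eta> / 2"] \<eta> by auto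
  have "\<exists>q. (\<forall>m. q m \<in> \<rat>) \<and> q \<longlonglongrightarrow> x" for x :: real
  proof -
    have "\<forall>m. \<exists>r\<in>\<rat>. x < r \<and> r < x + inverse (real (Suc m))"
      using Rats_dense_in_real[of x] by (metis inverse_positive_iff_positive less_add_same_cancel1 of_nat_0_less_iff zero_less_Suc)
    then obtain q where q: "\<And>m. q m \<in> \<rat> \<and> x < q m \<and> q m < x + inverse (real (Suc m))" by metis
    have le: "\<forall>m. x \<le> q m" "\<forall>m. q m \<le> x + inverse (real (Suc m))"
      using q less_imp_le by blast+
    have "q \<longlonglongrightarrow> x"
      by (rule tendsto_sandwich[OF always_eventually[OF le(1)] always_eventually[OF le(2)]
            tendsto_const LIMSEQ_inverse_real_of_nat_add])
    then show ?thesis using q by blast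
  qed
  then have "\<exists>q. \<forall>x. (\<forall>m. q x m \<in> \<rat>) \<and> q x \<longlonglongrightarrow> (x :: real)" by (intro choice allI)
  then obtain q where q: "\<And>x m. q x m \<in> \<rat>" "\<And>x :: real. q x \<longlonglongrightarrow> x" by blast
  define \<phi> where "\<phi> = (\<lambda>m. restrict (\<lambda>j. q (\<psi> j) m) (bar_ix X))"
  have sc: "(\<lambda>m. score X p (\<phi> m) t) \<longlonglongrightarrow> score X p \<psi> t" for t
    unfolding score_def \<phi>_def by (intro tendsto_sum tendsto_mult) (auto intro: q)
  have avg: "(\<lambda>m. avg n (\<lambda>t. f m t)) \<longlonglongrightarrow> avg n g" if "\<And>t. (\<lambda>m. f m t) \<longlonglongrightarrow> g t" for f g
    unfolding avg_def divide_inverse by (intro tendsto_mult tendsto_sum that tendsto_const)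
  have "\<forall>\<^sub>F m in sequentially. norm4 n (score X p (\<phi> m)) < norm4 n (score X p \<psi>) + \<eta> / 2"
  proof (rule order_tendstoD(2))
    show "(\<lambda>m. norm4 n (score X p (\<phi> m))) \<longlonglongrightarrow> norm4 n (score X p \<psi>)"
      unfolding norm4_def by (intro tendsto_real_root avg tendsto_power tendsto_rabs sc)
  qed (use \<eta> in simp)
  moreover have "\<forall>\<^sub>F m in sequentially. row_feasible n X p y (\<phi> m)"
    unfolding row_feasible_def
  proof (intro eventually_ball_finite ballI finite_bar_ix X eventually_conj)
    fix j assume j: "j \<in> bar_ix X"
    let ?d = "of_bool (None = j) :: real"
    have "\<bar>avg n (\<lambda>t. score X p \<psi> t * aug (p t) j) - ?d\<bar> \<le> lam n X * z"
      "sqrt (avg n (\<lambda>t. (score X p \<psi> t * aug (p t) j - ?d)\<^sup>2)) \<le> z"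
      using feas j unfolding row_feasible_def by blast+
    then have strict: "\<bar>avg n (\<lambda>t. score X p \<psi> t * aug (p t) j) - ?d\<bar> < lam n X * y"
      "sqrt (avg n (\<lambda>t. (score X p \<psi> t * aug (p t) j - ?d)\<^sup>2)) < y"
      using y lam by (auto intro: le_less_trans)
    have "(\<lambda>m. \<bar>avg n (\<lambda>t. score X p (\<phi> m) t * aug (p t) j) - ?d\<bar>) \<longlonglongrightarrow> \<bar>avg n (\<lambda>t. score X p \<psi> t * aug (p t) j) - ?d\<bar>"
      by (intro tendsto_rabs tendsto_diff avg tendsto_mult sc tendsto_const)
    from order_tendstoD(2)[OF this strict(1)]
    show "\<forall>\<^sub>F m in sequentially. \<bar>avg n (\<lambda>t. score X p (\<phi> m) t * aug (p t) j) - ?d\<bar> \<le> lam n X * y"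
      by (auto elim: eventually_mono)
    have "(\<lambda>m. sqrt (avg n (\<lambda>t. (score X p (\<phi> m) t * aug (p t) j - ?d)\<^sup>2))) \<longlonglongrightarrow> sqrt (avg n (\<lambda>t. (score X p \<psi> t * aug (p t) j - ?d)\<^sup>2))"
      by (intro tendsto_real_sqrt avg tendsto_power tendsto_diff tendsto_mult sc tendsto_const)
    from order_tendstoD(2)[OF this strict(2)]
    show "\<forall>\<^sub>F m in sequentially. sqrt (avg n (\<lambda>t. (score X p (\<phi> m) t * aug (p t) j - ?d)\<^sup>2)) \<le> y"
      by (auto elim: eventually_mono)
  qed
  ultimately have "\<forall>\<^sub>F m in sequentially. norm4 n (score X p (\<phi> m)) < norm4 n (score X p \<psi>) + \<eta> / 2 \<and> row_feasible n X p y (\<phi> m)"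
    by (rule eventually_conj)
  then obtain m where m: "norm4 n (score X p (\<phi> m)) < norm4 n (score X p \<psi>) + \<eta> / 2" "row_feasible n X p y (\<phi> m)"
    using eventually_happens by fastforce
  have "(y, \<phi> m) \<in> range (rational_row X)"
    unfolding range_rational_row[OF X] using y q by (auto simp: rational_rows_def \<phi>_def)
  then obtain i where i: "rational_row X i = (y, \<phi> m)" by auto
  show ?thesis
    by (intro exI[of _ i]) (use m y i in \<open>auto simp: row_value_def\<close>)
qed

text \<open>One \<eta> is lost in passing to rational candidates, the other in rounding to the
  grid.\<close>

lemma near_row_near_minimal:
  assumes X: "finite X" and lam: "0 < lam n X" and feas: "row_feasible n X p z \<psi>" and \<eta>: "0 < \<eta>"
  shows "row_feasible n X p (fst (near_row n X \<eta> p)) (snd (near_row n X \<eta> p))"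
    "norm4 n (score X p (snd (near_row n X \<eta> p))) + fst (near_row n X \<eta> p) \<le> norm4 n (score X p \<psi>) + z + 2 * \<eta>"
proof -
  obtain i where i: "row_feasible n X p (fst (rational_row X i)) (snd (rational_row X i))"
    "row_value n X p (rational_row X i) \<le> norm4 n (score X p \<psi>) + z + \<eta>"
    using rational_row_approximates[OF assms] by blast
  show "row_feasible n X p (fst (near_row n X \<eta> p)) (snd (near_row n X \<eta> p))"
    "norm4 n (score X p (snd (near_row n X \<eta> p))) + fst (near_row n X \<eta> p) \<le> norm4 n (score X p \<psi>) + z + 2 * \<eta>"
    using near_row_minimizes[OF \<eta> i(1)] i(2) by (auto simp: row_value_def)
qed

section \<open>Measurability of the selected row in the prices\<close>

context
  fixes N :: "'a measure" and n :: nat and X :: "'v set" and q :: "'a \<Rightarrow> nat \<Rightarrow> 'v \<Rightarrow> real"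
  assumes X: "finite X"
    and q[measurable]: "\<And>t k. t \<in> {1..n} \<Longrightarrow> k \<in> X \<Longrightarrow> (\<lambda>x. q x t k) \<in> borel_measurable N"
begin

lemma aug_measurable: "t \<in> {1..n} \<Longrightarrow> j \<in> bar_ix X \<Longrightarrow> (\<lambda>x. aug (q x t) j) \<in> borel_measurable N"
  using q by (auto simp: bar_ix_def aug_def)

lemma score_measurable:
  "t \<in> {1..n} \<Longrightarrow> (\<lambda>x. score X (q x) \<psi> t) \<in> borel_measurable N"
  unfolding score_def using aug_measurable by (intro borel_measurable_sum borel_measurable_times) auto

lemma avg_measurable:
  "(\<And>t. t \<in> {1..n} \<Longrightarrow> f t \<in> borel_measurable N) \<Longrightarrow> (\<lambda>x. avg n (\<lambda>t. f t x)) \<in> borel_measurable N"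
  unfolding avg_def by (intro borel_measurable_divide borel_measurable_sum) auto

lemma norm4_measurable:
  "(\<And>t. t \<in> {1..n} \<Longrightarrow> f t \<in> borel_measurable N) \<Longrightarrow> (\<lambda>x. norm4 n (\<lambda>t. f t x)) \<in> borel_measurable N"
  unfolding norm4_def by (intro measurable_compose[OF avg_measurable borel_measurable_root] borel_measurable_power borel_measurable_abs) auto

lemma row_below_measurable: "Measurable.pred N (\<lambda>x. row_below n X \<eta> (q x) m i)"
proof -
  have le: "Measurable.pred N (\<lambda>x. f x \<le> g x)"
    if "f \<in> borel_measurable N" "g \<in> borel_measurable N" for f g :: "'a \<Rightarrow> real"
    using borel_measurable_le[OF that] by (simp add: pred_def)
  show ?thesis
    unfolding row_below_def row_feasible_def row_value_def
    by (intro pred_intros_logic(3) pred_intros_finite(3) finite_bar_ix[OF X] le borel_measurable_const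
        borel_measurable_abs borel_measurable_diff borel_measurable_add avg_measurable norm4_measurable
        measurable_compose[OF _ borel_measurable_sqrt] borel_measurable_power borel_measurable_times
        score_measurable aug_measurable)
qed

lemma near_row_measurable: "(\<lambda>x. snd (near_row n X \<eta> (q x)) j) \<in> borel_measurable N"
proof -
  note [measurable] = row_below_measurable
  have "(\<lambda>x. LEAST m. \<exists>i. row_below n X \<eta> (q x) m i) \<in> N \<rightarrow>\<^sub>M count_space UNIV"
    by (intro measurable_Least pred_intros_countable(2) row_below_measurable)
  then have "Measurable.pred N (\<lambda>x. row_below n X \<eta> (q x) (LEAST m. \<exists>i. row_below n X \<eta> (q x) m i) i)" for i
    by (rule measurable_compose_countable[where f = "\<lambda>m x. row_below n X \<eta> (q x) m i", OF row_below_measurable])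
  then have "(\<lambda>x. LEAST i. row_below n X \<eta> (q x) (LEAST m. \<exists>i. row_below n X \<eta> (q x) m i) i) \<in> N \<rightarrow>\<^sub>M count_space UNIV"
    by (rule measurable_Least)
  then show ?thesis
    unfolding near_row_def by (rule measurable_compose) simp
qed

lemma near_score_measurable:
  assumes "t \<in> {1..n}"
  shows "(\<lambda>x. score X (q x) (snd (near_row n X \<eta> (q x))) t / norm4 n (score X (q x) (snd (near_row n X \<eta> (q x))))) \<in> borel_measurable N"
proof -
  have s: "(\<lambda>x. score X (q x) (snd (near_row n X \<eta> (q x))) t) \<in> borel_measurable N" if "t \<in> {1..n}" for t
    unfolding score_def using aug_measurable[OF that] near_row_measurable
    by (intro borel_measurable_sum borel_measurable_times) auto
  show ?thesis by (intro borel_measurable_divide s assms norm4_measurable)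
qed

end

section \<open>Noise averaged with price-dependent weights\<close>

text \<open>Each weight involves the prices of all periods, so the summands are not independent. In
  a cross term for t and s all observations except that of period t are frozen; what remains is a
  bounded function of the price in period t times the noise of that period, which has mean zero by
  \<open>orth\<close>. Only the diagonal terms survive.\<close>

lemma (in prob_space) weighted_noise_second_moment:
  fixes obs :: "nat \<Rightarrow> 'a \<Rightarrow> 'p \<times> 'y" and e :: "'p \<times> 'y \<Rightarrow> real" and w :: "nat \<Rightarrow> (nat \<Rightarrow> 'p) \<Rightarrow> real"
  assumes n: "1 \<le> n" and indep: "indep_vars (\<lambda>_. MP \<Otimes>\<^sub>M MY) obs {1..n}"
    and e: "e \<in> borel_measurable (MP \<Otimes>\<^sub>M MY)"
    and fourth: "\<And>t. t \<in> {1..n} \<Longrightarrow> integrable M (\<lambda>\<omega>. e (obs t \<omega>) ^ 4)"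
      "\<And>t. t \<in> {1..n} \<Longrightarrow> expectation (\<lambda>\<omega>. e (obs t \<omega>) ^ 4) \<le> C"
    and orth: "\<And>t g b. t \<in> {1..n} \<Longrightarrow> g \<in> borel_measurable MP \<Longrightarrow> (\<And>x. \<bar>g x\<bar> \<le> b) \<Longrightarrow>
      expectation (\<lambda>\<omega>. g (fst (obs t \<omega>)) * e (obs t \<omega>)) = 0"
    and w: "\<And>t. t \<in> {1..n} \<Longrightarrow> w t \<in> borel_measurable (PiM {1..n} (\<lambda>_. MP))"
    and wb: "\<And>t q. t \<in> {1..n} \<Longrightarrow> \<bar>w t q\<bar> \<le> B"
    and w4: "\<And>q. avg n (\<lambda>t. w t q ^ 4) \<le> 1"
  defines "Q \<equiv> \<lambda>\<omega>. \<lambda>s\<in>{1..n}. fst (obs s \<omega>)"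
  shows "integrable M (\<lambda>\<omega>. (avg n (\<lambda>t. w t (Q \<omega>) * e (obs t \<omega>)))\<^sup>2)" (is ?I)
    and "expectation (\<lambda>\<omega>. (avg n (\<lambda>t. w t (Q \<omega>) * e (obs t \<omega>)))\<^sup>2) \<le> (1 + C) / real n" (is ?E)
proof -
  let ?Ob = "MP \<Otimes>\<^sub>M MY"
  define a where "a = (\<lambda>t \<omega>. w t (Q \<omega>) * e (obs t \<omega>))"
  have B: "0 \<le> B" using wb[of 1 undefined] n by (auto intro: order_trans[OF abs_ge_zero])
  have obs: "obs t \<in> M \<rightarrow>\<^sub>M ?Ob" if "t \<in> {1..n}" for t
    using indep that by (auto simp: indep_vars_def2)
  have eobs: "(\<lambda>\<omega>. e (obs t \<omega>)) \<in> borel_measurable M" if "t \<in> {1..n}" for t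
    by (rule measurable_compose[OF obs[OF that] e])
  have Q: "Q \<in> M \<rightarrow>\<^sub>M PiM {1..n} (\<lambda>_. MP)"
    unfolding Q_def by (intro measurable_restrict measurable_compose[OF obs measurable_fst])
  have am: "a t \<in> borel_measurable M" if "t \<in> {1..n}" for t
    unfolding a_def by (intro borel_measurable_times measurable_compose[OF Q w] eobs that)
  have e2: "integrable M (\<lambda>\<omega>. (e (obs t \<omega>))\<^sup>2)" "integrable M (\<lambda>\<omega>. e (obs t \<omega>))" if "t \<in> {1..n}" for t
    using fourth_moment_integrable[OF eobs[OF that] fourth(1)[OF that]] .
  have a2: "integrable M (\<lambda>\<omega>. (a t \<omega>)\<^sup>2)" if t: "t \<in> {1..n}" for t
  proof (rule Bochner_Integration.integrable_bound)
    show "integrable M (\<lambda>\<omega>. B\<^sup>2 * (e (obs t \<omega>))\<^sup>2)" using e2[OF t] by simp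
    show "AE \<omega> in M. norm ((a t \<omega>)\<^sup>2) \<le> norm (B\<^sup>2 * (e (obs t \<omega>))\<^sup>2)"
      using power_mono[OF wb[OF t], of _ 2] by (auto simp: a_def power_mult_distrib intro!: mult_right_mono AE_I2)
  qed (use am[OF t] in simp)
  have aa: "integrable M (\<lambda>\<omega>. a t \<omega> * a s \<omega>)" if "t \<in> {1..n}" "s \<in> {1..n}" for t s
  proof (rule Bochner_Integration.integrable_bound)
    show "integrable M (\<lambda>\<omega>. (a t \<omega>)\<^sup>2 + (a s \<omega>)\<^sup>2)" using a2 that by simp
    have *: "\<bar>x * y\<bar> \<le> x\<^sup>2 + y\<^sup>2" for x y :: real
    proof -
      have "2 * (\<bar>x\<bar> * \<bar>y\<bar>) \<le> x\<^sup>2 + y\<^sup>2" using sum_squares_bound[of "\<bar>x\<bar>" "\<bar>y\<bar>"] by simp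
      moreover have "0 \<le> \<bar>x\<bar> * \<bar>y\<bar>" by simp
      ultimately show ?thesis unfolding abs_mult by linarith
    qed
    show "AE \<omega> in M. norm (a t \<omega> * a s \<omega>) \<le> norm ((a t \<omega>)\<^sup>2 + (a s \<omega>)\<^sup>2)"
      unfolding real_norm_def by (intro AE_I2 order_trans[OF * abs_ge_self])
  qed (use am that in simp)
  have cross: "expectation (\<lambda>\<omega>. a t \<omega> * a s \<omega>) = 0" if t: "t \<in> {1..n}" and s: "s \<in> {1..n}" and "t \<noteq> s" for t s
  proof -
    let ?J = "{1..n} - {t}"
    have sJ: "s \<in> ?J" using s \<open>t \<noteq> s\<close> by simp
    define S where "S = PiM {t} (\<lambda>_. ?Ob)"
    define T where "T = PiM ?J (\<lambda>_. ?Ob)"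
    define X where "X = (\<lambda>\<omega>. restrict (\<lambda>i. obs i \<omega>) {t})"
    define Y where "Y = (\<lambda>\<omega>. restrict (\<lambda>i. obs i \<omega>) ?J)"
    have iv: "indep_var S X T Y"
      unfolding S_def T_def X_def Y_def using t by (intro indep_var_restrict[OF indep]) auto
    have X: "X \<in> M \<rightarrow>\<^sub>M S" and Y: "Y \<in> M \<rightarrow>\<^sub>M T"
      and XY: "distr M S X \<Otimes>\<^sub>M distr M T Y = distr M (S \<Otimes>\<^sub>M T) (\<lambda>\<omega>. (X \<omega>, Y \<omega>))"
      using iv[unfolded indep_var_distribution_eq] by blast+
    define q :: "'p \<Rightarrow> (nat \<Rightarrow> 'p \<times> 'y) \<Rightarrow> nat \<Rightarrow> 'p" where "q = (\<lambda>p y. \<lambda>i\<in>{1..n}. if i = t then p else fst (y i))"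
    have qm: "(\<lambda>z. q (fst z) (snd z)) \<in> MP \<Otimes>\<^sub>M T \<rightarrow>\<^sub>M PiM {1..n} (\<lambda>_. MP)"
      unfolding q_def
    proof (intro measurable_restrict)
      fix i assume i: "i \<in> {1..n}"
      show "(\<lambda>z. if i = t then fst z else fst (snd z i)) \<in> MP \<Otimes>\<^sub>M T \<rightarrow>\<^sub>M MP"
      proof (cases "i = t")
        case False
        then have "(\<lambda>y. y i) \<in> T \<rightarrow>\<^sub>M ?Ob" unfolding T_def using i by (intro measurable_component_singleton) auto
        then have "(\<lambda>z. fst (snd z i)) \<in> MP \<Otimes>\<^sub>M T \<rightarrow>\<^sub>M MP"
          by (intro measurable_compose[OF measurable_snd measurable_compose[OF _ measurable_fst]])
        then show ?thesis using False by simp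
      qed simp
    qed
    define h :: "(nat \<Rightarrow> 'p \<times> 'y) \<Rightarrow> (nat \<Rightarrow> 'p \<times> 'y) \<Rightarrow> real" where "h = (\<lambda>x y. (w t (q (fst (x t)) y) * e (x t)) * (w s (q (fst (x t)) y) * e (y s)))"
    have xt: "(\<lambda>x. x t) \<in> S \<rightarrow>\<^sub>M ?Ob" unfolding S_def by (intro measurable_component_singleton) simp
    have ys: "(\<lambda>y. y s) \<in> T \<rightarrow>\<^sub>M ?Ob" unfolding T_def by (intro measurable_component_singleton sJ)
    have map: "(\<lambda>z. (fst (fst z t), snd z)) \<in> S \<Otimes>\<^sub>M T \<rightarrow>\<^sub>M MP \<Otimes>\<^sub>M T"
      by (intro measurable_Pair measurable_snd measurable_compose[OF measurable_fst measurable_compose[OF xt measurable_fst]])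
    have wq: "(\<lambda>z. w i (q (fst (fst z t)) (snd z))) \<in> borel_measurable (S \<Otimes>\<^sub>M T)" if "i \<in> {1..n}" for i
      using measurable_compose[OF map measurable_compose[OF qm w[OF that]]] by simp
    have hm: "case_prod h \<in> borel_measurable (S \<Otimes>\<^sub>M T)"
      unfolding h_def case_prod_beta
      by (intro borel_measurable_times wq t s measurable_compose[OF measurable_fst measurable_compose[OF xt e]]
          measurable_compose[OF measurable_snd measurable_compose[OF ys e]])
    have h_eq: "a t \<omega> * a s \<omega> = h (X \<omega>) (Y \<omega>)" for \<omega>
    proof -
      have "q (fst (X \<omega> t)) (Y \<omega>) = Q \<omega>"
        by (auto simp: q_def Q_def X_def Y_def fun_eq_iff)
      then show ?thesis using sJ by (simp add: h_def a_def X_def Y_def)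
    qed
    interpret X: prob_space "distr M S X" by (rule prob_space_distr[OF X])
    interpret Y: prob_space "distr M T Y" by (rule prob_space_distr[OF Y])
    interpret XY: pair_sigma_finite "distr M S X" "distr M T Y" ..
    have int: "integrable (distr M S X \<Otimes>\<^sub>M distr M T Y) (case_prod h)"
      unfolding XY using hm aa[OF t s] X Y by (subst integrable_distr_eq) (auto simp: h_eq)
    have "expectation (\<lambda>\<omega>. a t \<omega> * a s \<omega>) = (\<integral>z. case_prod h z \<partial>(distr M S X \<Otimes>\<^sub>M distr M T Y))"
      unfolding XY using hm X Y by (subst integral_distr) (auto simp: h_eq)
    also have "\<dots> = (\<integral>y. (\<integral>x. h x y \<partial>distr M S X) \<partial>distr M T Y)"
      by (rule XY.integral_snd[OF int, symmetric])
    also have "\<dots> = (\<integral>y. 0 \<partial>distr M T Y)"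
    proof (rule Bochner_Integration.integral_cong)
      fix y assume "y \<in> space (distr M T Y)"
      then have y: "y \<in> space T" by simp
      define g where "g = (\<lambda>p. w t (q p y) * w s (q p y))"
      have "(\<lambda>p. (p, y)) \<in> MP \<rightarrow>\<^sub>M MP \<Otimes>\<^sub>M T" using y by simp
      from measurable_compose[OF this qm] have "(\<lambda>p. q p y) \<in> MP \<rightarrow>\<^sub>M PiM {1..n} (\<lambda>_. MP)" by simp
      then have g: "g \<in> borel_measurable MP"
        unfolding g_def by (intro borel_measurable_times measurable_compose[OF _ w] t s)
      have gb: "\<bar>g p\<bar> \<le> B * B" for p
        unfolding g_def abs_mult using wb t s B by (intro mult_mono) auto
      have hy: "(\<lambda>x. h x y) \<in> borel_measurable S"
        using measurable_compose[OF measurable_Pair2'[OF y] hm] by simp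
      have "(\<integral>x. h x y \<partial>distr M S X) = expectation (\<lambda>\<omega>. h (X \<omega>) y)"
        by (rule integral_distr[OF X hy])
      also have "\<dots> = expectation (\<lambda>\<omega>. e (y s) * (g (fst (obs t \<omega>)) * e (obs t \<omega>)))"
        by (intro Bochner_Integration.integral_cong) (auto simp: h_def g_def X_def mult_ac)
      also have "\<dots> = 0" using orth[OF t g gb] by simp
      finally show "(\<integral>x. h x y \<partial>distr M S X) = 0" .
    qed simp
    finally show ?thesis by simp
  qed
  have sq: "(avg n (\<lambda>t. w t (Q \<omega>) * e (obs t \<omega>)))\<^sup>2 = (\<Sum>t=1..n. \<Sum>s=1..n. a t \<omega> * a s \<omega>) / (real n)\<^sup>2" for \<omega>
    by (simp add: avg_def a_def power2_eq_square sum_product)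
  show ?I unfolding sq using aa by (intro integrable_divide Bochner_Integration.integrable_sum) auto
  have "expectation (\<lambda>\<omega>. \<Sum>t=1..n. \<Sum>s=1..n. a t \<omega> * a s \<omega>) = (\<Sum>t=1..n. \<Sum>s=1..n. expectation (\<lambda>\<omega>. a t \<omega> * a s \<omega>))"
    using aa by (subst Bochner_Integration.integral_sum, force, intro sum.cong refl Bochner_Integration.integral_sum, force)
  also have "\<dots> = (\<Sum>t=1..n. \<Sum>s=1..n. if s = t then expectation (\<lambda>\<omega>. (a t \<omega>)\<^sup>2) else 0)"
    using cross by (intro sum.cong refl) (auto simp: power2_eq_square)
  also have "\<dots> = expectation (\<lambda>\<omega>. \<Sum>t=1..n. (a t \<omega>)\<^sup>2)"
    using a2 by (subst Bochner_Integration.integral_sum) auto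
  also have "\<dots> \<le> expectation (\<lambda>\<omega>. real n + (\<Sum>t=1..n. e (obs t \<omega>) ^ 4))"
  proof (rule integral_mono)
    show "integrable M (\<lambda>\<omega>. \<Sum>t=1..n. (a t \<omega>)\<^sup>2)" using a2 by (intro Bochner_Integration.integrable_sum) auto
    show "integrable M (\<lambda>\<omega>. real n + (\<Sum>t=1..n. e (obs t \<omega>) ^ 4))"
      using fourth by (intro Bochner_Integration.integrable_add Bochner_Integration.integrable_sum) auto
    fix \<omega>
    \<comment> \<open>Young's inequality for w^2 e^2 uses the fourth-power normalization of the
      weights. The pointwise bound \<open>B\<close> secures integrability and does not enter the
      constant, so it may grow with n.\<close>
    have "(\<Sum>t=1..n. (a t \<omega>)\<^sup>2) \<le> (\<Sum>t=1..n. w t (Q \<omega>) ^ 4 + e (obs t \<omega>) ^ 4)"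
    proof (rule sum_mono)
      fix t
      have "2 * ((w t (Q \<omega>))\<^sup>2 * (e (obs t \<omega>))\<^sup>2) \<le> ((w t (Q \<omega>))\<^sup>2)\<^sup>2 + ((e (obs t \<omega>))\<^sup>2)\<^sup>2"
        using sum_squares_bound[of "(w t (Q \<omega>))\<^sup>2" "(e (obs t \<omega>))\<^sup>2"] by simp
      moreover have "0 \<le> (w t (Q \<omega>))\<^sup>2 * (e (obs t \<omega>))\<^sup>2" by simp
      ultimately have "(w t (Q \<omega>))\<^sup>2 * (e (obs t \<omega>))\<^sup>2 \<le> ((w t (Q \<omega>))\<^sup>2)\<^sup>2 + ((e (obs t \<omega>))\<^sup>2)\<^sup>2" by linarith
      then show "(a t \<omega>)\<^sup>2 \<le> w t (Q \<omega>) ^ 4 + e (obs t \<omega>) ^ 4" by (simp add: a_def power_mult_distrib)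
    qed
    also have "\<dots> \<le> real n + (\<Sum>t=1..n. e (obs t \<omega>) ^ 4)"
      using w4[of "Q \<omega>"] n by (simp add: sum.distrib avg_def divide_le_eq)
    finally show "(\<Sum>t=1..n. (a t \<omega>)\<^sup>2) \<le> real n + (\<Sum>t=1..n. e (obs t \<omega>) ^ 4)" .
  qed
  also have "\<dots> = real n + (\<Sum>t=1..n. expectation (\<lambda>\<omega>. e (obs t \<omega>) ^ 4))"
    using fourth by (subst Bochner_Integration.integral_add) (auto simp: prob_space intro!: Bochner_Integration.integral_sum)
  also have "\<dots> \<le> real n + (\<Sum>t=1..n. C)"
    using fourth by (intro add_left_mono sum_mono) auto
  finally have "expectation (\<lambda>\<omega>. \<Sum>t=1..n. \<Sum>s=1..n. a t \<omega> * a s \<omega>) \<le> real n * (1 + C)" by (simp add: algebra_simps)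
  then have "expectation (\<lambda>\<omega>. \<Sum>t=1..n. \<Sum>s=1..n. a t \<omega> * a s \<omega>) / (real n)\<^sup>2 \<le> real n * (1 + C) / (real n)\<^sup>2"
    by (rule divide_right_mono) simp
  then show ?E unfolding sq using n by (simp add: power2_eq_square)
qed

section \<open>The debiased intercept\<close>

lemma tau_bounds: "0 < tau n X p" "tau n X p \<le> 1 / 4"
proof -
  have "1 \<le> M_n n X p" unfolding M_n_def by (subst real_sqrt_ge_1_iff) simp
  then show "0 < tau n X p" "tau n X p \<le> 1 / 4" unfolding tau_def by (auto simp: field_simps)
qed

lemma sum_bar_ix: "finite X \<Longrightarrow> (\<Sum>i\<in>bar_ix X. f i) = f None + (\<Sum>j\<in>X. f (Some j))"
  unfolding bar_ix_def by (subst sum.insert) (auto simp: sum.reindex)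

text \<open>The first program decouples over the rows as well: row \<open>k\<close> of a minimizer
  is compared with a given row that is feasible at level \<open>K\<close>. The factor 1/4 is the
  upper bound for \<open>tau\<close>.\<close>

lemma step1_row_bound:
  fixes W :: "'v \<Rightarrow> 'v \<Rightarrow> real" and v :: "'v \<Rightarrow> real"
  assumes X: "finite X" and k: "k \<in> X" and K: "0 \<le> K"
    and feas: "\<And>j. j \<in> bar_ix X \<Longrightarrow> \<bar>avg n (\<lambda>t. resid X p y W v t k * aug (p t) j)\<bar> \<le> lam n X * K"
      "\<And>j. j \<in> bar_ix X \<Longrightarrow> sqrt (avg n (\<lambda>t. (resid X p y W v t k)\<^sup>2 * (aug (p t) j)\<^sup>2)) \<le> K"
    and sol: "step1_solution n X p y Wh vh"
  shows "\<bar>vh k\<bar> + (\<Sum>j\<in>X. \<bar>Wh k j\<bar>) \<le> \<bar>v k\<bar> + (\<Sum>j\<in>X. \<bar>W k j\<bar>) + K / 4"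
proof -
  obtain z where am: "is_arg_min (step1_objective n X p) (step1_feasible n X p y) (Wh, vh, z)"
    using sol unfolding step1_solution_def by blast
  then have f: "step1_feasible n X p y (Wh, vh, z)" by (simp add: is_arg_min_def)
  define W' v' z' where "W' = Wh(k := W k)" and "v' = vh(k := v k)" and "z' = z(k := K)"
  have r: "resid X p y W' v' t i = (if i = k then resid X p y W v t k else resid X p y Wh vh t i)" for t i
    by (auto simp: resid_def W'_def v'_def mv_on_def)
  have "step1_feasible n X p y (W', v', z')"
    using f feas unfolding step1_feasible_def prod.case r by (auto simp: z'_def)
  then have "step1_objective n X p (Wh, vh, z) \<le> step1_objective n X p (W', v', z')"
    using am unfolding is_arg_min_def by (meson not_le)
  then have "(\<bar>vh k\<bar> + (\<Sum>j\<in>X. \<bar>Wh k j\<bar>)) + tau n X p * z k + (\<Sum>i\<in>X - {k}. (\<bar>vh i\<bar> + (\<Sum>j\<in>X. \<bar>Wh i j\<bar>)) + tau n X p * z i)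
      \<le> (\<bar>v k\<bar> + (\<Sum>j\<in>X. \<bar>W k j\<bar>)) + tau n X p * K + (\<Sum>i\<in>X - {k}. (\<bar>v' i\<bar> + (\<Sum>j\<in>X. \<bar>W' i j\<bar>)) + tau n X p * z' i)"
    unfolding step1_objective_def prod.case sum.remove[OF X k] by (simp add: W'_def v'_def z'_def)
  also have "(\<Sum>i\<in>X - {k}. (\<bar>v' i\<bar> + (\<Sum>j\<in>X. \<bar>W' i j\<bar>)) + tau n X p * z' i) = (\<Sum>i\<in>X - {k}. (\<bar>vh i\<bar> + (\<Sum>j\<in>X. \<bar>Wh i j\<bar>)) + tau n X p * z i)"
    by (intro sum.cong) (auto simp: W'_def v'_def z'_def)
  finally have le: "\<bar>vh k\<bar> + (\<Sum>j\<in>X. \<bar>Wh k j\<bar>) + tau n X p * z k \<le> \<bar>v k\<bar> + (\<Sum>j\<in>X. \<bar>W k j\<bar>) + tau n X p * K" by simp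
  have "sqrt (avg n (\<lambda>t. (resid X p y Wh vh t k)\<^sup>2 * (aug (p t) None)\<^sup>2)) \<le> z k"
    using f k None_bar_ix[of X] unfolding step1_feasible_def by auto
  moreover have "0 \<le> sqrt (avg n (\<lambda>t. (resid X p y Wh vh t k)\<^sup>2 * (aug (p t) None)\<^sup>2))"
    by (intro real_sqrt_ge_zero avg_nonneg) auto
  ultimately have "0 \<le> z k" by linarith
  then have "0 \<le> tau n X p * z k" using tau_bounds(1)[of n X p] by simp
  moreover have "tau n X p * K \<le> K / 4" using mult_right_mono[OF tau_bounds(2)[of n X p] K] by simp
  ultimately show ?thesis using le by linarith
qed

text \<open>Debiasing multiplies the first-stage error by the deviation of the relaxed inverse from
  the unit row, which the constraints bound by \<open>lam * z\<close> in each entry. Pairing with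
  the \<open>l\<^sub>1\<close>-norm of the first-stage error gives the first term; the second is the
  noise seen through the scores.\<close>

lemma v_check_error:
  fixes W :: "'v \<Rightarrow> 'v \<Rightarrow> real" and v :: "'v \<Rightarrow> real"
  assumes X: "finite X"
    and data: "\<And>t. t \<in> {1..n} \<Longrightarrow> y t k = v k - mv_on X W (p t) k + \<epsilon> t"
    and row: "row_feasible n X p z (\<Psi> None)"
  shows "\<bar>v_check n X p y Wh vh \<Psi> k - v k\<bar> \<le>
    (\<bar>vh k - v k\<bar> + (\<Sum>j\<in>X. \<bar>Wh k j - W k j\<bar>)) * (lam n X * z) + \<bar>avg n (\<lambda>t. score X p (\<Psi> None) t * \<epsilon> t)\<bar>"
proof -
  define \<Delta> where "\<Delta> = case_option (v k - vh k) (\<lambda>j. Wh k j - W k j)"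
  let ?s = "score X p (\<Psi> None)"
  have res: "resid X p y Wh vh t k = (\<Sum>i\<in>bar_ix X. \<Delta> i * aug (p t) i) + \<epsilon> t" if "t \<in> {1..n}" for t
    using data[OF that] by (simp add: resid_def sum_bar_ix[OF X] \<Delta>_def aug_def mv_on_def left_diff_distrib sum_subtractf)
  have "mm_on (bar_ix X) \<Psi> (\<lambda>j k. avg n (\<lambda>t. aug (p t) j * resid X p y Wh vh t k)) None k
      = avg n (\<lambda>t. ?s t * resid X p y Wh vh t k)"
    unfolding mm_on_def score_def sum_distrib_right mult.assoc avg_sum avg_cmult ..
  also have "\<dots> = avg n (\<lambda>t. (\<Sum>i\<in>bar_ix X. \<Delta> i * (?s t * aug (p t) i)) + ?s t * \<epsilon> t)"
    by (intro avg_cong) (simp add: res distrib_left sum_distrib_left mult_ac)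
  also have "\<dots> = (\<Sum>i\<in>bar_ix X. \<Delta> i * avg n (\<lambda>t. ?s t * aug (p t) i)) + avg n (\<lambda>t. ?s t * \<epsilon> t)"
    unfolding avg_add avg_sum avg_cmult ..
  finally have mm: "mm_on (bar_ix X) \<Psi> (\<lambda>j k. avg n (\<lambda>t. aug (p t) j * resid X p y Wh vh t k)) None k
     = (\<Sum>i\<in>bar_ix X. \<Delta> i * avg n (\<lambda>t. ?s t * aug (p t) i)) + avg n (\<lambda>t. ?s t * \<epsilon> t)" .
  have "(\<Sum>i\<in>bar_ix X. \<Delta> i * of_bool (None = i)) = v k - vh k"
    by (simp add: sum_bar_ix[OF X] \<Delta>_def)
  then have "v_check n X p y Wh vh \<Psi> k - v k
      = (\<Sum>i\<in>bar_ix X. \<Delta> i * (avg n (\<lambda>t. ?s t * aug (p t) i) - of_bool (None = i))) + avg n (\<lambda>t. ?s t * \<epsilon> t)"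
    unfolding v_check_def debiased_def mm by (simp add: stack_def right_diff_distrib sum_subtractf)
  also have "\<bar>\<dots>\<bar> \<le> \<bar>\<Sum>i\<in>bar_ix X. \<Delta> i * (avg n (\<lambda>t. ?s t * aug (p t) i) - of_bool (None = i))\<bar> + \<bar>avg n (\<lambda>t. ?s t * \<epsilon> t)\<bar>"
    by (rule abs_triangle_ineq)
  also have "\<bar>\<Sum>i\<in>bar_ix X. \<Delta> i * (avg n (\<lambda>t. ?s t * aug (p t) i) - of_bool (None = i))\<bar> \<le> (\<Sum>i\<in>bar_ix X. \<bar>\<Delta> i\<bar> * (lam n X * z))"
    using row unfolding row_feasible_def
    by (intro sum_abs[THEN order_trans] sum_mono) (auto simp: abs_mult intro!: mult_left_mono)
  also have "\<dots> = (\<bar>vh k - v k\<bar> + (\<Sum>j\<in>X. \<bar>Wh k j - W k j\<bar>)) * (lam n X * z)"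
    unfolding sum_distrib_right[symmetric] sum_bar_ix[OF X] by (simp add: \<Delta>_def abs_minus_commute)
  finally show ?thesis by simp
qed

text \<open>The normalized score vector differs from \<open>w\<close> by some \<open>d\<close> whose
  mean square is at most 1/n, so Cauchy-Schwarz makes its contribution negligible. The noise average
  is thus shifted to the weights \<open>w\<close>, which will depend on the prices only.\<close>

lemma score_noise_bound:
  fixes u w :: "nat \<Rightarrow> real" and \<epsilon> :: "nat \<Rightarrow> real"
  assumes n: "1 \<le> n" and a: "0 < norm4 n u" "norm4 n u \<le> F"
    and close: "norm4 n (\<lambda>t. u t / norm4 n u - w t) ^ 4 \<le> 1 / (real n)\<^sup>2"
    and \<epsilon>: "avg n (\<lambda>t. (\<epsilon> t)\<^sup>2) \<le> K" and K: "0 \<le> K"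
  shows "(avg n (\<lambda>t. u t * \<epsilon> t))\<^sup>2 \<le> F\<^sup>2 * (2 * (avg n (\<lambda>t. w t * \<epsilon> t))\<^sup>2 + 2 * K / real n)"
proof -
  define a where "a = norm4 n u"
  define d where "d = (\<lambda>t. u t / a - w t)"
  have a0: "0 < a" using assms by (simp add: a_def)
  have "(norm4 n d ^ 2) ^ 2 \<le> (1 / real n) ^ 2"
    using close by (simp add: d_def a_def power_divide)
  then have "norm4 n d ^ 2 \<le> 1 / real n" by (rule power2_le_imp_le) simp
  then have d2: "avg n (\<lambda>t. (d t)\<^sup>2) \<le> 1 / real n" using avg_square_le_norm4[OF n, of d] by linarith
  have "(avg n (\<lambda>t. d t * \<epsilon> t))\<^sup>2 \<le> avg n (\<lambda>t. (d t)\<^sup>2) * avg n (\<lambda>t. (\<epsilon> t)\<^sup>2)" by (rule avg_Cauchy_Schwarz)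
  also have "\<dots> \<le> 1 / real n * K"
    using d2 \<epsilon> by (intro mult_mono avg_nonneg) auto
  finally have de: "(avg n (\<lambda>t. d t * \<epsilon> t))\<^sup>2 \<le> K / real n" by simp
  have "avg n (\<lambda>t. u t * \<epsilon> t) = avg n (\<lambda>t. a * (w t * \<epsilon> t + d t * \<epsilon> t))"
    using a0 by (intro avg_cong) (simp add: d_def field_simps)
  also have "\<dots> = a * (avg n (\<lambda>t. w t * \<epsilon> t) + avg n (\<lambda>t. d t * \<epsilon> t))" unfolding avg_cmult avg_add ..
  finally have "(avg n (\<lambda>t. u t * \<epsilon> t))\<^sup>2 = a\<^sup>2 * (avg n (\<lambda>t. w t * \<epsilon> t) + avg n (\<lambda>t. d t * \<epsilon> t))\<^sup>2"
    by (simp add: power_mult_distrib)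
  also have "\<dots> \<le> F\<^sup>2 * (2 * (avg n (\<lambda>t. w t * \<epsilon> t))\<^sup>2 + 2 * K / real n)"
  proof (rule mult_mono)
    show "a\<^sup>2 \<le> F\<^sup>2" using assms(3) a0 by (intro power_mono) (auto simp: a_def)
    have "(x + y)\<^sup>2 \<le> 2 * x\<^sup>2 + 2 * y\<^sup>2" for x y :: real
      using sum_squares_bound[of x y] by (simp add: power2_sum)
    from this[of "avg n (\<lambda>t. w t * \<epsilon> t)" "avg n (\<lambda>t. d t * \<epsilon> t)"]
    show "(avg n (\<lambda>t. w t * \<epsilon> t) + avg n (\<lambda>t. d t * \<epsilon> t))\<^sup>2 \<le> 2 * (avg n (\<lambda>t. w t * \<epsilon> t))\<^sup>2 + 2 * K / real n"
      using de by linarith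
  qed auto
  finally show ?thesis .
qed

text \<open>The mesh \<eta> is chosen so that the selected row, minimal up to 2 \<eta>, satisfies 64
  (2 \<eta>) = 1 / n^2 in the comparison of directions.\<close>

definition near_weight :: "nat \<Rightarrow> 'v set \<Rightarrow> (nat \<Rightarrow> 'v \<Rightarrow> real) \<Rightarrow> nat \<Rightarrow> real" where
  "near_weight n X p t = score X p (snd (near_row n X (1 / (128 * (real n)\<^sup>2)) p)) t /
     norm4 n (score X p (snd (near_row n X (1 / (128 * (real n)\<^sup>2)) p)))"

text \<open>The deterministic part: one constant \<open>K\<close> bounds all empirical averages. The
  true parameters are feasible in the first program, which bounds the first-stage error by
  \<open>2 * B + K\<close>; the population row is feasible in the second, which bounds
  \<open>z\<close> and the norm of the scores by \<open>2 * K\<close>.\<close>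

lemma v_check_total_error:
  fixes W :: "'v \<Rightarrow> 'v \<Rightarrow> real" and v :: "'v \<Rightarrow> real" and \<epsilon> :: "nat \<Rightarrow> 'v \<Rightarrow> real"
  assumes X: "finite X" and n: "1 \<le> n" and K: "1 \<le> K"
    and \<rho>: "0 < \<rho>" "1 / real n \<le> \<rho>\<^sup>2" "\<rho> \<le> lam n X" "lam n X \<le> \<Lambda> * \<rho>"
    and small: "lam n X * (2 * K + 1) \<le> 1 / 2"
    and data: "\<And>t k. t \<in> {1..n} \<Longrightarrow> k \<in> X \<Longrightarrow> y t k = v k - mv_on X W (p t) k + \<epsilon> t k"
    and truth: "\<And>k. k \<in> X \<Longrightarrow> \<bar>v k\<bar> + (\<Sum>j\<in>X. \<bar>W k j\<bar>) \<le> B"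
    and noise: "\<And>k j. k \<in> X \<Longrightarrow> j \<in> bar_ix X \<Longrightarrow> \<bar>avg n (\<lambda>t. \<epsilon> t k * aug (p t) j)\<bar> \<le> K * \<rho>"
      "\<And>k j. k \<in> X \<Longrightarrow> j \<in> bar_ix X \<Longrightarrow> avg n (\<lambda>t. (\<epsilon> t k * aug (p t) j)\<^sup>2) \<le> K"
    and psi: "\<And>j. j \<in> bar_ix X \<Longrightarrow> \<bar>avg n (\<lambda>t. score X p \<psi> t * aug (p t) j - of_bool (None = j))\<bar> \<le> K * \<rho>"
      "\<And>j. j \<in> bar_ix X \<Longrightarrow> avg n (\<lambda>t. (score X p \<psi> t * aug (p t) j - of_bool (None = j))\<^sup>2) \<le> K"
      "avg n (\<lambda>t. score X p \<psi> t ^ 4) \<le> K"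
    and weighted: "(\<Sum>k\<in>X. (avg n (\<lambda>t. near_weight n X p t * \<epsilon> t k))\<^sup>2) \<le> real (card X) * (T * \<rho>\<^sup>2)"
    and sol1: "step1_solution n X p y Wh vh" and sol2: "step2_solution n X p \<Psi>"
  shows "(\<Sum>k\<in>X. (v_check n X p y Wh vh \<Psi> k - v k)\<^sup>2) \<le>
    real (card X) * ((2 * ((2 * B + K) * (\<Lambda> * (2 * K)))\<^sup>2 + 2 * (2 * K)\<^sup>2 * (2 * T + 2 * K)) * \<rho>\<^sup>2)"
proof -
  have lam0: "0 < lam n X" using \<rho> by simp
  \<comment> \<open>\<open>1 \<le> K\<close> lets the same constant bound second moments and their
    square roots.\<close>
  have sqrtK: "sqrt x \<le> K" if "x \<le> K" for x
  proof -
    have "K \<le> K\<^sup>2" using K by (simp add: self_le_power)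
    then show ?thesis using that K by (intro real_le_lsqrt) auto
  qed
  have l1: "K * \<rho> \<le> lam n X * K" using \<rho> K by (simp add: mult.commute)
  have step1: "\<bar>vh k - v k\<bar> + (\<Sum>j\<in>X. \<bar>Wh k j - W k j\<bar>) \<le> 2 * B + K" if k: "k \<in> X" for k
  proof -
    have res: "resid X p y W v t k = \<epsilon> t k" if "t \<in> {1..n}" for t using data[OF that k] by (simp add: resid_def)
    have "\<bar>vh k\<bar> + (\<Sum>j\<in>X. \<bar>Wh k j\<bar>) \<le> \<bar>v k\<bar> + (\<Sum>j\<in>X. \<bar>W k j\<bar>) + K / 4"
    proof (rule step1_row_bound[OF X k _ _ _ sol1])
      show "0 \<le> K" using K by simp
      fix j assume j: "j \<in> bar_ix X"
      have "avg n (\<lambda>t. resid X p y W v t k * aug (p t) j) = avg n (\<lambda>t. \<epsilon> t k * aug (p t) j)"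
        by (intro avg_cong) (simp add: res)
      then show "\<bar>avg n (\<lambda>t. resid X p y W v t k * aug (p t) j)\<bar> \<le> lam n X * K" using noise(1)[OF k j] l1 by linarith
      have "avg n (\<lambda>t. (resid X p y W v t k)\<^sup>2 * (aug (p t) j)\<^sup>2) = avg n (\<lambda>t. (\<epsilon> t k * aug (p t) j)\<^sup>2)"
        by (intro avg_cong) (simp add: res power_mult_distrib)
      then show "sqrt (avg n (\<lambda>t. (resid X p y W v t k)\<^sup>2 * (aug (p t) j)\<^sup>2)) \<le> K" using noise(2)[OF k j] sqrtK by simp
    qed
    moreover have "\<bar>vh k - v k\<bar> \<le> \<bar>vh k\<bar> + \<bar>v k\<bar>" by (rule abs_triangle_ineq4)
    moreover have "(\<Sum>j\<in>X. \<bar>Wh k j - W k j\<bar>) \<le> (\<Sum>j\<in>X. \<bar>Wh k j\<bar>) + (\<Sum>j\<in>X. \<bar>W k j\<bar>)"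
      unfolding sum.distrib[symmetric] by (intro sum_mono abs_triangle_ineq4)
    ultimately show ?thesis using truth[OF k] K by simp
  qed
  obtain z where z: "row_feasible n X p z (\<Psi> None)"
    and min: "\<And>z' \<phi>. row_feasible n X p z' \<phi> \<Longrightarrow> norm4 n (score X p (\<Psi> None)) + z \<le> norm4 n (score X p \<phi>) + z'"
    using step2_row[OF X sol2] by blast
  let ?u = "score X p (\<Psi> None)"
  \<comment> \<open>A competitor that does not depend on the estimators; its value is at most
    \<open>2 * K\<close> and so bounds the minimal one.\<close>
  have "row_feasible n X p K \<psi>"
    unfolding row_feasible_def
  proof (intro ballI conjI)
    fix j assume j: "j \<in> bar_ix X"
    have "avg n (\<lambda>t. score X p \<psi> t * aug (p t) j - of_bool (None = j)) = avg n (\<lambda>t. score X p \<psi> t * aug (p t) j) - of_bool (None = j)"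
      unfolding avg_diff avg_const[OF n] ..
    then show "\<bar>avg n (\<lambda>t. score X p \<psi> t * aug (p t) j) - of_bool (None = j)\<bar> \<le> lam n X * K"
      using psi(1)[OF j] l1 by simp
    show "sqrt (avg n (\<lambda>t. (score X p \<psi> t * aug (p t) j - of_bool (None = j))\<^sup>2)) \<le> K"
      by (rule sqrtK[OF psi(2)[OF j]])
  qed
  from min[OF this] have obj: "norm4 n ?u + z \<le> 2 * K"
  proof -
    have "norm4 n (score X p \<psi>) \<le> K"
      unfolding norm4_le_iff[OF order_trans[OF zero_le_one K]] using psi(3) K self_le_power[of K 4] by simp
    then show ?thesis using min[OF \<open>row_feasible n X p K \<psi>\<close>] by simp
  qed
  have z0: "0 \<le> z" by (rule row_feasible_nonneg[OF z])
  define \<eta> where "\<eta> = 1 / (128 * (real n)\<^sup>2)"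
  have \<eta>: "0 < \<eta>" "2 * \<eta> \<le> 1" "64 * (2 * \<eta>) = 1 / (real n)\<^sup>2"
  proof -
    have "1 \<le> (real n)\<^sup>2" "0 < n" using n by simp_all
    then show "0 < \<eta>" "64 * (2 * \<eta>) = 1 / (real n)\<^sup>2" by (simp_all add: \<eta>_def)
    have "\<eta> \<le> 1 / 2"
      unfolding \<eta>_def using \<open>1 \<le> (real n)\<^sup>2\<close> by (intro divide_left_mono) linarith+
    then show "2 * \<eta> \<le> 1" by simp
  qed
  note near = near_row_near_minimal[OF X lam0 z \<eta>(1)]
  have sm: "lam n X * (norm4 n ?u + z + 1) \<le> 1 / 2"
    using obj lam0 by (intro order_trans[OF mult_left_mono small]) auto
  have "norm4 n (\<lambda>t. ?u t / norm4 n ?u - near_weight n X p t) ^ 4 \<le> 64 * (2 * \<eta>)"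
    unfolding near_weight_def \<eta>_def[symmetric]
    by (rule near_minimizers_close[OF n less_imp_le[OF lam0] z min near]) (use \<eta> sm in auto)
  then have close: "norm4 n (\<lambda>t. ?u t / norm4 n ?u - near_weight n X p t) ^ 4 \<le> 1 / (real n)\<^sup>2" using \<eta>(3) by simp
  have "lam n X * z \<le> lam n X * (norm4 n ?u + z + 1)"
    using lam0 norm4_nonneg[of n ?u] by (intro mult_left_mono) auto
  then have u_pos: "0 < norm4 n ?u" using row_score_lower[OF n z] sm by simp
  have u_le: "norm4 n ?u \<le> 2 * K" and z_le: "z \<le> 2 * K" using obj z0 norm4_nonneg[of n ?u] by linarith+
  have each: "(v_check n X p y Wh vh \<Psi> k - v k)\<^sup>2 \<le> 2 * ((2 * B + K) * (\<Lambda> * (2 * K)))\<^sup>2 * \<rho>\<^sup>2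
      + 2 * ((2 * K)\<^sup>2 * (2 * (avg n (\<lambda>t. near_weight n X p t * \<epsilon> t k))\<^sup>2 + 2 * K / real n))" if k: "k \<in> X" for k
  proof -
    let ?s = "\<bar>vh k - v k\<bar> + (\<Sum>j\<in>X. \<bar>Wh k j - W k j\<bar>)" and ?a = "avg n (\<lambda>t. ?u t * \<epsilon> t k)"
    have s0: "0 \<le> ?s" by (intro add_nonneg_nonneg sum_nonneg) auto
    have lz: "0 \<le> lam n X * z" "lam n X * z \<le> \<Lambda> * \<rho> * (2 * K)"
      using lam0 z0 z_le \<rho> by (auto intro!: mult_mono)
    have "\<bar>v_check n X p y Wh vh \<Psi> k - v k\<bar> \<le> ?s * (lam n X * z) + \<bar>?a\<bar>"
      by (rule v_check_error[where \<epsilon> = "\<lambda>t. \<epsilon> t k" and \<Psi> = \<Psi>]) (use X data k z in auto)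
    from power_mono[OF this abs_ge_zero, of 2]
    have "(v_check n X p y Wh vh \<Psi> k - v k)\<^sup>2 \<le> (?s * (lam n X * z) + \<bar>?a\<bar>)\<^sup>2"
      by (simp only: power2_abs)
    also have "\<dots> \<le> 2 * (?s * (lam n X * z))\<^sup>2 + 2 * ?a\<^sup>2"
      using sum_squares_bound[of "?s * (lam n X * z)" "\<bar>?a\<bar>"] by (simp add: power2_sum)
    also have "(?s * (lam n X * z))\<^sup>2 \<le> ((2 * B + K) * (\<Lambda> * \<rho> * (2 * K)))\<^sup>2"
      using s0 by (intro power_mono mult_mono[OF step1[OF k] lz(2)] mult_nonneg_nonneg[OF s0 lz(1)]
          order_trans[OF s0 step1[OF k]] lz(1))
    also have "\<dots> = ((2 * B + K) * (\<Lambda> * (2 * K)))\<^sup>2 * \<rho>\<^sup>2" by (simp add: power_mult_distrib mult_ac)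
    also have "?a\<^sup>2 \<le> (2 * K)\<^sup>2 * (2 * (avg n (\<lambda>t. near_weight n X p t * \<epsilon> t k))\<^sup>2 + 2 * K / real n)"
      using noise(2)[OF k None_bar_ix] K
      by (intro score_noise_bound[OF n u_pos u_le close]) (simp_all add: aug_def)
    finally show ?thesis by simp
  qed
  have "(\<Sum>k\<in>X. (v_check n X p y Wh vh \<Psi> k - v k)\<^sup>2) \<le> (\<Sum>k\<in>X. 2 * ((2 * B + K) * (\<Lambda> * (2 * K)))\<^sup>2 * \<rho>\<^sup>2
      + 2 * ((2 * K)\<^sup>2 * (2 * (avg n (\<lambda>t. near_weight n X p t * \<epsilon> t k))\<^sup>2 + 2 * K / real n)))"
    by (rule sum_mono[OF each])
  also have "\<dots> = real (card X) * (2 * ((2 * B + K) * (\<Lambda> * (2 * K)))\<^sup>2 * \<rho>\<^sup>2)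
      + 2 * (2 * K)\<^sup>2 * (2 * (\<Sum>k\<in>X. (avg n (\<lambda>t. near_weight n X p t * \<epsilon> t k))\<^sup>2) + real (card X) * (2 * K * (1 / real n)))"
    by (simp add: sum.distrib sum_distrib_left algebra_simps)
  also have "\<dots> \<le> real (card X) * (2 * ((2 * B + K) * (\<Lambda> * (2 * K)))\<^sup>2 * \<rho>\<^sup>2)
      + 2 * (2 * K)\<^sup>2 * (2 * (real (card X) * (T * \<rho>\<^sup>2)) + real (card X) * (2 * K * \<rho>\<^sup>2))"
    using weighted \<rho>(2) K by (intro add_left_mono mult_left_mono add_mono) auto
  also have "\<dots> = real (card X) * ((2 * ((2 * B + K) * (\<Lambda> * (2 * K)))\<^sup>2 + 2 * (2 * K)\<^sup>2 * (2 * T + 2 * K)) * \<rho>\<^sup>2)"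
    by (simp add: algebra_simps)
  finally show ?thesis .
qed

section \<open>Events of high probability\<close>

text \<open>The version of \<open>whp\<close> for a single sample size, with explicit failure
  probability. An inner event is asked for because the predicates speak about arbitrary
  minimizers.\<close>

definition likely :: "'a measure \<Rightarrow> real \<Rightarrow> ('a \<Rightarrow> bool) \<Rightarrow> bool" where
  "likely M \<kappa> Q \<longleftrightarrow> (\<exists>E\<in>sets M. 1 - \<kappa> \<le> measure M E \<and> (\<forall>\<omega>\<in>E. Q \<omega>))"

lemma likely_mono:
  assumes "likely M \<kappa> Q" "\<kappa> \<le> \<kappa>'" "\<And>\<omega>. \<omega> \<in> space M \<Longrightarrow> Q \<omega> \<Longrightarrow> R \<omega>"
  shows "likely M \<kappa>' R"
proof -
  obtain E where E: "E \<in> sets M" "1 - \<kappa> \<le> measure M E" "\<And>\<omega>. \<omega> \<in> E \<Longrightarrow> Q \<omega>"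
    using assms(1) unfolding likely_def by blast
  have "R \<omega>" if "\<omega> \<in> E" for \<omega>
    using assms(3) E(3)[OF that] sets.sets_into_space[OF E(1)] that by blast
  then show ?thesis unfolding likely_def using E assms(2) by (intro bexI[of _ E]) auto
qed

context prob_space
begin

lemma likely_conj:
  assumes "likely M \<kappa> Q" "likely M \<kappa>' R"
  shows "likely M (\<kappa> + \<kappa>') (\<lambda>\<omega>. Q \<omega> \<and> R \<omega>)"
proof -
  obtain E F where E: "E \<in> events" "1 - \<kappa> \<le> prob E" "\<forall>\<omega>\<in>E. Q \<omega>"
    and F: "F \<in> events" "1 - \<kappa>' \<le> prob F" "\<forall>\<omega>\<in>F. R \<omega>"
    using assms unfolding likely_def by blast
  have "prob (E \<union> F) = prob E + prob F - prob (E \<inter> F)"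
    using E(1) F(1) by (subst finite_measure_Union') (auto simp: finite_measure_Diff' Int_commute)
  moreover have "prob (E \<union> F) \<le> 1" by (rule prob_le_1)
  ultimately have "1 - (\<kappa> + \<kappa>') \<le> prob (E \<inter> F)" using E(2) F(2) by linarith
  then show ?thesis unfolding likely_def using E F by (intro bexI[of _ "E \<inter> F"]) auto
qed

lemma likely_AE:
  assumes "AE \<omega> in M. Q \<omega>" shows "likely M 0 Q"
proof -
  obtain N where N: "{\<omega>\<in>space M. \<not> Q \<omega>} \<subseteq> N" "N \<in> null_sets M"
    using assms by (auto simp: eventually_ae_filter)
  have "prob (space M - N) = 1" using N(2) by (subst prob_compl) (auto simp: measure_eq_0_null_sets)
  then show ?thesis unfolding likely_def using N by (intro bexI[of _ "space M - N"]) auto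
qed

lemma likely_Markov:
  assumes "integrable M f" "\<And>\<omega>. 0 \<le> f \<omega>" "expectation f \<le> m" "0 < b"
  shows "likely M (m / b) (\<lambda>\<omega>. f \<omega> < b)"
proof -
  have f: "f \<in> borel_measurable M" using assms(1) by simp
  have "prob {\<omega>\<in>space M. b \<le> f \<omega>} \<le> expectation f / b"
    using integral_Markov_inequality_measure[OF assms(1), of "{}" b] assms by simp
  also have "\<dots> \<le> m / b" using assms by (simp add: divide_right_mono)
  finally have "prob {\<omega>\<in>space M. b \<le> f \<omega>} \<le> m / b" .
  moreover have ev: "{\<omega>\<in>space M. b \<le> f \<omega>} \<in> events" using f by measurable
  ultimately have "1 - m / b \<le> prob (space M - {\<omega>\<in>space M. b \<le> f \<omega>})"
    by (simp add: prob_compl)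
  then show ?thesis unfolding likely_def using ev by (intro bexI[of _ "space M - {\<omega>\<in>space M. b \<le> f \<omega>}"]) auto
qed

lemma Max_integrable:
  fixes f :: "'i \<Rightarrow> 'a \<Rightarrow> real"
  assumes S: "finite S" "S \<noteq> {}" and f: "\<And>i. i \<in> S \<Longrightarrow> integrable M (f i)" "\<And>i \<omega>. 0 \<le> f i \<omega>"
  shows "integrable M (\<lambda>\<omega>. MAX i\<in>S. f i \<omega>)" "0 \<le> (MAX i\<in>S. f i \<omega>)"
proof -
  have nn: "0 \<le> (MAX i\<in>S. f i \<omega>)" for \<omega>
    using S f(2) by (subst Max_ge_iff) auto
  show "0 \<le> (MAX i\<in>S. f i \<omega>)" by (rule nn)
  show "integrable M (\<lambda>\<omega>. MAX i\<in>S. f i \<omega>)"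
  proof (rule Bochner_Integration.integrable_bound)
    show "integrable M (\<lambda>\<omega>. \<Sum>i\<in>S. f i \<omega>)" using f by (intro Bochner_Integration.integrable_sum) auto
    show "(\<lambda>\<omega>. MAX i\<in>S. f i \<omega>) \<in> borel_measurable M"
      using f(1) S by (intro borel_measurable_Max) auto
    have "(MAX i\<in>S. f i \<omega>) \<le> (\<Sum>i\<in>S. f i \<omega>)" for \<omega>
      using S f(2) by (intro Max.boundedI) (auto intro!: member_le_sum)
    then show "AE \<omega> in M. norm (MAX i\<in>S. f i \<omega>) \<le> norm (\<Sum>i\<in>S. f i \<omega>)"
      using nn f(2) by (intro AE_I2) (simp add: sum_nonneg)
  qed
qed

lemma likely_Max:
  fixes f :: "'i \<Rightarrow> 'a \<Rightarrow> real"
  assumes S: "finite S" "S \<noteq> {}" and f: "\<And>i. i \<in> S \<Longrightarrow> integrable M (f i)" "\<And>i \<omega>. 0 \<le> f i \<omega>"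
    and m: "expectation (\<lambda>\<omega>. MAX i\<in>S. f i \<omega>) \<le> m" and b: "0 < b"
  shows "likely M (m / b) (\<lambda>\<omega>. \<forall>i\<in>S. f i \<omega> < b)"
proof (rule likely_mono[OF likely_Markov[OF Max_integrable[OF S f] m b] order_refl])
  fix \<omega> assume "(MAX i\<in>S. f i \<omega>) < b"
  then show "\<forall>i\<in>S. f i \<omega> < b" using S by auto
qed

lemma nn_integral_bound:
  assumes "f \<in> borel_measurable M" "\<And>\<omega>. 0 \<le> f \<omega>" "(\<integral>\<^sup>+\<omega>. ennreal (f \<omega>) \<partial>M) \<le> ennreal C" "0 \<le> C"
  shows "integrable M f" "expectation f \<le> C"
proof -
  show i: "integrable M f"
  proof (rule integrableI_bounded)
    have "(\<integral>\<^sup>+\<omega>. ennreal (norm (f \<omega>)) \<partial>M) = (\<integral>\<^sup>+\<omega>. ennreal (f \<omega>) \<partial>M)"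
      using assms(2) by (intro nn_integral_cong) simp
    also have "\<dots> < \<infinity>" using assms(3) by (rule le_less_trans) simp
    finally show "(\<integral>\<^sup>+\<omega>. ennreal (norm (f \<omega>)) \<partial>M) < \<infinity>" .
  qed (rule assms)
  have "ennreal (expectation f) = (\<integral>\<^sup>+\<omega>. ennreal (f \<omega>) \<partial>M)"
    using i assms(2) by (intro nn_integral_eq_integral[symmetric]) auto
  also have "\<dots> \<le> ennreal C" by (rule assms(3))
  finally show "expectation f \<le> C" using assms(4) by (simp only: ennreal_le_iff)
qed

text \<open>The tower property in \<open>ennreal\<close>, where no integrability has to be known
  beforehand; it comes out together with the bound.\<close>

lemma nn_cond_exp_bound:
  assumes sub: "subalgebra M F" and f: "f \<in> borel_measurable M" "\<And>\<omega>. 0 \<le> f \<omega>"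
    and le: "AE \<omega> in M. nn_cond_exp M F (\<lambda>\<omega>. ennreal (f \<omega>)) \<omega> \<le> ennreal C" and C: "0 \<le> C"
  shows "integrable M f" "expectation f \<le> C"
proof -
  interpret F: finite_measure_subalgebra M F
    by (rule finite_measure_subalgebra.intro[OF finite_measure_axioms]) (unfold_locales, rule sub)
  have "(\<integral>\<^sup>+\<omega>. ennreal (f \<omega>) \<partial>M) = (\<integral>\<^sup>+\<omega>. 1 * nn_cond_exp M F (\<lambda>\<omega>. ennreal (f \<omega>)) \<omega> \<partial>M)"
    using f by (subst F.nn_cond_exp_intg) auto
  also have "\<dots> \<le> (\<integral>\<^sup>+\<omega>. ennreal C \<partial>M)"
    using le by (intro nn_integral_mono_AE) auto
  also have "\<dots> = ennreal C" by (simp add: emeasure_space_1)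
  finally have "(\<integral>\<^sup>+\<omega>. ennreal (f \<omega>) \<partial>M) \<le> ennreal C" .
  from nn_integral_bound[OF f this C] show "integrable M f" "expectation f \<le> C" .
qed

end

section \<open>Dependence of the near-minimizer on the prices\<close>

text \<open>The selection sees nothing but the sampled prices of the observable agents. This permits
  replacing the true prices by clipped ones and reading the weights as functions on a product
  space.\<close>

lemma near_weight_cong:
  assumes eq: "\<And>t k. t \<in> {1..n} \<Longrightarrow> k \<in> X \<Longrightarrow> p t k = p' t k" and t: "t \<in> {1..n}"
  shows "near_weight n X p t = near_weight n X p' t"
proof -
  have a: "aug (p t) j = aug (p' t) j" if "t \<in> {1..n}" "j \<in> bar_ix X" for t j
    using that eq by (auto simp: bar_ix_def aug_def)
  have s: "score X p \<psi> t = score X p' \<psi> t" if "t \<in> {1..n}" for t \<psi>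
    unfolding score_def using a[OF that] by (intro sum.cong) auto
  have n4: "norm4 n (score X p \<psi>) = norm4 n (score X p' \<psi>)" for \<psi>
    unfolding norm4_def using s by (intro arg_cong[where f = "root 4"] avg_cong) simp
  have "row_feasible n X p z \<psi> = row_feasible n X p' z \<psi>" for z \<psi>
    unfolding row_feasible_def
  proof (intro ball_cong refl)
    fix j assume j: "j \<in> bar_ix X"
    have "avg n (\<lambda>t. score X p \<psi> t * aug (p t) j) = avg n (\<lambda>t. score X p' \<psi> t * aug (p' t) j)"
      "avg n (\<lambda>t. (score X p \<psi> t * aug (p t) j - of_bool (None = j))\<^sup>2) = avg n (\<lambda>t. (score X p' \<psi> t * aug (p' t) j - of_bool (None = j))\<^sup>2)"
      using s a j by (auto intro!: avg_cong)
    then show "(\<bar>avg n (\<lambda>t. score X p \<psi> t * aug (p t) j) - of_bool (None = j)\<bar> \<le> lam n X * z \<and>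
        sqrt (avg n (\<lambda>t. (score X p \<psi> t * aug (p t) j - of_bool (None = j))\<^sup>2)) \<le> z) =
      (\<bar>avg n (\<lambda>t. score X p' \<psi> t * aug (p' t) j) - of_bool (None = j)\<bar> \<le> lam n X * z \<and>
        sqrt (avg n (\<lambda>t. (score X p' \<psi> t * aug (p' t) j - of_bool (None = j))\<^sup>2)) \<le> z)" by simp
  qed
  then have "row_below n X \<eta> p = row_below n X \<eta> p'" for \<eta>
    by (simp add: fun_eq_iff row_below_def row_value_def n4)
  then have "near_row n X \<eta> p = near_row n X \<eta> p'" for \<eta> by (simp add: near_row_def)
  then show ?thesis by (simp add: near_weight_def s[OF t] n4)
qed

text \<open>An inequality and not an equation: for a score of norm zero the division returns
  zero.\<close>

lemma near_weight_norm: "avg n (\<lambda>t. near_weight n X p t ^ 4) \<le> 1"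
proof -
  let ?u = "score X p (snd (near_row n X (1 / (128 * (real n)\<^sup>2)) p))"
  have "near_weight n X p = (\<lambda>t. 1 / norm4 n ?u * ?u t)" by (simp add: fun_eq_iff near_weight_def)
  then have "norm4 n (near_weight n X p) = \<bar>1 / norm4 n ?u\<bar> * norm4 n ?u" by (simp only: norm4_scale)
  also have "\<dots> \<le> 1" using norm4_nonneg[of n ?u] by simp
  finally have "norm4 n (near_weight n X p) ^ 4 \<le> 1" using norm4_nonneg by (intro power_le_one) auto
  then show ?thesis by (simp add: norm4_power)
qed

lemma near_weight_bound:
  assumes "t \<in> {1..n}" shows "\<bar>near_weight n X p t\<bar> \<le> real n"
proof -
  have n: "1 \<le> n" using assms by simp
  have "near_weight n X p t ^ 4 \<le> (\<Sum>t=1..n. near_weight n X p t ^ 4)"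
    using assms by (intro member_le_sum) auto
  also have "\<dots> \<le> real n" using near_weight_norm[of n X p] n by (simp add: avg_def divide_le_eq)
  also have "\<dots> \<le> real n ^ 4" using n by (intro self_le_power) auto
  finally have "\<bar>near_weight n X p t\<bar> ^ 4 \<le> real n ^ 4" by simp
  then show ?thesis by (rule power_le_imp_le_base[where n = 3, simplified]) simp
qed

section \<open>Regular instances\<close>

text \<open>The choice in \<open>inv_on\<close> depends on the matrix only through
  \<open>inverse_pair_on\<close>, so matrices that agree on the index set have literally the same
  inverse.\<close>

lemma inv_on_cong:
  assumes "\<And>i j. i \<in> I \<Longrightarrow> j \<in> I \<Longrightarrow> A i j = A' i j" shows "inv_on I A = inv_on I A'"
proof -
  have "inverse_pair_on I A = inverse_pair_on I A'"
    unfolding fun_eq_iff inverse_pair_on_def mm_on_def using assms by (auto intro!: ball_cong sum.cong)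
  then show ?thesis by (simp add: inv_on_def)
qed

section \<open>One regular instance: the noise as a function of the observations\<close>

locale regular_instance = sampled_pricing pbar abar bbar \<zeta> n D
  for pbar abar bbar \<zeta> n and D :: "('v, 'w) pricing" +
  fixes c C K Me Mp :: real
  assumes c: "0 < c" "c < C" and moments: "1 \<le> Me" "1 \<le> Mp"
    and noise: "regular_noise c C Me n D" and prices: "regular_prices c C K Mp n D"
begin

interpretation prob_space P by (rule prob)

abbreviation "B \<equiv> max 1 pbar"

definition clip :: "('v \<Rightarrow> real) \<Rightarrow> 'v \<Rightarrow> real" where
  "clip p k = max 0 (min pbar (p k))"

text \<open>Clipping changes the observed prices only on a null set, but makes the design bounded everywhere.\<close>

definition cprice :: "nat \<Rightarrow> 'w \<Rightarrow> 'v \<Rightarrow> real" where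
  "cprice t \<omega> = clip (fst (observation D t \<omega>))"

text \<open>Independence over the periods is available for the pairs of prices and consumptions, so
  the noise is recovered from these by solving the reduced form.\<close>

definition noise_of :: "'v \<Rightarrow> ('v \<Rightarrow> real) \<times> ('v \<Rightarrow> real) \<Rightarrow> real" where
  "noise_of k x = snd x k - v_vec D pbar k + mv_on X W (fst x) k"

lemma obs_indep: "indep_vars (\<lambda>_. observation_space D) (observation D) {1..n}"
  using sampling unfolding regular_sampling_def by simp

lemma obs_measurable: "t \<in> {1..n} \<Longrightarrow> observation D t \<in> P \<rightarrow>\<^sub>M observation_space D"
  using obs_indep by (auto simp: indep_vars_def2)

lemma price_component: "k \<in> X \<Longrightarrow> (\<lambda>p. p k) \<in> borel_measurable (PiM X (\<lambda>_. borel))"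
  by (rule measurable_component_singleton)

lemma fst_measurable: "fst \<in> observation_space D \<rightarrow>\<^sub>M PiM X (\<lambda>_. borel)"
  and snd_measurable: "snd \<in> observation_space D \<rightarrow>\<^sub>M PiM X (\<lambda>_. borel)"
  unfolding observation_space_def by simp_all

lemma noise_of_measurable: "k \<in> X \<Longrightarrow> noise_of k \<in> borel_measurable (observation_space D)"
  unfolding noise_of_def mv_on_def
  by (intro borel_measurable_add borel_measurable_diff borel_measurable_sum borel_measurable_times borel_measurable_const
      measurable_compose[OF fst_measurable price_component] measurable_compose[OF snd_measurable price_component])

lemma clip_bounds: "0 \<le> clip p k" "clip p k \<le> pbar"
  using pbar by (auto simp: clip_def)

lemma aug_clip_bound: "\<bar>aug (clip p) j\<bar> \<le> B"
  using clip_bounds[of p] by (cases j) (auto simp: aug_def le_max_iff_disj)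

lemma aug_clip_measurable: "j \<in> bar_ix X \<Longrightarrow> (\<lambda>p. aug (clip p) j) \<in> borel_measurable (PiM X (\<lambda>_. borel))"
  using price_component by (auto simp: bar_ix_def aug_def clip_def intro!: borel_measurable_max borel_measurable_min)

lemma AE_good: "AE \<omega> in P. \<forall>t\<in>{1..n}. \<forall>k\<in>X. cprice t \<omega> k = price D t \<omega> k \<and>
    0 \<le> price D t \<omega> k \<and> price D t \<omega> k \<le> pbar \<and> noise_of k (observation D t \<omega>) = eps D t \<omega> k \<and>
    cons D t \<omega> k = v_vec D pbar k - mv_on X W (price D t \<omega>) k + eps D t \<omega> k"
proof (rule AE_finite_allI)
  fix t assume t: "t \<in> {1..n}"
  show "AE \<omega> in P. \<forall>k\<in>X. cprice t \<omega> k = price D t \<omega> k \<and>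
    0 \<le> price D t \<omega> k \<and> price D t \<omega> k \<le> pbar \<and> noise_of k (observation D t \<omega>) = eps D t \<omega> k \<and>
    cons D t \<omega> k = v_vec D pbar k - mv_on X W (price D t \<omega>) k + eps D t \<omega> k"
    using AE_data[OF t]
  proof eventually_elim
    case (elim \<omega>)
    have "mv_on X W (restrict (price D t \<omega>) X) k = mv_on X W (price D t \<omega>) k" for k
      by (rule mv_on_cong) auto
    then show ?case using elim
      by (auto simp: cprice_def clip_def observation_def noise_of_def)
  qed
qed simp

lemma aug_cprice_eq:
  "\<forall>k\<in>X. cprice t \<omega> k = price D t \<omega> k \<Longrightarrow> j \<in> bar_ix X \<Longrightarrow> aug (cprice t \<omega>) j = aug (price D t \<omega>) j"
  by (auto simp: bar_ix_def aug_def)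

lemma price_measurable: "t \<in> {1..n} \<Longrightarrow> k \<in> X \<Longrightarrow> (\<lambda>\<omega>. price D t \<omega> k) \<in> borel_measurable P"
  using model unfolding pricing_model_def by auto

lemma price_subalgebra:
  assumes "T \<subseteq> {1..n}" shows "subalgebra P (price_sigma D T)"
proof -
  have "(\<lambda>\<omega>. restrict (\<lambda>(t, k). price D t \<omega> k) (T \<times> X)) \<in> P \<rightarrow>\<^sub>M PiM (T \<times> X) (\<lambda>_. borel)"
    using price_measurable assms by (intro measurable_restrict) auto
  then show ?thesis
    unfolding subalgebra_def price_sigma_def by (simp add: measurable_iff_sets)
qed

lemma eps_measurable: "t \<in> {1..n} \<Longrightarrow> k \<in> X \<Longrightarrow> (\<lambda>\<omega>. eps D t \<omega> k) \<in> borel_measurable P"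
  using eps_integrable by auto

lemma noise_obs_measurable: "t \<in> {1..n} \<Longrightarrow> k \<in> X \<Longrightarrow> (\<lambda>\<omega>. noise_of k (observation D t \<omega>)) \<in> borel_measurable P"
  by (rule measurable_compose[OF obs_measurable noise_of_measurable])

lemma AE_noise: "t \<in> {1..n} \<Longrightarrow> k \<in> X \<Longrightarrow> AE \<omega> in P. noise_of k (observation D t \<omega>) = eps D t \<omega> k"
  using AE_good by (auto elim!: eventually_mono)

lemma eps_fourth:
  assumes t: "t \<in> {1..n}" and k: "k \<in> X"
  shows "integrable P (\<lambda>\<omega>. \<bar>eps D t \<omega> k\<bar> ^ 4)" "expectation (\<lambda>\<omega>. \<bar>eps D t \<omega> k\<bar> ^ 4) \<le> C"
proof -
  have le: "AE \<omega> in P. nn_cond_exp P (price_sigma D {t}) (\<lambda>\<omega>. ennreal (\<bar>eps D t \<omega> k\<bar> ^ 4)) \<omega> \<le> ennreal C"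
    using noise t k unfolding regular_noise_def by auto
  have m: "(\<lambda>\<omega>. \<bar>eps D t \<omega> k\<bar> ^ 4) \<in> borel_measurable P"
    using eps_measurable[OF t k] by simp
  have sub: "subalgebra P (price_sigma D {t})" using t by (intro price_subalgebra) auto
  from nn_cond_exp_bound[OF sub m _ le] c
  show "integrable P (\<lambda>\<omega>. \<bar>eps D t \<omega> k\<bar> ^ 4)" "expectation (\<lambda>\<omega>. \<bar>eps D t \<omega> k\<bar> ^ 4) \<le> C" by auto
qed

lemma noise_fourth:
  assumes t: "t \<in> {1..n}" and k: "k \<in> X"
  shows "integrable P (\<lambda>\<omega>. noise_of k (observation D t \<omega>) ^ 4)" "expectation (\<lambda>\<omega>. noise_of k (observation D t \<omega>) ^ 4) \<le> C"
proof -
  have m: "(\<lambda>\<omega>. noise_of k (observation D t \<omega>) ^ 4) \<in> borel_measurable P" "(\<lambda>\<omega>. \<bar>eps D t \<omega> k\<bar> ^ 4) \<in> borel_measurable P"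
    using noise_obs_measurable[OF t k] eps_measurable[OF t k] by simp_all
  have ae: "AE \<omega> in P. noise_of k (observation D t \<omega>) ^ 4 = \<bar>eps D t \<omega> k\<bar> ^ 4"
    using AE_noise[OF t k] by (auto elim!: eventually_mono)
  show "integrable P (\<lambda>\<omega>. noise_of k (observation D t \<omega>) ^ 4)"
    using eps_fourth(1)[OF t k] integrable_cong_AE[OF m ae] by simp
  show "expectation (\<lambda>\<omega>. noise_of k (observation D t \<omega>) ^ 4) \<le> C"
    using eps_fourth(2)[OF t k] integral_cong_AE[OF m ae] by simp
qed

lemma likely_eps:
  assumes X: "X \<noteq> {}" and b: "0 < b"
  shows "likely P (Me / b) (\<lambda>\<omega>. \<forall>t\<in>{1..n}. \<forall>k\<in>X. \<bar>eps D t \<omega> k\<bar> ^ 4 < b)"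
proof -
  let ?S = "{1..n} \<times> X" and ?f = "\<lambda>(t, k) \<omega>. \<bar>eps D t \<omega> k\<bar> ^ 4"
  have S: "finite ?S" "?S \<noteq> {}" using X finX n by auto
  have f: "integrable P (?f i)" if "i \<in> ?S" for i using that eps_fourth(1) by (cases i) auto
  have nn: "0 \<le> ?f i \<omega>" for i \<omega> by (cases i) simp
  note mi = Max_integrable[OF S f nn]
  have eq: "(MAX i\<in>?S. ?f i \<omega>) = (MAX (t, k)\<in>?S. \<bar>eps D t \<omega> k\<bar> ^ 4)" for \<omega>
    by (intro arg_cong[where f = Max] image_cong) auto
  have le: "AE \<omega> in P. nn_cond_exp P (price_sigma D {1..n}) (\<lambda>\<omega>. ennreal (MAX i\<in>?S. ?f i \<omega>)) \<omega> \<le> ennreal Me"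
    using noise unfolding regular_noise_def eq by blast
  have "expectation (\<lambda>\<omega>. MAX i\<in>?S. ?f i \<omega>) \<le> Me"
    by (rule nn_cond_exp_bound(2)[OF price_subalgebra[OF order_refl] _ mi(2) le]) (use mi(1) moments in auto)
  from likely_Max[OF S f nn this b] show ?thesis
    by (rule likely_mono) auto
qed

text \<open>A bounded function of the prices in period \<open>t\<close> is measurable for the
  conditioning sigma-algebra and can be pulled out of the conditional expectation, which
  vanishes.\<close>

lemma noise_orthogonal:
  assumes t: "t \<in> {1..n}" and k: "k \<in> X" and g: "g \<in> borel_measurable (PiM X (\<lambda>_. borel))" and b: "\<And>p. \<bar>g p\<bar> \<le> b"
  shows "expectation (\<lambda>\<omega>. g (fst (observation D t \<omega>)) * noise_of k (observation D t \<omega>)) = 0"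
proof -
  have sub: "subalgebra P (price_sigma D {t})" using t by (intro price_subalgebra) auto
  interpret F: finite_measure_subalgebra P "price_sigma D {t}"
    by (rule finite_measure_subalgebra.intro[OF finite_measure_axioms]) (unfold_locales, rule sub)
  let ?m = "\<lambda>\<omega>. restrict (\<lambda>(t, k). price D t \<omega> k) ({t} \<times> X)"
  have m: "?m \<in> price_sigma D {t} \<rightarrow>\<^sub>M PiM ({t} \<times> X) (\<lambda>_. borel)"
    unfolding price_sigma_def by (rule measurable_vimage_algebra1) (auto simp: space_PiM)
  have "(\<lambda>f. \<lambda>k\<in>X. f (t, k)) \<in> PiM ({t} \<times> X) (\<lambda>_. borel) \<rightarrow>\<^sub>M PiM X (\<lambda>_. borel :: real measure)"
    by (intro measurable_restrict measurable_component_singleton) auto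
  from measurable_compose[OF m measurable_compose[OF this g]]
  have "(\<lambda>\<omega>. g (\<lambda>k\<in>X. ?m \<omega> (t, k))) \<in> borel_measurable (price_sigma D {t})" .
  also have "(\<lambda>\<omega>. g (\<lambda>k\<in>X. ?m \<omega> (t, k))) = (\<lambda>\<omega>. g (fst (observation D t \<omega>)))"
    by (auto simp: observation_def fun_eq_iff restrict_def intro!: arg_cong[where f = g])
  finally have gF: "(\<lambda>\<omega>. g (fst (observation D t \<omega>))) \<in> borel_measurable (price_sigma D {t})" .
  have gP: "(\<lambda>\<omega>. g (fst (observation D t \<omega>))) \<in> borel_measurable P"
    by (rule measurable_compose[OF obs_measurable[OF t] measurable_compose[OF fst_measurable g]])
  have int: "integrable P (\<lambda>\<omega>. g (fst (observation D t \<omega>)) * eps D t \<omega> k)"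
  proof (rule Bochner_Integration.integrable_bound)
    show "integrable P (\<lambda>\<omega>. b * eps D t \<omega> k)" using eps_integrable[OF t k] by simp
    show "AE \<omega> in P. norm (g (fst (observation D t \<omega>)) * eps D t \<omega> k) \<le> norm (b * eps D t \<omega> k)"
      using b by (intro AE_I2) (auto simp: abs_mult intro!: mult_right_mono order_trans[OF b abs_ge_self])
  qed (use gP eps_measurable[OF t k] in simp)
  have ce: "AE \<omega> in P. real_cond_exp P (price_sigma D {t}) (\<lambda>\<omega>. eps D t \<omega> k) \<omega> = 0"
    using sampling t k unfolding regular_sampling_def by auto
  have "expectation (\<lambda>\<omega>. g (fst (observation D t \<omega>)) * noise_of k (observation D t \<omega>))
      = expectation (\<lambda>\<omega>. g (fst (observation D t \<omega>)) * eps D t \<omega> k)"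
    using AE_noise[OF t k] gP eps_measurable[OF t k] noise_obs_measurable[OF t k]
    by (intro integral_cong_AE) (auto elim!: eventually_mono)
  also have "\<dots> = expectation (\<lambda>\<omega>. g (fst (observation D t \<omega>)) * real_cond_exp P (price_sigma D {t}) (\<lambda>\<omega>. eps D t \<omega> k) \<omega>)"
    by (rule F.real_cond_exp_intg(2)[OF int gF eps_measurable[OF t k], symmetric])
  also have "\<dots> = expectation (\<lambda>\<omega>. 0)"
    using ce gP by (intro integral_cong_AE) (auto elim!: eventually_mono)
  finally show ?thesis by simp
qed

end

lemma abs_le_of_power4_less: "\<bar>x\<bar> ^ 4 < (b::real) ^ 4 \<Longrightarrow> 0 \<le> b \<Longrightarrow> \<bar>x\<bar> \<le> b"
  using power_less_imp_less_base[of "\<bar>x\<bar>" 4 b] by simp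

section \<open>One regular instance: the row of the population inverse that belongs to the
  intercept\<close>

context regular_instance
begin

interpretation prob_space P by (rule prob)

text \<open>Taken from period 1 for all periods: the observations are identically distributed, so
  the matrix of second moments and its chosen inverse do not depend on the period.\<close>

definition psi0 :: "'v option \<Rightarrow> real" where
  "psi0 = Psi_bar D 1 None"

definition Psi_obs :: "'v option \<Rightarrow> ('v \<Rightarrow> real) \<times> ('v \<Rightarrow> real) \<Rightarrow> real" where
  "Psi_obs j x = (\<Sum>i\<in>bar_ix X. psi0 i * aug (clip (fst x)) i) * aug (clip (fst x)) j"

lemma fin_bar: "finite (bar_ix X)"
  by (rule finite_bar_ix[OF finX])

lemma Psi_obs_score: "Psi_obs j (observation D t \<omega>) = score X (\<lambda>s. cprice s \<omega>) psi0 t * aug (cprice t \<omega>) j"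
  by (simp add: Psi_obs_def score_def cprice_def)

lemma aug_obs_measurable: "j \<in> bar_ix X \<Longrightarrow> (\<lambda>x. aug (clip (fst x)) j) \<in> borel_measurable (observation_space D)"
  by (rule measurable_compose[OF fst_measurable aug_clip_measurable])

lemma Psi_obs_measurable: "j \<in> bar_ix X \<Longrightarrow> Psi_obs j \<in> borel_measurable (observation_space D)"
  unfolding Psi_obs_def using aug_obs_measurable
  by (intro borel_measurable_times borel_measurable_sum borel_measurable_const) auto

lemma Psi_obs_bound: "\<bar>Psi_obs j x\<bar> \<le> (\<Sum>i\<in>bar_ix X. \<bar>psi0 i\<bar> * B) * B"
proof -
  have "\<bar>\<Sum>i\<in>bar_ix X. psi0 i * aug (clip (fst x)) i\<bar> \<le> (\<Sum>i\<in>bar_ix X. \<bar>psi0 i\<bar> * B)"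
    by (intro sum_abs[THEN order_trans] sum_mono) (auto simp: abs_mult intro!: mult_left_mono aug_clip_bound)
  then show ?thesis unfolding Psi_obs_def abs_mult
    by (intro mult_mono aug_clip_bound) (auto intro!: sum_nonneg)
qed

lemma AE_aug: "AE \<omega> in P. \<forall>t\<in>{1..n}. \<forall>j\<in>bar_ix X. aug (cprice t \<omega>) j = aug (price D t \<omega>) j"
  using AE_good by eventually_elim (auto intro!: aug_cprice_eq)

lemma aug_price_measurable: "t \<in> {1..n} \<Longrightarrow> j \<in> bar_ix X \<Longrightarrow> (\<lambda>\<omega>. aug (price D t \<omega>) j) \<in> borel_measurable P"
  using price_measurable by (auto simp: bar_ix_def aug_def)

lemma aug_cprice_measurable: "t \<in> {1..n} \<Longrightarrow> j \<in> bar_ix X \<Longrightarrow> (\<lambda>\<omega>. aug (cprice t \<omega>) j) \<in> borel_measurable P"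
  unfolding cprice_def by (rule measurable_compose[OF obs_measurable aug_obs_measurable])

lemma second_moment_clip:
  assumes "t \<in> {1..n}" "i \<in> bar_ix X" "j \<in> bar_ix X"
  shows "second_moment D t i j = expectation (\<lambda>\<omega>. aug (cprice t \<omega>) i * aug (cprice t \<omega>) j)"
  unfolding second_moment_def
  using AE_aug assms aug_price_measurable aug_cprice_measurable
  by (intro integral_cong_AE borel_measurable_times) (auto elim!: eventually_mono)

lemma second_moment_eq:
  assumes t: "t \<in> {1..n}" and i: "i \<in> bar_ix X" and j: "j \<in> bar_ix X"
  shows "second_moment D t i j = second_moment D 1 i j"
proof -
  have one: "1 \<in> {1..n}" using n by simp
  let ?f = "\<lambda>x. aug (clip (fst x)) i * aug (clip (fst x)) j"
  have f: "?f \<in> borel_measurable (observation_space D)"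
    by (intro borel_measurable_times aug_obs_measurable i j)
  have eq: "second_moment D s i j = (\<integral>x. ?f x \<partial>distr P (observation_space D) (observation D s))" if "s \<in> {1..n}" for s
    unfolding second_moment_clip[OF that i j] by (subst integral_distr[OF obs_measurable[OF that] f]) (simp add: cprice_def)
  have "distr P (observation_space D) (observation D t) = distr P (observation_space D) (observation D 1)"
    using sampling t one unfolding regular_sampling_def by blast
  then show ?thesis by (simp only: eq[OF t] eq[OF one])
qed

lemma Psi_bar_eq: "t \<in> {1..n} \<Longrightarrow> Psi_bar D t = Psi_bar D 1"
  unfolding Psi_bar_def by (intro inv_on_cong second_moment_eq)

lemma AE_Psi: "AE \<omega> in P. \<forall>t\<in>{1..n}. \<forall>j\<in>bar_ix X. Psi_prod D t \<omega> None j = Psi_obs j (observation D t \<omega>)"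
  using AE_aug
proof eventually_elim
  case (elim \<omega>)
  show ?case
  proof (intro ballI)
    fix t j assume t: "t \<in> {1..n}" and j: "j \<in> bar_ix X"
    show "Psi_prod D t \<omega> None j = Psi_obs j (observation D t \<omega>)"
      unfolding Psi_prod_def Psi_obs_score mv_on_def score_def Psi_bar_eq[OF t] psi0_def
      using elim t j by (intro arg_cong2[where f = "(*)"] sum.cong) auto
  qed
qed

lemma Psi_prod_measurable:
  "t \<in> {1..n} \<Longrightarrow> j \<in> bar_ix X \<Longrightarrow> (\<lambda>\<omega>. Psi_prod D t \<omega> k j) \<in> borel_measurable P"
  unfolding Psi_prod_def mv_on_def using aug_price_measurable
  by (intro borel_measurable_times borel_measurable_sum borel_measurable_const) auto

text \<open>The moment conditions on the design bound Bochner integrals, which are 0 for functions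
  that are not integrable, so integrability is needed separately. It follows from bounded prices;
  the bound used here depends on the dimension and enters no rate.\<close>

lemma Psi_prod_integrable:
  assumes t: "t \<in> {1..n}" and j: "j \<in> bar_ix X"
  shows "integrable P (\<lambda>\<omega>. \<bar>Psi_prod D t \<omega> k j\<bar> ^ 4)"
proof (rule integrable_const_bound)
  have "AE \<omega> in P. \<bar>Psi_prod D t \<omega> k j\<bar> \<le> (\<Sum>i\<in>bar_ix X. \<bar>Psi_bar D t k i\<bar> * B) * B"
    using AE_aug
  proof eventually_elim
    case (elim \<omega>)
    then have a: "\<bar>aug (price D t \<omega>) i\<bar> \<le> B" if "i \<in> bar_ix X" for i
      using that t aug_clip_bound[of "fst (observation D t \<omega>)" i] by (simp add: cprice_def)
    have "\<bar>mv_on (bar_ix X) (Psi_bar D t) (aug (price D t \<omega>)) k\<bar> \<le> (\<Sum>i\<in>bar_ix X. \<bar>Psi_bar D t k i\<bar> * B)"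
      unfolding mv_on_def by (intro sum_abs[THEN order_trans] sum_mono) (auto simp: abs_mult intro!: mult_left_mono a)
    then show ?case unfolding Psi_prod_def abs_mult
      using a[OF j] by (intro mult_mono) (auto intro!: sum_nonneg)
  qed
  then show "AE \<omega> in P. norm (\<bar>Psi_prod D t \<omega> k j\<bar> ^ 4) \<le> ((\<Sum>i\<in>bar_ix X. \<bar>Psi_bar D t k i\<bar> * B) * B) ^ 4"
  proof eventually_elim
    case (elim \<omega>)
    from power_mono[OF elim abs_ge_zero, of 4] show ?case by simp
  qed
qed (use Psi_prod_measurable[OF t j] in simp)

lemma Psi_obs_obs_measurable:
  "t \<in> {1..n} \<Longrightarrow> j \<in> bar_ix X \<Longrightarrow> (\<lambda>\<omega>. Psi_obs j (observation D t \<omega>)) \<in> borel_measurable P"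
  by (rule measurable_compose[OF obs_measurable Psi_obs_measurable])

lemma Psi_obs_power_integrable:
  assumes "t \<in> {1..n}" "j \<in> bar_ix X"
  shows "integrable P (\<lambda>\<omega>. Psi_obs j (observation D t \<omega>) ^ m)"
proof (rule integrable_const_bound)
  show "AE \<omega> in P. norm (Psi_obs j (observation D t \<omega>) ^ m) \<le> ((\<Sum>i\<in>bar_ix X. \<bar>psi0 i\<bar> * B) * B) ^ m"
    by (auto simp: power_abs intro!: AE_I2 power_mono Psi_obs_bound)
qed (use Psi_obs_obs_measurable[OF assms] in simp)

lemma Psi_obs_fourth:
  assumes t: "t \<in> {1..n}" and j: "j \<in> bar_ix X"
  shows "expectation (\<lambda>\<omega>. Psi_obs j (observation D t \<omega>) ^ 4) \<le> C"
proof -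
  have "expectation (\<lambda>\<omega>. Psi_obs j (observation D t \<omega>) ^ 4) = expectation (\<lambda>\<omega>. \<bar>Psi_prod D t \<omega> None j\<bar> ^ 4)"
    using AE_Psi t j Psi_obs_obs_measurable[OF t j] Psi_prod_measurable[OF t j]
    by (intro integral_cong_AE) (auto elim!: eventually_mono)
  then show ?thesis using prices t j None_bar_ix[of X] unfolding regular_prices_def by auto
qed

text \<open>The mean is an entry of the product of the inverse with the matrix of second
  moments.\<close>

lemma Psi_obs_mean:
  assumes t: "t \<in> {1..n}" and j: "j \<in> bar_ix X"
  shows "expectation (\<lambda>\<omega>. Psi_obs j (observation D t \<omega>)) = of_bool (None = j)"
proof -
  have one: "1 \<in> {1..n}" using n by simp
  have int: "integrable P (\<lambda>\<omega>. aug (cprice t \<omega>) i * aug (cprice t \<omega>) j)" if "i \<in> bar_ix X" for i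
  proof (rule integrable_const_bound)
    show "AE \<omega> in P. norm (aug (cprice t \<omega>) i * aug (cprice t \<omega>) j) \<le> B * B"
      unfolding cprice_def real_norm_def abs_mult by (intro AE_I2 mult_mono aug_clip_bound) auto
  qed (use aug_cprice_measurable t j that in simp)
  have "expectation (\<lambda>\<omega>. Psi_obs j (observation D t \<omega>)) = expectation (\<lambda>\<omega>. \<Sum>i\<in>bar_ix X. psi0 i * (aug (cprice t \<omega>) i * aug (cprice t \<omega>) j))"
    by (intro Bochner_Integration.integral_cong) (simp_all add: Psi_obs_def cprice_def sum_distrib_right mult.assoc)
  also have "\<dots> = (\<Sum>i\<in>bar_ix X. psi0 i * expectation (\<lambda>\<omega>. aug (cprice t \<omega>) i * aug (cprice t \<omega>) j))"
    using int by (subst Bochner_Integration.integral_sum) auto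
  also have "\<dots> = (\<Sum>i\<in>bar_ix X. psi0 i * second_moment D 1 i j)"
    by (intro sum.cong refl) (simp only: second_moment_clip[OF t _ j, symmetric] second_moment_eq[OF t _ j])
  also have "\<dots> = mm_on (bar_ix X) (Psi_bar D 1) (second_moment D 1) None j"
    by (simp add: mm_on_def psi0_def)
  also have "\<dots> = of_bool (None = j)"
  proof -
    have "invertible_on (bar_ix X) (second_moment D 1)"
      using prices one unfolding regular_prices_def by blast
    from inv_on_inverse[OF this] show ?thesis
      unfolding inverse_pair_on_def Psi_bar_def using None_bar_ix[of X] j by blast
  qed
  finally show ?thesis .
qed

text \<open>Markov's inequality for the maximum over all rows, restricted to the row
  \<open>None\<close>. It is used at two levels: for single terms of the averages and for their
  fourth powers.\<close>

lemma likely_Psi: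
  assumes b: "0 < b"
  shows "likely P (Mp / b) (\<lambda>\<omega>. \<forall>t\<in>{1..n}. \<forall>j\<in>bar_ix X. \<bar>Psi_obs j (observation D t \<omega>)\<bar> ^ 4 < b)"
proof -
  let ?S = "{1..n} \<times> bar_ix X \<times> bar_ix X" and ?f = "\<lambda>(t, k, j) \<omega>. \<bar>Psi_prod D t \<omega> k j\<bar> ^ 4"
  have S: "finite ?S" "?S \<noteq> {}" using fin_bar None_bar_ix[of X] n by auto
  have f: "integrable P (?f i)" if "i \<in> ?S" for i using that Psi_prod_integrable by (cases i) auto
  have nn: "0 \<le> ?f i \<omega>" for i \<omega> by (cases i) simp
  have eq: "(MAX i\<in>?S. ?f i \<omega>) = (MAX (t, k, j)\<in>?S. \<bar>Psi_prod D t \<omega> k j\<bar> ^ 4)" for \<omega>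
    by (intro arg_cong[where f = Max] image_cong) auto
  have "expectation (\<lambda>\<omega>. MAX i\<in>?S. ?f i \<omega>) \<le> Mp"
    using prices unfolding regular_prices_def eq by blast
  then have lm: "likely P (Mp / b) (\<lambda>\<omega>. \<forall>i\<in>?S. ?f i \<omega> < b)" by (intro likely_Max[OF S f nn] b)
  show ?thesis
  proof (rule likely_mono[OF likely_conj[OF lm likely_AE[OF AE_Psi]]])
    fix \<omega>
    assume \<omega>: "(\<forall>i\<in>?S. ?f i \<omega> < b) \<and> (\<forall>t\<in>{1..n}. \<forall>j\<in>bar_ix X. Psi_prod D t \<omega> None j = Psi_obs j (observation D t \<omega>))"
    show "\<forall>t\<in>{1..n}. \<forall>j\<in>bar_ix X. \<bar>Psi_obs j (observation D t \<omega>)\<bar> ^ 4 < b"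
    proof (intro ballI)
      fix t j assume tj: "t \<in> {1..n}" "j \<in> bar_ix X"
      then have "?f (t, None, j) \<omega> < b" using \<omega> None_bar_ix[of X] by blast
      then show "\<bar>Psi_obs j (observation D t \<omega>)\<bar> ^ 4 < b" using \<omega> tj by simp
    qed
  qed simp
qed

section \<open>High-probability bounds for the empirical averages\<close>

lemma likely_maximal_noise:
  assumes l: "0 < l" "l \<le> real n"
  shows "likely P (3 * real (card X * card (bar_ix X)) * exp (- 4 * l)) (\<lambda>\<omega>.
    (\<forall>k\<in>X. \<forall>j\<in>bar_ix X. \<forall>t\<in>{1..n}. \<bar>noise_of k (observation D t \<omega>) * aug (cprice t \<omega>) j\<bar> \<le> sqrt (real n / l)) \<longrightarrow>
    (\<forall>k\<in>X. \<forall>j\<in>bar_ix X. \<bar>avg n (\<lambda>t. noise_of k (observation D t \<omega>) * aug (cprice t \<omega>) j)\<bar> \<le> (2 * (B ^ 4 * C) + 5) * sqrt (l / real n) \<and>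
       avg n (\<lambda>t. (noise_of k (observation D t \<omega>) * aug (cprice t \<omega>) j)\<^sup>2) \<le> 2 * (B ^ 4 * C) + 5))"
proof -
  define Z where "Z = (\<lambda>(k, j) t \<omega>. noise_of k (observation D t \<omega>) * aug (cprice t \<omega>) j)"
  have fourth: "integrable P (\<lambda>\<omega>. Z i t \<omega> ^ 4)" "expectation (\<lambda>\<omega>. Z i t \<omega> ^ 4) \<le> B ^ 4 * C"
    if i: "i \<in> X \<times> bar_ix X" and t: "t \<in> {1..n}" for i t
  proof -
    obtain k j where kj: "i = (k, j)" "k \<in> X" "j \<in> bar_ix X" using i by auto
    have le: "Z i t \<omega> ^ 4 \<le> B ^ 4 * noise_of k (observation D t \<omega>) ^ 4" for \<omega>
    proof -
      have "\<bar>aug (cprice t \<omega>) j\<bar> ^ 4 \<le> B ^ 4" unfolding cprice_def by (intro power_mono aug_clip_bound) simp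
      then show ?thesis by (simp add: Z_def kj power_mult_distrib mult.commute mult_right_mono)
    qed
    have i: "integrable P (\<lambda>\<omega>. B ^ 4 * noise_of k (observation D t \<omega>) ^ 4)"
      using noise_fourth[OF t kj(2)] by simp
    show int: "integrable P (\<lambda>\<omega>. Z i t \<omega> ^ 4)"
    proof (rule Bochner_Integration.integrable_bound[OF i])
      show "(\<lambda>\<omega>. Z i t \<omega> ^ 4) \<in> borel_measurable P"
        unfolding Z_def kj prod.case using noise_obs_measurable[OF t kj(2)] aug_cprice_measurable[OF t kj(3)] by simp
    qed (use le in \<open>auto intro!: AE_I2 simp: zero_le_power_eq\<close>)
    have "expectation (\<lambda>\<omega>. Z i t \<omega> ^ 4) \<le> expectation (\<lambda>\<omega>. B ^ 4 * noise_of k (observation D t \<omega>) ^ 4)"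
      by (rule integral_mono[OF int i le])
    also have "\<dots> \<le> B ^ 4 * C" using noise_fourth[OF t kj(2)] by (simp add: mult_left_mono)
    finally show "expectation (\<lambda>\<omega>. Z i t \<omega> ^ 4) \<le> B ^ 4 * C" .
  qed
  have indep: "indep_vars (\<lambda>_. borel) (Z i) {1..n}" if i: "i \<in> X \<times> bar_ix X" for i
  proof -
    obtain k j where kj: "i = (k, j)" "k \<in> X" "j \<in> bar_ix X" using i by (cases i) auto
    have "indep_vars (\<lambda>_. borel) (\<lambda>t \<omega>. noise_of k (observation D t \<omega>) * aug (clip (fst (observation D t \<omega>))) j) {1..n}"
      by (rule indep_vars_compose2[OF obs_indep, of "\<lambda>_ x. noise_of k x * aug (clip (fst x)) j"])
        (intro borel_measurable_times noise_of_measurable aug_obs_measurable kj)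
    then show ?thesis by (simp add: Z_def kj cprice_def)
  qed
  have mean: "expectation (Z i t) = 0" if i: "i \<in> X \<times> bar_ix X" and t: "t \<in> {1..n}" for i t
  proof -
    obtain k j where kj: "i = (k, j)" "k \<in> X" "j \<in> bar_ix X" using i by (cases i) auto
    show ?thesis
      using noise_orthogonal[OF t kj(2) aug_clip_measurable[OF kj(3)] aug_clip_bound]
      by (simp add: Z_def kj cprice_def mult.commute)
  qed
  have "0 \<le> B ^ 4 * C" using c by simp
  then have "likely P (3 * real (card (X \<times> bar_ix X)) * exp (- 4 * l)) (\<lambda>\<omega>.
      (\<forall>i\<in>X \<times> bar_ix X. \<forall>t\<in>{1..n}. \<bar>Z i t \<omega>\<bar> \<le> sqrt (real n / l)) \<longrightarrow>
      (\<forall>i\<in>X \<times> bar_ix X. \<bar>avg n (\<lambda>t. Z i t \<omega>)\<bar> \<le> (2 * (B ^ 4 * C) + 5) * sqrt (l / real n) \<and>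
         avg n (\<lambda>t. (Z i t \<omega>)\<^sup>2) \<le> 2 * (B ^ 4 * C) + 5))"
    unfolding likely_def
    by (rule maximal_inequality[OF finite_cartesian_product[OF finX fin_bar] n l])
      (rule indep fourth mean; assumption)+
  then show ?thesis unfolding card_cartesian_product by (simp add: Z_def)
qed

lemma likely_maximal_Psi:
  assumes l: "0 < l" "l \<le> real n"
  shows "likely P (3 * real (card (bar_ix X)) * exp (- 4 * l)) (\<lambda>\<omega>.
    (\<forall>j\<in>bar_ix X. \<forall>t\<in>{1..n}. \<bar>Psi_obs j (observation D t \<omega>) - of_bool (None = j)\<bar> \<le> sqrt (real n / l)) \<longrightarrow>
    (\<forall>j\<in>bar_ix X. \<bar>avg n (\<lambda>t. Psi_obs j (observation D t \<omega>) - of_bool (None = j))\<bar> \<le> (2 * (8 * (C + 1)) + 5) * sqrt (l / real n) \<and>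
       avg n (\<lambda>t. (Psi_obs j (observation D t \<omega>) - of_bool (None = j))\<^sup>2) \<le> 2 * (8 * (C + 1)) + 5))"
proof -
  define Z where "Z = (\<lambda>j t \<omega>. Psi_obs j (observation D t \<omega>) - of_bool (None = j))"
  \<comment> \<open>Centring costs a factor 8 in the fourth moment, hence the constant
    \<open>8 * (C + 1)\<close>.\<close>
  have four: "(x - d) ^ 4 \<le> 8 * (x ^ 4 + 1)" if "d = 0 \<or> d = 1" for x d :: real
  proof -
    have "(x - d) ^ 4 + (x + d) ^ 4 \<le> 8 * (x ^ 4 + d ^ 4)"
    proof -
      have "8 * (x ^ 4 + d ^ 4) - ((x - d) ^ 4 + (x + d) ^ 4) = 6 * (x\<^sup>2 - d\<^sup>2)\<^sup>2"
        by (simp add: power2_eq_square power4_eq_xxxx algebra_simps)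
      then show ?thesis using zero_le_power2[of "x\<^sup>2 - d\<^sup>2"] by linarith
    qed
    moreover have "(x - d) ^ 4 \<le> (x - d) ^ 4 + (x + d) ^ 4" by simp
    moreover have "8 * (x ^ 4 + d ^ 4) \<le> 8 * (x ^ 4 + 1)" using that by auto
    ultimately show ?thesis by (meson order_trans)
  qed
  have fourth: "integrable P (\<lambda>\<omega>. Z j t \<omega> ^ 4)" "expectation (\<lambda>\<omega>. Z j t \<omega> ^ 4) \<le> 8 * (C + 1)"
    if j: "j \<in> bar_ix X" and t: "t \<in> {1..n}" for j t
  proof -
    have le: "Z j t \<omega> ^ 4 \<le> 8 * (Psi_obs j (observation D t \<omega>) ^ 4 + 1)" for \<omega>
      unfolding Z_def by (rule four) simp
    have i: "integrable P (\<lambda>\<omega>. 8 * (Psi_obs j (observation D t \<omega>) ^ 4 + 1))"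
      using Psi_obs_power_integrable[OF t j] by simp
    show int: "integrable P (\<lambda>\<omega>. Z j t \<omega> ^ 4)"
    proof (rule Bochner_Integration.integrable_bound[OF i])
      show "(\<lambda>\<omega>. Z j t \<omega> ^ 4) \<in> borel_measurable P"
        unfolding Z_def using Psi_obs_obs_measurable[OF t j] by simp
    qed (use le in \<open>auto intro!: AE_I2 simp: zero_le_power_eq\<close>)
    have "expectation (\<lambda>\<omega>. Z j t \<omega> ^ 4) \<le> expectation (\<lambda>\<omega>. 8 * (Psi_obs j (observation D t \<omega>) ^ 4 + 1))"
      by (rule integral_mono[OF int i le])
    also have "\<dots> \<le> 8 * (C + 1)"
      using Psi_obs_power_integrable[OF t j] Psi_obs_fourth[OF t j] by (simp add: prob_space)
    finally show "expectation (\<lambda>\<omega>. Z j t \<omega> ^ 4) \<le> 8 * (C + 1)" .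
  qed
  have indep: "indep_vars (\<lambda>_. borel) (Z j) {1..n}" if "j \<in> bar_ix X" for j
    unfolding Z_def
    by (rule indep_vars_compose2[OF obs_indep, of "\<lambda>_ x. Psi_obs j x - of_bool (None = j)"])
      (intro borel_measurable_diff Psi_obs_measurable that borel_measurable_const)
  have mean: "expectation (Z j t) = 0" if "j \<in> bar_ix X" "t \<in> {1..n}" for j t
    unfolding Z_def using Psi_obs_mean[OF that(2,1)] Psi_obs_power_integrable[OF that(2,1), of 1]
    by (simp add: prob_space)
  have "0 \<le> 8 * (C + 1)" using c by simp
  then show ?thesis
    unfolding likely_def
    by (rule maximal_inequality[OF fin_bar n l])
      (rule indep[unfolded Z_def] fourth[unfolded Z_def] mean[unfolded Z_def]; assumption)+
qed

text \<open>The regressor \<open>None\<close> is 1, so this is the fourth power of the norm of the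
  population score, the first part of the objective in the second program. With only a fourth moment
  available, the bound goes through truncation of a nonnegative variable.\<close>

lemma likely_fourth_Psi:
  assumes b: "0 < b"
  shows "likely P (exp (- real n / b)) (\<lambda>\<omega>. (\<forall>t\<in>{1..n}. \<bar>Psi_obs None (observation D t \<omega>)\<bar> ^ 4 < b) \<longrightarrow>
    avg n (\<lambda>t. Psi_obs None (observation D t \<omega>) ^ 4) \<le> 2 * C + 1)"
proof -
  define Y where "Y = (\<lambda>t \<omega>. Psi_obs None (observation D t \<omega>) ^ 4)"
  let ?bad = "{\<omega>\<in>space P. (2 * C + 1) * real n \<le> (\<Sum>t=1..n. trunc b (Y t \<omega>))}"
  have indep: "indep_vars (\<lambda>_. borel) Y {1..n}"
    unfolding Y_def
    by (rule indep_vars_compose2[OF obs_indep, of "\<lambda>_ x. Psi_obs None x ^ 4"])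
      (intro borel_measurable_power Psi_obs_measurable None_bar_ix)
  have C: "0 \<le> C" using c by simp
  have pb: "prob ?bad \<le> exp (- real n / b)"
    by (rule nonneg_mean_tail[OF b C indep])
      (simp_all add: Y_def Psi_obs_power_integrable Psi_obs_fourth None_bar_ix)
  have "(\<lambda>\<omega>. \<Sum>t=1..n. trunc b (Y t \<omega>)) \<in> borel_measurable P"
    unfolding Y_def using Psi_obs_obs_measurable[OF _ None_bar_ix]
    by (intro borel_measurable_sum measurable_compose[OF _ trunc_measurable] borel_measurable_power) auto
  then have ev: "?bad \<in> events" by measurable
  show ?thesis
    unfolding likely_def
  proof (intro bexI[of _ "space P - ?bad"] conjI ballI impI)
    show "1 - exp (- real n / b) \<le> prob (space P - ?bad)" using pb prob_compl[OF ev] by linarith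
    fix \<omega> assume \<omega>: "\<omega> \<in> space P - ?bad" and lt: "\<forall>t\<in>{1..n}. \<bar>Psi_obs None (observation D t \<omega>)\<bar> ^ 4 < b"
    have "(\<Sum>t=1..n. trunc b (Y t \<omega>)) = (\<Sum>t=1..n. Y t \<omega>)"
    proof (intro sum.cong refl)
      fix t assume "t \<in> {1..n}"
      then have "\<bar>Psi_obs None (observation D t \<omega>)\<bar> ^ 4 < b" using lt by blast
      then show "trunc b (Y t \<omega>) = Y t \<omega>" by (simp add: trunc_def Y_def)
    qed
    moreover have "\<not> (2 * C + 1) * real n \<le> (\<Sum>t=1..n. trunc b (Y t \<omega>))" using \<omega> by blast
    ultimately have "(\<Sum>t=1..n. Y t \<omega>) \<le> (2 * C + 1) * real n" by linarith
    then show "avg n (\<lambda>t. Psi_obs None (observation D t \<omega>) ^ 4) \<le> 2 * C + 1"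
      using n by (simp add: avg_def Y_def divide_le_eq)
  qed (use ev in auto)
qed

text \<open>The expectations add up to the number of agents times (1 + C) / n, so Markov's
  inequality with a factor l above the mean fails with probability 1 / l. The sum over the agents is
  treated as one variable, without a union bound.\<close>

lemma likely_weighted_noise:
  assumes X: "X \<noteq> {}" and l: "0 < l"
  shows "likely P (1 / l) (\<lambda>\<omega>. (\<Sum>k\<in>X. (avg n (\<lambda>t. near_weight n X (\<lambda>s. cprice s \<omega>) t * noise_of k (observation D t \<omega>)))\<^sup>2)
    < real (card X) * ((1 + C) * (l / real n)))"
proof -
  let ?w = "\<lambda>t q. near_weight n X (\<lambda>s. clip (q s)) t"
  let ?Q = "\<lambda>\<omega>. \<lambda>s\<in>{1..n}. fst (observation D s \<omega>)"
  let ?g = "\<lambda>k \<omega>. (avg n (\<lambda>t. ?w t (?Q \<omega>) * noise_of k (observation D t \<omega>)))\<^sup>2"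
  have w: "?w t \<in> borel_measurable (PiM {1..n} (\<lambda>_. PiM X (\<lambda>_. borel)))" if "t \<in> {1..n}" for t
    unfolding near_weight_def
  proof (rule near_score_measurable[OF finX _ that])
    fix t k assume "t \<in> {1..n}" "k \<in> X"
    then have "(\<lambda>q. q t k) \<in> borel_measurable (PiM {1..n} (\<lambda>_. PiM X (\<lambda>_. borel)))"
      by (intro measurable_compose[where f = "\<lambda>q. q t" and g = "\<lambda>p. p k", OF measurable_component_singleton price_component])
    then show "(\<lambda>q. clip (q t) k) \<in> borel_measurable (PiM {1..n} (\<lambda>_. PiM X (\<lambda>_. borel)))"
      unfolding clip_def by (intro borel_measurable_max borel_measurable_min borel_measurable_const)
  qed
  have g: "integrable P (?g k)" "expectation (?g k) \<le> (1 + C) / real n" if k: "k \<in> X" for k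
  proof -
    note second = weighted_noise_second_moment[where C = C and B = "real n" and w = ?w, OF n
        obs_indep[unfolded observation_space_def] noise_of_measurable[OF k, unfolded observation_space_def]]
    have orth: "expectation (\<lambda>\<omega>. g (fst (observation D t \<omega>)) * noise_of k (observation D t \<omega>)) = 0"
      if "t \<in> {1..n}" "g \<in> borel_measurable (PiM X (\<lambda>_. borel))" "\<forall>p. \<bar>g p\<bar> \<le> b" for t g b
      using that by (intro noise_orthogonal[OF _ k]) auto
    show "integrable P (?g k)"
      by (rule second(1), erule noise_fourth(1)[OF _ k], erule noise_fourth(2)[OF _ k], erule (1) orth, blast,
          erule w, erule near_weight_bound, rule near_weight_norm)
    show "expectation (?g k) \<le> (1 + C) / real n"
      by (rule second(2), erule noise_fourth(1)[OF _ k], erule noise_fourth(2)[OF _ k], erule (1) orth, blast,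
          erule w, erule near_weight_bound, rule near_weight_norm)
  qed
  have "expectation (\<lambda>\<omega>. \<Sum>k\<in>X. ?g k \<omega>) = (\<Sum>k\<in>X. expectation (?g k))"
    using g(1) by (intro Bochner_Integration.integral_sum)
  also have "\<dots> \<le> (\<Sum>k\<in>X. (1 + C) / real n)" using g(2) by (rule sum_mono)
  finally have e: "expectation (\<lambda>\<omega>. \<Sum>k\<in>X. ?g k \<omega>) \<le> real (card X) * ((1 + C) / real n)" by simp
  have pos: "0 < card X" "0 < 1 + C" "0 < n" using X finX c n by (auto simp: card_gt_0_iff)
  have "likely P (real (card X) * ((1 + C) / real n) / (real (card X) * ((1 + C) * (l / real n))))
      (\<lambda>\<omega>. (\<Sum>k\<in>X. ?g k \<omega>) < real (card X) * ((1 + C) * (l / real n)))"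
    using g(1) e pos l by (intro likely_Markov) (auto intro!: sum_nonneg Bochner_Integration.integrable_sum)
  then show ?thesis
  proof (rule likely_mono)
    show "real (card X) * ((1 + C) / real n) / (real (card X) * ((1 + C) * (l / real n))) \<le> 1 / l"
      using pos l by (simp add: field_simps)
    fix \<omega> assume lt: "(\<Sum>k\<in>X. ?g k \<omega>) < real (card X) * ((1 + C) * (l / real n))"
    have "?w t (?Q \<omega>) = near_weight n X (\<lambda>s. cprice s \<omega>) t" if "t \<in> {1..n}" for t
      using that by (intro near_weight_cong) (auto simp: cprice_def)
    then have "avg n (\<lambda>t. ?w t (?Q \<omega>) * noise_of k (observation D t \<omega>)) =
        avg n (\<lambda>t. near_weight n X (\<lambda>s. cprice s \<omega>) t * noise_of k (observation D t \<omega>))" for k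
      by (intro avg_cong) simp
    then show "(\<Sum>k\<in>X. (avg n (\<lambda>t. near_weight n X (\<lambda>s. cprice s \<omega>) t * noise_of k (observation D t \<omega>)))\<^sup>2)
        < real (card X) * ((1 + C) * (l / real n))"
      using lt by simp
  qed
qed

end

section \<open>One regular instance: the debiased intercept and the regret\<close>

context regular_instance
begin

interpretation prob_space P by (rule prob)

text \<open>The failure probabilities add up to \<open>B ^ 4\<close> (noise maximum), 16 (score
  maximum) and 1 (fourth powers) times the moment ratio, and to 12 (maximal inequalities), 1 (second
  level for the scores) and 1 (weighted noise) over \<open>l\<close>. The bound is uniform over all
  solutions of both programs, so it applies to any selection.\<close>

lemma likely_v_check:
  fixes \<Lambda> :: real
  defines "l \<equiv> ln (real (card X))" and "K1 \<equiv> 2 * (B ^ 4 * C) + 2 * (8 * (C + 1)) + 5"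
    and "B1 \<equiv> (abar + pbar) / \<zeta> + 1 / \<zeta>"
  assumes p3: "3 \<le> card X" and l4: "4 * l \<le> real n"
    and lam: "sqrt (l / real n) \<le> lam n X" "lam n X \<le> \<Lambda> * sqrt (l / real n)"
    and small: "lam n X * (2 * K1 + 1) \<le> 1 / 2"
  shows "likely P ((B ^ 4 + 17) * (Me * Mp * l / real n) + 14 / l) (\<lambda>\<omega>. \<forall>Wh vh \<Psi>.
    step1_solution n X (\<lambda>t. price D t \<omega>) (\<lambda>t. cons D t \<omega>) Wh vh \<longrightarrow>
    step2_solution n X (\<lambda>t. price D t \<omega>) \<Psi> \<longrightarrow>
    (\<Sum>k\<in>X. (v_check n X (\<lambda>t. price D t \<omega>) (\<lambda>t. cons D t \<omega>) Wh vh \<Psi> k - v_vec D pbar k)\<^sup>2) \<le>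
      real (card X) * ((2 * ((2 * B1 + K1) * (\<Lambda> * (2 * K1)))\<^sup>2 + 2 * (2 * K1)\<^sup>2 * (2 * (1 + C) + 2 * K1)) * (l / real n)))"
proof -
  define p where "p = real (card X)"
  define L where "L = sqrt (real n / l)"
  have p: "3 \<le> p" using p3 by (simp add: p_def)
  have X: "X \<noteq> {}" using p3 by auto
  have l1: "1 \<le> l"
  proof -
    have "exp 1 \<le> p" using exp_le p by linarith
    then show ?thesis using p ln_ge_iff[of p 1] by (simp add: l_def p_def[symmetric])
  qed
  have l0: "0 < l" and ln': "l \<le> real n" and n0: "0 < real n" using l1 l4 n by linarith+
  have C0: "0 < C" using c by simp
  have K1: "1 \<le> K1" "2 * (B ^ 4 * C) + 5 \<le> K1" "2 * (8 * (C + 1)) + 5 \<le> K1" "2 * C + 1 \<le> K1"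
    using C0 by (auto simp: K1_def)
  have L2: "2 \<le> L" using l4 l0 by (auto simp: L_def le_divide_eq intro!: real_le_rsqrt)
  have L4: "L ^ 4 = (real n / l)\<^sup>2"
  proof -
    have "L ^ 4 = (L\<^sup>2)\<^sup>2" by simp
    also have "L\<^sup>2 = real n / l" using l0 by (simp add: L_def)
    finally show ?thesis .
  qed
  have B1': "1 \<le> B" by simp
  \<comment> \<open>The three levels: noise times a regressor of size at most \<open>B\<close> stays
    below \<open>L\<close>; a score below \<open>L / 2\<close> stays below \<open>L\<close> after
    centring by 1, as \<open>L\<close> is at least 2; and \<open>Mp * l\<close> is large enough for
    Markov's inequality to fail with probability 1 / l only.\<close>
  have LB: "0 < (L / B) ^ 4" "0 < (L / 2) ^ 4" "0 < Mp * l" using L2 B1' moments l0 by auto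
  define Q where "Q = Me * Mp * l / real n"
  have le_n: "l\<^sup>2 / (real n)\<^sup>2 \<le> l / real n"
    using ln' l0 n0 by (simp add: power2_eq_square field_simps)
  have \<kappa>1: "Me / (L / B) ^ 4 \<le> B ^ 4 * Q"
  proof -
    have "Me / (L / B) ^ 4 = B ^ 4 * (Me * (l\<^sup>2 / (real n)\<^sup>2))"
      using l0 n0 by (simp add: power_divide L4)
    also have "\<dots> \<le> B ^ 4 * (Me * Mp * (l / real n))"
      using le_n moments l0 n0 by (intro mult_left_mono mult_mono) auto
    finally show ?thesis by (simp add: Q_def)
  qed
  have Mpl: "Mp * (l / real n) \<le> Q"
    using mult_right_mono[OF moments(1), of "Mp * (l / real n)"] moments l0 n0 by (simp add: Q_def)
  have \<kappa>2: "Mp / (L / 2) ^ 4 \<le> 16 * Q"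
  proof -
    have "Mp / (L / 2) ^ 4 = 16 * (Mp * (l\<^sup>2 / (real n)\<^sup>2))"
      using l0 n0 by (simp add: power_divide L4)
    also have "\<dots> \<le> 16 * (Mp * (l / real n))"
      using le_n moments by (intro mult_left_mono) auto
    finally show ?thesis using Mpl by linarith
  qed
  have \<kappa>3: "exp (- real n / (Mp * l)) \<le> Q"
  proof -
    have pos: "0 < real n / (Mp * l)" using n0 LB(3) by simp
    have "real n / (Mp * l) \<le> exp (real n / (Mp * l))" using exp_ge_add_one_self[of "real n / (Mp * l)"] by linarith
    then have "inverse (exp (real n / (Mp * l))) \<le> inverse (real n / (Mp * l))" using pos by (rule le_imp_inverse_le)
    then have "exp (- real n / (Mp * l)) \<le> Mp * (l / real n)" by (simp add: exp_minus)
    then show ?thesis using Mpl by linarith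
  qed
  have card_bar: "real (card (bar_ix X)) = p + 1"
    unfolding bar_ix_def p_def using finX by (subst card_insert_disjoint) (auto simp: card_image)
  \<comment> \<open>\<open>exp (- 4 * l)\<close> is the inverse fourth power of the number p of
    observable agents, against p (p + 1) pairs and p + 1 rows. The resulting order 1 / p^2 is
    weakened to 1 / l to match the other terms.\<close>
  have \<kappa>4: "3 * real (card X * card (bar_ix X)) * exp (- 4 * l) + 3 * real (card (bar_ix X)) * exp (- 4 * l) \<le> 12 / l"
  proof -
    have "exp (4 * l) = p ^ 4"
      using p exp_of_nat_mult[of 4 l] by (simp add: l_def p_def[symmetric])
    then have e: "exp (- 4 * l) = 1 / p ^ 4" by (simp add: exp_minus inverse_eq_divide)
    have "3 * real (card X * card (bar_ix X)) * exp (- 4 * l) + 3 * real (card (bar_ix X)) * exp (- 4 * l) = 3 * (p + 1)\<^sup>2 / p ^ 4"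
      unfolding e of_nat_mult card_bar p_def[symmetric] by (simp add: power2_eq_square algebra_simps add_divide_distrib)
    also have "\<dots> \<le> 3 * (2 * p)\<^sup>2 / p ^ 4"
      using p by (intro divide_right_mono mult_left_mono power_mono) auto
    also have "\<dots> = 12 / p\<^sup>2" using p by (simp add: power2_eq_square power4_eq_xxxx field_simps)
    also have "\<dots> \<le> 12 / l"
    proof (rule divide_left_mono)
      have "l \<le> p" using ln_le_minus_one[of p] p by (simp add: l_def p_def[symmetric])
      also have "\<dots> \<le> p\<^sup>2" using p by (simp add: power2_eq_square)
      finally show "l \<le> p\<^sup>2" .
    qed (use p l0 in auto)
    finally show ?thesis .
  qed
  have \<kappa>5: "Mp / (Mp * l) = 1 / l" using moments by simp
  note ev = likely_conj[OF likely_AE[OF AE_good] likely_conj[OF likely_AE[OF AE_aug]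
      likely_conj[OF likely_eps[OF X LB(1)] likely_conj[OF likely_Psi[OF LB(2)] likely_conj[OF likely_Psi[OF LB(3)]
      likely_conj[OF likely_fourth_Psi[OF LB(3)] likely_conj[OF likely_weighted_noise[OF X l0]
      likely_conj[OF likely_maximal_noise[OF l0 ln'] likely_maximal_Psi[OF l0 ln']]]]]]]]]
  show ?thesis
  proof (rule likely_mono[OF ev], goal_cases)
    case 1
    show ?case using \<kappa>1 \<kappa>2 \<kappa>3 \<kappa>4 unfolding \<kappa>5 Q_def[symmetric] by (simp add: algebra_simps)
  next
    case (2 \<omega>)
    let ?p = "\<lambda>t. price D t \<omega>" and ?y = "\<lambda>t. cons D t \<omega>"
    have good: "cprice t \<omega> k = price D t \<omega> k" "noise_of k (observation D t \<omega>) = eps D t \<omega> k"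
      "cons D t \<omega> k = v_vec D pbar k - mv_on X W (price D t \<omega>) k + eps D t \<omega> k" if "t \<in> {1..n}" "k \<in> X" for t k
      using 2(2) that by blast+
    have aug: "aug (cprice t \<omega>) j = aug (price D t \<omega>) j" if "t \<in> {1..n}" "j \<in> bar_ix X" for t j
      using 2(2) that by blast
    have eps4: "\<bar>eps D t \<omega> k\<bar> ^ 4 < (L / B) ^ 4" if "t \<in> {1..n}" "k \<in> X" for t k using 2(2) that by blast
    have psi4: "\<bar>Psi_obs j (observation D t \<omega>)\<bar> ^ 4 < (L / 2) ^ 4" if "t \<in> {1..n}" "j \<in> bar_ix X" for t j
      using 2(2) that by blast
    have psi4': "\<bar>Psi_obs None (observation D t \<omega>)\<bar> ^ 4 < Mp * l" if "t \<in> {1..n}" for t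
      using 2(2) that None_bar_ix[of X] by blast
    have f4: "avg n (\<lambda>t. Psi_obs None (observation D t \<omega>) ^ 4) \<le> 2 * C + 1"
      using 2(2) psi4' by blast
    have wn: "(\<Sum>k\<in>X. (avg n (\<lambda>t. near_weight n X (\<lambda>s. cprice s \<omega>) t * noise_of k (observation D t \<omega>)))\<^sup>2)
        < real (card X) * ((1 + C) * (l / real n))" using 2(2) by blast
    have zb: "\<bar>noise_of k (observation D t \<omega>) * aug (cprice t \<omega>) j\<bar> \<le> L" if "t \<in> {1..n}" "k \<in> X" for t k j
    proof -
      have "\<bar>noise_of k (observation D t \<omega>)\<bar> \<le> L / B"
        using abs_le_of_power4_less[OF eps4[OF that]] L2 B1' good(2)[OF that] by simp
      then have "\<bar>noise_of k (observation D t \<omega>)\<bar> * \<bar>aug (cprice t \<omega>) j\<bar> \<le> L / B * B"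
        using L2 B1' unfolding cprice_def by (intro mult_mono aug_clip_bound) auto
      then show ?thesis using B1' by (simp add: abs_mult)
    qed
    have vb: "\<bar>Psi_obs j (observation D t \<omega>) - of_bool (None = j)\<bar> \<le> L" if "t \<in> {1..n}" "j \<in> bar_ix X" for t j
    proof -
      have "\<bar>Psi_obs j (observation D t \<omega>)\<bar> \<le> L / 2" using abs_le_of_power4_less[OF psi4[OF that]] L2 by simp
      moreover have "\<bar>of_bool (None = j) :: real\<bar> \<le> 1" by simp
      moreover have "\<bar>Psi_obs j (observation D t \<omega>) - of_bool (None = j)\<bar> \<le> \<bar>Psi_obs j (observation D t \<omega>)\<bar> + \<bar>of_bool (None = j)\<bar>"
        by (rule abs_triangle_ineq4)
      ultimately show ?thesis using L2 by linarith
    qed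
    have mz: "\<bar>avg n (\<lambda>t. noise_of k (observation D t \<omega>) * aug (cprice t \<omega>) j)\<bar> \<le> (2 * (B ^ 4 * C) + 5) * sqrt (l / real n)"
      "avg n (\<lambda>t. (noise_of k (observation D t \<omega>) * aug (cprice t \<omega>) j)\<^sup>2) \<le> 2 * (B ^ 4 * C) + 5"
      if "k \<in> X" "j \<in> bar_ix X" for k j
      using 2(2) zb that unfolding L_def by blast+
    have mv: "\<bar>avg n (\<lambda>t. Psi_obs j (observation D t \<omega>) - of_bool (None = j))\<bar> \<le> (2 * (8 * (C + 1)) + 5) * sqrt (l / real n)"
      "avg n (\<lambda>t. (Psi_obs j (observation D t \<omega>) - of_bool (None = j))\<^sup>2) \<le> 2 * (8 * (C + 1)) + 5"
      if "j \<in> bar_ix X" for j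
      using 2(2) vb that unfolding L_def by blast+
    have sc: "Psi_obs j (observation D t \<omega>) = score X ?p psi0 t * aug (?p t) j" if "t \<in> {1..n}" "j \<in> bar_ix X" for t j
      unfolding Psi_obs_score score_def using aug that by (auto intro!: sum.cong)
    have r0: "0 < sqrt (l / real n)" using l0 n0 by simp
    have r2: "(sqrt (l / real n))\<^sup>2 = l / real n" using l0 n0 by simp
    show ?case
    proof (intro allI impI)
      fix Wh vh \<Psi>
      assume s1: "step1_solution n X ?p ?y Wh vh" and s2: "step2_solution n X ?p \<Psi>"
      have "(\<Sum>k\<in>X. (v_check n X ?p ?y Wh vh \<Psi> k - v_vec D pbar k)\<^sup>2) \<le>
        real (card X) * ((2 * ((2 * B1 + K1) * (\<Lambda> * (2 * K1)))\<^sup>2 + 2 * (2 * K1)\<^sup>2 * (2 * (1 + C) + 2 * K1)) * (sqrt (l / real n))\<^sup>2)"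
      proof (rule v_check_total_error[where \<epsilon> = "\<lambda>t k. eps D t \<omega> k" and W = W and \<psi> = psi0,
            OF finX n K1(1) r0 _ lam small _ _ _ _ _ _ _ _ s1 s2])
        show "1 / real n \<le> (sqrt (l / real n))\<^sup>2" unfolding r2 using l1 n0 by (simp add: divide_right_mono)
        show "cons D t \<omega> k = v_vec D pbar k - mv_on X W (price D t \<omega>) k + eps D t \<omega> k" if "t \<in> {1..n}" "k \<in> X" for t k
          using good(3) that .
        show "\<bar>v_vec D pbar k\<bar> + (\<Sum>j\<in>X. \<bar>W k j\<bar>) \<le> B1" if "k \<in> X" for k
          using v_bound[OF that] W_row_sum[OF that] by (simp add: B1_def)
        fix j assume j: "j \<in> bar_ix X"
        have "avg n (\<lambda>t. Psi_obs j (observation D t \<omega>) - of_bool (None = j)) = avg n (\<lambda>t. score X ?p psi0 t * aug (?p t) j - of_bool (None = j))"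
          "avg n (\<lambda>t. (Psi_obs j (observation D t \<omega>) - of_bool (None = j))\<^sup>2) = avg n (\<lambda>t. (score X ?p psi0 t * aug (?p t) j - of_bool (None = j))\<^sup>2)"
          using sc[OF _ j] by (intro avg_cong; simp)+
        then show "\<bar>avg n (\<lambda>t. score X ?p psi0 t * aug (?p t) j - of_bool (None = j))\<bar> \<le> K1 * sqrt (l / real n)"
          "avg n (\<lambda>t. (score X ?p psi0 t * aug (?p t) j - of_bool (None = j))\<^sup>2) \<le> K1"
          using mv[OF j] mult_right_mono[OF K1(3) less_imp_le[OF r0]] K1(3) by linarith+
        fix k assume k: "k \<in> X"
        have "avg n (\<lambda>t. noise_of k (observation D t \<omega>) * aug (cprice t \<omega>) j) = avg n (\<lambda>t. eps D t \<omega> k * aug (?p t) j)"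
          "avg n (\<lambda>t. (noise_of k (observation D t \<omega>) * aug (cprice t \<omega>) j)\<^sup>2) = avg n (\<lambda>t. (eps D t \<omega> k * aug (?p t) j)\<^sup>2)"
          using good(2)[OF _ k] aug[OF _ j] by (intro avg_cong; simp)+
        then show "\<bar>avg n (\<lambda>t. eps D t \<omega> k * aug (?p t) j)\<bar> \<le> K1 * sqrt (l / real n)"
          "avg n (\<lambda>t. (eps D t \<omega> k * aug (?p t) j)\<^sup>2) \<le> K1"
          using mz[OF k j] mult_right_mono[OF K1(2) less_imp_le[OF r0]] K1(2) by linarith+
      next
        have "avg n (\<lambda>t. Psi_obs None (observation D t \<omega>) ^ 4) = avg n (\<lambda>t. score X ?p psi0 t ^ 4)"
          using sc[OF _ None_bar_ix] by (intro avg_cong) (simp add: aug_def)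
        then show "avg n (\<lambda>t. score X ?p psi0 t ^ 4) \<le> K1" using f4 K1(4) by linarith
        have nw: "near_weight n X (\<lambda>s. cprice s \<omega>) t = near_weight n X ?p t" if "t \<in> {1..n}" for t
          using that good(1) by (intro near_weight_cong) auto
        have "(\<Sum>k\<in>X. (avg n (\<lambda>t. near_weight n X (\<lambda>s. cprice s \<omega>) t * noise_of k (observation D t \<omega>)))\<^sup>2)
          = (\<Sum>k\<in>X. (avg n (\<lambda>t. near_weight n X ?p t * eps D t \<omega> k))\<^sup>2)"
          using nw good(2) by (intro sum.cong refl arg_cong[where f = "\<lambda>x. x\<^sup>2"] avg_cong) simp
        then show "(\<Sum>k\<in>X. (avg n (\<lambda>t. near_weight n X ?p t * eps D t \<omega> k))\<^sup>2) \<le> real (card X) * ((1 + C) * (sqrt (l / real n))\<^sup>2)"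
          unfolding r2 using wn by linarith
      qed
      then show "(\<Sum>k\<in>X. (v_check n X ?p ?y Wh vh \<Psi> k - v_vec D pbar k)\<^sup>2) \<le>
        real (card X) * ((2 * ((2 * B1 + K1) * (\<Lambda> * (2 * K1)))\<^sup>2 + 2 * (2 * K1)\<^sup>2 * (2 * (1 + C) + 2 * K1)) * (l / real n))"
        unfolding r2 .
    qed
  qed
qed

text \<open>The intercept contributes l / n, thresholding contributes s^2 l / n and r^2. The first
  is absorbed by the second because \<open>s\<close> is at least 1.\<close>

lemma regret_rate:
  fixes Cv \<beta>0 :: real
  defines "l \<equiv> ln (real (card X))" and "c0 \<equiv> \<zeta> / (4 * bbar)\<^sup>2"
  assumes p3: "3 \<le> card X" and t: "t \<in> {1..n}" and opt: "optimal_prices D pbar t pstar"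
    and interior: "\<And>k. k \<in> X \<Longrightarrow> 0 < pstar k \<and> pstar k < pbar"
    and approx: "sparse_approximable_on X W s r"
    and err: "\<And>k j. k \<in> X \<Longrightarrow> j \<in> X \<Longrightarrow> 2 * \<bar>Wc k j - W k j\<bar> \<le> \<mu> k j \<and> \<mu> k j \<le> \<beta>0 * sqrt (l / real n)"
    and small: "3 / 2 * real s * (\<beta>0 * sqrt (l / real n)) + r \<le> c0 / 2"
    and v: "(\<Sum>k\<in>X. (vc k - v_vec D pbar k)\<^sup>2) \<le> real (card X) * (Cv * (l / real n))" and Cv: "0 \<le> Cv"
  shows "regret D pbar t pstar (price_estimate X pbar (threshold \<mu> Wc) vc) \<le>
    8 * bbar / (\<zeta> * pbar\<^sup>2) * ((2 * Cv + 8 * pbar\<^sup>2 * (9 / 2 * \<beta>0\<^sup>2 + 2)) / c0\<^sup>2) * ((real s)\<^sup>2 * l / real n + r\<^sup>2)"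
proof -
  have X: "X \<noteq> {}" using p3 by auto
  have bb: "0 < bbar" using X bbar_pos by blast
  have c0: "0 < c0" using bb \<zeta> by (simp add: c0_def)
  have card: "0 < real (card X)" using p3 by simp
  have l0: "0 \<le> l" using p3 by (simp add: l_def)
  define \<rho>2 where "\<rho>2 = l / real n"
  define S where "S = (\<Sum>k\<in>X. (price_estimate X pbar (threshold \<mu> Wc) vc k - pstar k)\<^sup>2)"
  define \<delta> where "\<delta> = 3 / 2 * real s * (\<beta>0 * sqrt (l / real n)) + r"
  have \<rho>2: "0 \<le> \<rho>2" using l0 by (simp add: \<rho>2_def)
  have r0: "0 \<le> r" by (rule sparse_approximation_bounds(1)[OF X approx])
  \<comment> \<open>\<open>s = 0\<close> would give \<open>c0 \<le> r\<close>, against the smallness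
    of \<open>r\<close>.\<close>
  have s1: "1 \<le> s"
  proof (rule ccontr)
    assume "\<not> 1 \<le> s"
    then have s0: "s = 0" by simp
    then have "c0 \<le> r" unfolding c0_def by (rule sparse_approximation_bounds(2)[OF X approx])
    then show False using small c0 unfolding s0 by simp
  qed
  have "c0\<^sup>2 * S \<le> 2 * (\<Sum>k\<in>X. (vc k - v_vec D pbar k)\<^sup>2) + 2 * real (card X) * (2 * \<delta> * pbar)\<^sup>2"
    unfolding S_def c0_def \<delta>_def
    by (rule price_estimate_error[OF X t opt interior approx err small[unfolded c0_def]])
  also have "\<dots> \<le> 2 * (real (card X) * (Cv * \<rho>2)) + 2 * real (card X) * (2 * \<delta> * pbar)\<^sup>2"
    using v by (simp add: \<rho>2_def)
  also have "\<dots> = real (card X) * (2 * Cv * \<rho>2 + 8 * pbar\<^sup>2 * \<delta>\<^sup>2)"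
    by (simp add: power_mult_distrib algebra_simps)
  also have "\<dots> \<le> real (card X) * (2 * Cv * ((real s)\<^sup>2 * \<rho>2 + r\<^sup>2) + 8 * pbar\<^sup>2 * ((9 / 2 * \<beta>0\<^sup>2 + 2) * ((real s)\<^sup>2 * \<rho>2 + r\<^sup>2)))"
  proof (intro mult_left_mono add_mono)
    have "1 * \<rho>2 \<le> (real s)\<^sup>2 * \<rho>2" using s1 \<rho>2 by (intro mult_right_mono) auto
    then show "\<rho>2 \<le> (real s)\<^sup>2 * \<rho>2 + r\<^sup>2" using zero_le_power2[of r] by linarith
    have "\<delta>\<^sup>2 \<le> 2 * (3 / 2 * real s * (\<beta>0 * sqrt \<rho>2))\<^sup>2 + 2 * r\<^sup>2"
      using sum_squares_bound[of "3 / 2 * real s * (\<beta>0 * sqrt \<rho>2)" r] by (simp add: \<delta>_def \<rho>2_def power2_sum)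
    also have "(3 / 2 * real s * (\<beta>0 * sqrt \<rho>2))\<^sup>2 = 9 / 4 * \<beta>0\<^sup>2 * ((real s)\<^sup>2 * \<rho>2)"
      using \<rho>2 by (simp add: power_mult_distrib power2_eq_square)
    also have "2 * (9 / 4 * \<beta>0\<^sup>2 * ((real s)\<^sup>2 * \<rho>2)) + 2 * r\<^sup>2 \<le> (9 / 2 * \<beta>0\<^sup>2 + 2) * ((real s)\<^sup>2 * \<rho>2 + r\<^sup>2)"
    proof -
      have "(9 / 2 * b + 2) * (x + y) = 2 * (9 / 4 * b * x) + 2 * y + (9 / 2 * b * y + 2 * x)" for b x y :: real
        by (simp add: field_simps)
      moreover have "0 \<le> 9 / 2 * \<beta>0\<^sup>2 * r\<^sup>2 + 2 * ((real s)\<^sup>2 * \<rho>2)" using \<rho>2 by simp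
      ultimately show ?thesis by simp
    qed
    finally show "\<delta>\<^sup>2 \<le> (9 / 2 * \<beta>0\<^sup>2 + 2) * ((real s)\<^sup>2 * \<rho>2 + r\<^sup>2)" .
  qed (use Cv in auto)
  also have "\<dots> = real (card X) * ((2 * Cv + 8 * pbar\<^sup>2 * (9 / 2 * \<beta>0\<^sup>2 + 2)) * ((real s)\<^sup>2 * \<rho>2 + r\<^sup>2))"
  proof -
    have "real (card X) * (2 * Cv * e + 8 * pbar\<^sup>2 * (b * e)) = real (card X) * ((2 * Cv + 8 * pbar\<^sup>2 * b) * e)" for b e
      by (simp add: algebra_simps)
    then show ?thesis by (simp only:)
  qed
  finally have "c0\<^sup>2 * S \<le> real (card X) * ((2 * Cv + 8 * pbar\<^sup>2 * (9 / 2 * \<beta>0\<^sup>2 + 2)) * ((real s)\<^sup>2 * \<rho>2 + r\<^sup>2))" .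
  then have "S / real (card X) \<le> (2 * Cv + 8 * pbar\<^sup>2 * (9 / 2 * \<beta>0\<^sup>2 + 2)) / c0\<^sup>2 * ((real s)\<^sup>2 * \<rho>2 + r\<^sup>2)"
    using card c0 by (simp add: divide_le_eq le_divide_eq mult_ac)
  then have "8 * bbar / (\<zeta> * pbar\<^sup>2) * (S / real (card X)) \<le>
      8 * bbar / (\<zeta> * pbar\<^sup>2) * ((2 * Cv + 8 * pbar\<^sup>2 * (9 / 2 * \<beta>0\<^sup>2 + 2)) / c0\<^sup>2 * ((real s)\<^sup>2 * \<rho>2 + r\<^sup>2))"
    using bb \<zeta> by (intro mult_left_mono) auto
  moreover have "regret D pbar t pstar (price_estimate X pbar (threshold \<mu> Wc) vc) \<le> 8 * bbar / (\<zeta> * pbar\<^sup>2) * (S / real (card X))"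
    unfolding S_def by (rule regret_bound[OF t opt interior X price_estimate_box])
  ultimately show ?thesis by (simp add: \<rho>2_def mult.assoc)
qed

end

section \<open>The limit: all constants are shared by the instances, and the failure probabilities
  vanish\<close>

theorem theorem4:
  fixes D :: "nat \<Rightarrow> ('v, 'w) pricing"
    and pbar abar bbar \<zeta> C\<^sub>0 :: real
    and s period :: "nat \<Rightarrow> nat"
    and r1 M\<epsilon> M\<Psi> :: "nat \<Rightarrow> real"
    and pstar :: "nat \<Rightarrow> 'v \<Rightarrow> real"
    and What :: "nat \<Rightarrow> 'w \<Rightarrow> 'v \<Rightarrow> 'v \<Rightarrow> real"
    and vhat :: "nat \<Rightarrow> 'w \<Rightarrow> 'v \<Rightarrow> real"
    and Psihat :: "nat \<Rightarrow> 'w \<Rightarrow> 'v option \<Rightarrow> 'v option \<Rightarrow> real"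
    and \<mu> :: "nat \<Rightarrow> 'w \<Rightarrow> 'v \<Rightarrow> 'v \<Rightarrow> real"
    and Wcheck :: "nat \<Rightarrow> 'w \<Rightarrow> 'v \<Rightarrow> 'v \<Rightarrow> real"
    and vcheck phat :: "nat \<Rightarrow> 'w \<Rightarrow> 'v \<Rightarrow> real"
  assumes "0 < pbar" and "0 < \<zeta>"
    and model: "\<And>n. n \<ge> 1 \<Longrightarrow> pricing_model pbar abar bbar \<zeta> n (D n)"
    and approx: "\<And>n. n \<ge> 1 \<Longrightarrow> sparse_approximable_on (VO (D n)) (H_inv (D n)) (s n) (r1 n)"
    and design: "regular_design pbar s M\<epsilon> M\<Psi> D"
    and period: "\<And>n. n \<ge> 1 \<Longrightarrow> period n \<in> {1..n}"
    and optimal: "\<And>n. n \<ge> 1 \<Longrightarrow> optimal_prices (D n) pbar (period n) (pstar n)"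
    and interior: "\<And>n k. n \<ge> 1 \<Longrightarrow> k \<in> VO (D n) \<Longrightarrow> 0 < pstar n k \<and> pstar n k < pbar"
    and rate: "(\<lambda>n. real (s n) * sqrt (ln (real (card (VO (D n)))) / real n) + r1 n) \<in> o(\<lambda>_. 1)"
    and step1: "\<And>n \<omega>. n \<ge> 1 \<Longrightarrow> \<omega> \<in> space (pspace (D n)) \<Longrightarrow>
      step1_solution n (VO (D n)) (\<lambda>t. price (D n) t \<omega>) (\<lambda>t. cons (D n) t \<omega>) (What n \<omega>) (vhat n \<omega>)"
    and step2: "\<And>n \<omega>. n \<ge> 1 \<Longrightarrow> \<omega> \<in> space (pspace (D n)) \<Longrightarrow>
      step2_solution n (VO (D n)) (\<lambda>t. price (D n) t \<omega>) (Psihat n \<omega>)"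
    and step3: "\<And>n \<omega>. Wcheck n \<omega> = W_check n (VO (D n)) (\<lambda>t. price (D n) t \<omega>)
        (\<lambda>t. cons (D n) t \<omega>) (What n \<omega>) (vhat n \<omega>) (Psihat n \<omega>)"
      "\<And>n \<omega>. vcheck n \<omega> = v_check n (VO (D n)) (\<lambda>t. price (D n) t \<omega>)
        (\<lambda>t. cons (D n) t \<omega>) (What n \<omega>) (vhat n \<omega>) (Psihat n \<omega>)"
    and "0 < C\<^sub>0"
    and thresholds: "whp (\<lambda>n. pspace (D n)) (\<lambda>n \<omega>. \<forall>k\<in>VO (D n). \<forall>j\<in>VO (D n).
      2 * \<bar>Wcheck n \<omega> k j - H_inv (D n) k j\<bar> \<le> \<mu> n \<omega> k j \<and>
      \<mu> n \<omega> k j \<le> C\<^sub>0 * sqrt (ln (real (card (VO (D n)))) / real n))"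
    and phat: "\<And>n \<omega>. phat n \<omega> =
      price_estimate (VO (D n)) pbar (threshold (\<mu> n \<omega>) (Wcheck n \<omega>)) (vcheck n \<omega>)"
  shows "\<exists>C\<^sub>1>0. whp (\<lambda>n. pspace (D n)) (\<lambda>n \<omega>.
      regret (D n) pbar (period n) (pstar n) (phat n \<omega>)
        \<le> C\<^sub>1 * ((real (s n))\<^sup>2 * ln (real (card (VO (D n)))) / real n + (r1 n)\<^sup>2))"
proof -
  define l where "l = (\<lambda>n. ln (real (card (VO (D n)))))"
  from design obtain c C C' K where c: "0 < c" "c < C" "0 < C'"
    and inst: "\<And>n. n \<ge> 1 \<Longrightarrow> 1 \<le> M\<epsilon> n \<and> 1 \<le> M\<Psi> n \<and> regular_sampling pbar n (D n) \<and>
        regular_noise c C (M\<epsilon> n) n (D n) \<and> regular_prices c C K (M\<Psi> n) n (D n) \<and>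
        ln (real n) \<le> C' * l n"
    and moments: "(\<lambda>n. M\<epsilon> n * M\<Psi> n * l n) \<in> o(\<lambda>n. real n)"
    unfolding regular_design_def l_def by blast
  have reg: "regular_instance pbar abar bbar \<zeta> n (D n) c C K (M\<epsilon> n) (M\<Psi> n)" if "n \<ge> 1" for n
    using that \<open>0 < pbar\<close> \<open>0 < \<zeta>\<close> model[OF that] inst[OF that] c
    by (intro regular_instance.intro sampled_pricing.intro pricing_instance.intro
        sampled_pricing_axioms.intro regular_instance_axioms.intro) auto
  define B where "B = max 1 pbar"
  define K1 where "K1 = 2 * (B ^ 4 * C) + 2 * (8 * (C + 1)) + 5"
  define B1 where "B1 = (abar + pbar) / \<zeta> + 1 / \<zeta>"
  define \<Lambda> where "\<Lambda> = sqrt (4 * (6 + C'))"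
  define Cv where "Cv = 2 * ((2 * B1 + K1) * (\<Lambda> * (2 * K1)))\<^sup>2 + 2 * (2 * K1)\<^sup>2 * (2 * (1 + C) + 2 * K1)"
  define c0 where "c0 = \<zeta> / (4 * bbar)\<^sup>2"
  define C1 where "C1 = 8 * bbar / (\<zeta> * pbar\<^sup>2) * ((2 * Cv + 8 * pbar\<^sup>2 * (9 / 2 * C\<^sub>0\<^sup>2 + 2)) / c0\<^sup>2)"
  have K1: "0 < K1" using c by (simp add: K1_def B_def add_pos_nonneg)
  have Cv: "0 \<le> Cv" using K1 c by (simp add: Cv_def)

  \<comment> \<open>By ln n \<le> C' l the number of observable agents grows at least like a power
    of n, so \<open>l\<close> diverges and the failure terms 1 / l vanish.\<close>
  have l_top: "filterlim l at_top sequentially"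
  proof (rule filterlim_at_top_mono)
    show "filterlim (\<lambda>n. 1 / C' * ln (real n)) at_top sequentially"
      by (rule filterlim_tendsto_pos_mult_at_top[OF tendsto_const _ filterlim_compose[OF ln_at_top filterlim_real_sequentially]])
        (use c(3) in simp)
    show "\<forall>\<^sub>F n in sequentially. 1 / C' * ln (real n) \<le> l n"
      using eventually_ge_at_top[of 1] by eventually_elim (use inst c(3) in \<open>simp add: divide_le_eq mult.commute\<close>)
  qed
  have inv_l: "(\<lambda>n. 1 / l n) \<longlonglongrightarrow> 0"
    by (rule tendsto_divide_0[OF tendsto_const filterlim_at_top_imp_at_infinity[OF l_top]])
  define Q where "Q = (\<lambda>n. M\<epsilon> n * M\<Psi> n * l n / real n)"
  have Q0: "Q \<longlonglongrightarrow> 0"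
    unfolding Q_def by (rule smalloD_tendsto[OF moments])
  have l_pos: "\<forall>\<^sub>F n in sequentially. 3 \<le> l n"
    using l_top by (simp add: filterlim_at_top)
  \<comment> \<open>Both moment bounds are at least 1, so the ratio \<open>Q\<close>, which tends to
    zero, also dominates l / n.\<close>
  have l_le_Q: "\<forall>\<^sub>F n in sequentially. 0 \<le> l n / real n \<and> l n / real n \<le> Q n"
    using l_pos eventually_ge_at_top[of 1]
  proof eventually_elim
    case (elim n)
    have "1 * 1 \<le> M\<epsilon> n * M\<Psi> n" using inst[OF elim(2)] by (intro mult_mono) auto
    then have "1 * (l n / real n) \<le> M\<epsilon> n * M\<Psi> n * (l n / real n)" using elim by (intro mult_right_mono) auto
    then show ?case using elim by (simp add: Q_def)
  qed
  have ln0: "(\<lambda>n. l n / real n) \<longlonglongrightarrow> 0"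
    by (rule tendsto_sandwich[OF _ _ tendsto_const Q0]) (use l_le_Q in \<open>auto elim: eventually_mono\<close>)
  have \<rho>0: "(\<lambda>n. sqrt (l n / real n)) \<longlonglongrightarrow> 0"
    using tendsto_real_sqrt[OF ln0] by simp
  have card3: "\<forall>\<^sub>F n in sequentially. 3 \<le> card (VO (D n))"
    using l_pos
  proof eventually_elim
    case (elim n)
    then have "0 < card (VO (D n))" by (cases "card (VO (D n)) = 0") (auto simp: l_def)
    then have "l n \<le> real (card (VO (D n))) - 1" unfolding l_def by (intro ln_le_minus_one) simp
    then show ?case using elim by linarith
  qed
  \<comment> \<open>Positivity of \<open>bbar\<close> has to be read off from an agent. The bound is
    common to all n, so one n with observable agents suffices.\<close>
  have bbar: "0 < bbar"
  proof -
    obtain n where nn: "n \<ge> 1" "3 \<le> card (VO (D n))"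
      using eventually_happens[OF eventually_conj[OF eventually_ge_at_top[of 1] card3]] by auto
    interpret regular_instance pbar abar bbar \<zeta> n "D n" c C K "M\<epsilon> n" "M\<Psi> n" by (rule reg[OF nn(1)])
    have "VO (D n) \<noteq> {}" using nn(2) by auto
    then show ?thesis using bbar_pos by blast
  qed
  have c0: "0 < c0" using bbar \<open>0 < \<zeta>\<close> by (simp add: c0_def)
  define \<sigma> where "\<sigma> = (\<lambda>n. real (s n) * sqrt (l n / real n) + r1 n)"
  have \<sigma>0: "\<sigma> \<longlonglongrightarrow> 0"
    using smalloD_tendsto[OF rate] by (simp add: \<sigma>_def l_def)
  \<comment> \<open>The factor majorizes the coefficients of both nonnegative summands of
    \<open>\<sigma> n\<close> in the row-sum error of the thresholded matrix.\<close>
  have "\<forall>\<^sub>F n in sequentially. (3 / 2 * C\<^sub>0 + 1) * \<sigma> n < c0 / 2"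
    using tendsto_mult_right_zero[OF \<sigma>0, of "3 / 2 * C\<^sub>0 + 1"] c0 by (intro order_tendstoD(2)[where y = 0]) auto
  then have small\<delta>: "\<forall>\<^sub>F n in sequentially. 3 / 2 * real (s n) * (C\<^sub>0 * sqrt (l n / real n)) + r1 n \<le> c0 / 2"
    using card3 eventually_ge_at_top[of 1]
  proof eventually_elim
    case (elim n)
    interpret regular_instance pbar abar bbar \<zeta> n "D n" c C K "M\<epsilon> n" "M\<Psi> n" by (rule reg[OF elim(3)])
    have "VO (D n) \<noteq> {}" using elim(2) by auto
    then have "0 \<le> r1 n" using sparse_approximation_bounds(1) approx[OF elim(3)] by blast
    moreover have "0 \<le> l n" using elim(2) by (simp add: l_def)
    ultimately have "0 \<le> real (s n) * sqrt (l n / real n)" "0 \<le> 3 / 2 * C\<^sub>0 * r1 n" using \<open>0 < C\<^sub>0\<close> by auto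
    then show ?case using elim(1) by (simp add: \<sigma>_def algebra_simps)
  qed
  have "\<forall>\<^sub>F n in sequentially. \<Lambda> * (2 * K1 + 1) * sqrt (l n / real n) < 1 / 2"
    using tendsto_mult_right_zero[OF \<rho>0, of "\<Lambda> * (2 * K1 + 1)"] by (intro order_tendstoD(2)[where y = 0]) auto
  moreover have "\<forall>\<^sub>F n in sequentially. l n / real n < 1 / 4"
    by (rule order_tendstoD(2)[OF ln0]) simp
  ultimately have "\<forall>\<^sub>F n in sequentially. 1 \<le> n \<and> 3 \<le> card (VO (D n)) \<and> 4 * l n \<le> real n \<and>
      \<Lambda> * (2 * K1 + 1) * sqrt (l n / real n) \<le> 1 / 2 \<and>
      3 / 2 * real (s n) * (C\<^sub>0 * sqrt (l n / real n)) + r1 n \<le> c0 / 2"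
    using card3 small\<delta> eventually_ge_at_top[of 1]
    by eventually_elim (auto simp: divide_less_eq)
  then obtain N where N: "\<And>n. N \<le> n \<Longrightarrow> 1 \<le> n \<and> 3 \<le> card (VO (D n)) \<and> 4 * l n \<le> real n \<and>
      \<Lambda> * (2 * K1 + 1) * sqrt (l n / real n) \<le> 1 / 2 \<and>
      3 / 2 * real (s n) * (C\<^sub>0 * sqrt (l n / real n)) + r1 n \<le> c0 / 2"
    unfolding eventually_sequentially by blast

  define \<kappa> where "\<kappa> = (\<lambda>n. (B ^ 4 + 17) * Q n + 14 / l n)"
  have \<kappa>0: "\<kappa> \<longlonglongrightarrow> 0"
    unfolding \<kappa>_def using tendsto_add[OF tendsto_mult_right_zero[OF Q0, of "B ^ 4 + 17"] tendsto_mult_right_zero[OF inv_l, of 14]] by simp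
  define good where "good = (\<lambda>n \<omega>. (\<Sum>k\<in>VO (D n). (vcheck n \<omega> k - v_vec (D n) pbar k)\<^sup>2) \<le> real (card (VO (D n))) * (Cv * (l n / real n)))"
  have likely: "likely (pspace (D n)) (\<kappa> n) (good n)" if n: "N \<le> n" for n
  proof -
    note Nn = N[OF n]
    then have n1: "1 \<le> n" by blast
    interpret regular_instance pbar abar bbar \<zeta> n "D n" c C K "M\<epsilon> n" "M\<Psi> n" by (rule reg[OF n1])
    have lam: "sqrt (l n / real n) \<le> lam n X" "lam n X \<le> \<Lambda> * sqrt (l n / real n)"
      unfolding \<Lambda>_def l_def using Nn inst[OF n1] by (intro lam_bounds; simp add: l_def)+
    have "lam n X * (2 * K1 + 1) \<le> \<Lambda> * sqrt (l n / real n) * (2 * K1 + 1)"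
      using lam(2) K1 by (intro mult_right_mono) auto
    also have "\<dots> \<le> 1 / 2" using Nn by (simp add: mult_ac)
    finally have small: "lam n X * (2 * K1 + 1) \<le> 1 / 2" .
    have "likely (pspace (D n)) (\<kappa> n) (\<lambda>\<omega>. \<forall>Wh vh \<Psi>.
      step1_solution n X (\<lambda>t. price (D n) t \<omega>) (\<lambda>t. cons (D n) t \<omega>) Wh vh \<longrightarrow>
      step2_solution n X (\<lambda>t. price (D n) t \<omega>) \<Psi> \<longrightarrow>
      (\<Sum>k\<in>X. (v_check n X (\<lambda>t. price (D n) t \<omega>) (\<lambda>t. cons (D n) t \<omega>) Wh vh \<Psi> k - v_vec (D n) pbar k)\<^sup>2) \<le>
        real (card X) * (Cv * (l n / real n)))"
      unfolding \<kappa>_def Q_def Cv_def B_def K1_def B1_def l_def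
      by (rule likely_v_check) (use Nn lam small in \<open>simp_all only: l_def K1_def B_def\<close>)
    then show ?thesis
      by (rule likely_mono) (use step1[OF n1] step2[OF n1] in \<open>auto simp: good_def step3(2)\<close>)
  qed
  from thresholds obtain A where A: "\<And>n. A n \<in> sets (pspace (D n))"
    "\<And>n \<omega>. \<omega> \<in> A n \<Longrightarrow> \<forall>k\<in>VO (D n). \<forall>j\<in>VO (D n). 2 * \<bar>Wcheck n \<omega> k j - H_inv (D n) k j\<bar> \<le> \<mu> n \<omega> k j \<and>
      \<mu> n \<omega> k j \<le> C\<^sub>0 * sqrt (l n / real n)"
    "(\<lambda>n. measure (pspace (D n)) (A n)) \<longlonglongrightarrow> 1"
    unfolding whp_def l_def by blast
  \<comment> \<open>For n below \<open>N\<close> the event is empty, so that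
    \<open>N \<le> n\<close> may be used at each of its points; otherwise it is the threshold event
    intersected with one for the intercept, at a loss of at most \<open>\<kappa> n\<close>.\<close>
  have "\<exists>F. F \<in> sets (pspace (D n)) \<and> F \<subseteq> A n \<and> (\<forall>\<omega>\<in>F. N \<le> n \<and> good n \<omega>) \<and>
      (N \<le> n \<longrightarrow> measure (pspace (D n)) (A n) - \<kappa> n \<le> measure (pspace (D n)) F \<and> measure (pspace (D n)) F \<le> 1)" for n
  proof (cases "N \<le> n")
    case True
    then have n1: "1 \<le> n" using N by blast
    interpret prob_space "pspace (D n)"
      using model[OF n1] unfolding pricing_model_def by blast
    have "likely (pspace (D n)) (1 - measure (pspace (D n)) (A n)) (\<lambda>\<omega>. \<omega> \<in> A n)"
      unfolding likely_def using A(1) by auto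
    from likely_conj[OF this likely[OF True]]
    obtain F where "F \<in> sets (pspace (D n))" "1 - ((1 - measure (pspace (D n)) (A n)) + \<kappa> n) \<le> measure (pspace (D n)) F"
      "\<forall>\<omega>\<in>F. \<omega> \<in> A n \<and> good n \<omega>"
      unfolding likely_def by blast
    then show ?thesis using True by (intro exI[of _ F]) auto
  qed (auto intro!: exI[of _ "{}"])
  then obtain F where F: "\<And>n. F n \<in> sets (pspace (D n))" "\<And>n. F n \<subseteq> A n" "\<And>n \<omega>. \<omega> \<in> F n \<Longrightarrow> N \<le> n \<and> good n \<omega>"
    "\<And>n. N \<le> n \<Longrightarrow> measure (pspace (D n)) (A n) - \<kappa> n \<le> measure (pspace (D n)) (F n) \<and> measure (pspace (D n)) (F n) \<le> 1"
    by metis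
  have F1: "(\<lambda>n. measure (pspace (D n)) (F n)) \<longlonglongrightarrow> 1"
  proof (rule tendsto_sandwich[OF _ _ _ tendsto_const])
    show "(\<lambda>n. measure (pspace (D n)) (A n) - \<kappa> n) \<longlonglongrightarrow> 1" using tendsto_diff[OF A(3) \<kappa>0] by simp
  qed (use F(4) in \<open>auto simp: eventually_sequentially\<close>)
  \<comment> \<open>\<open>\<bar>C1\<bar> + 1\<close> is a positive constant whatever the sign of
    \<open>C1\<close>.\<close>
  have bound: "regret (D n) pbar (period n) (pstar n) (phat n \<omega>) \<le> (\<bar>C1\<bar> + 1) * ((real (s n))\<^sup>2 * l n / real n + (r1 n)\<^sup>2)"
    if \<omega>: "\<omega> \<in> F n" for n \<omega>
  proof -
    have n: "N \<le> n" and g: "good n \<omega>" using F(3)[OF \<omega>] by auto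
    note Nn = N[OF n]
    then have n1: "1 \<le> n" by blast
    interpret regular_instance pbar abar bbar \<zeta> n "D n" c C K "M\<epsilon> n" "M\<Psi> n" by (rule reg[OF n1])
    have err: "2 * \<bar>Wcheck n \<omega> k j - W k j\<bar> \<le> \<mu> n \<omega> k j \<and> \<mu> n \<omega> k j \<le> C\<^sub>0 * sqrt (l n / real n)" if "k \<in> X" "j \<in> X" for k j
      using A(2) F(2) \<omega> that by blast
    have "regret (D n) pbar (period n) (pstar n) (phat n \<omega>) \<le> C1 * ((real (s n))\<^sup>2 * l n / real n + (r1 n)\<^sup>2)"
      unfolding phat C1_def c0_def l_def
      by (rule regret_rate[OF _ period[OF n1] optimal[OF n1] interior[OF n1] approx[OF n1] err[unfolded l_def] _ _ Cv])
        (use Nn g in \<open>auto simp: l_def c0_def good_def\<close>)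
    also have "\<dots> \<le> (\<bar>C1\<bar> + 1) * ((real (s n))\<^sup>2 * l n / real n + (r1 n)\<^sup>2)"
      using Nn by (intro mult_right_mono add_nonneg_nonneg divide_nonneg_nonneg mult_nonneg_nonneg) (auto simp: l_def)
    finally show ?thesis .
  qed
  show ?thesis
  proof (intro exI[of _ "\<bar>C1\<bar> + 1"] conjI)
    show "whp (\<lambda>n. pspace (D n)) (\<lambda>n \<omega>. regret (D n) pbar (period n) (pstar n) (phat n \<omega>)
        \<le> (\<bar>C1\<bar> + 1) * ((real (s n))\<^sup>2 * ln (real (card (VO (D n)))) / real n + (r1 n)\<^sup>2))"
      unfolding whp_def using F(1) F1 bound unfolding l_def by blast
  qed simp
qed

end
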